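(* Let $n\ge1$, let $m$ be a positive integer or half-integer, and let $\eta$ be a vector of integers in $\mathcal A^{\tilde B_n}_m=\{(x_1,\dots,x_n): x_1>\dots>x_n>0,\ x_1+x_2<2m\}$. Put $$R_k=\left(\frac{\sin\frac{n\pi}{m}}{\sin\frac{\pi}{2m}}\right)^k\prod_{1\le h<t\le n}\left(\sin\frac{\pi(\eta_h-\eta_t)}{2m}\sin\frac{\pi(t-h)}{2m}\sin\frac{\pi(\eta_h+\eta_t)}{2m}\sin\frac{\pi(t+h)}{2m}\right)\prod_{h=1}^n\left(\sin\frac{\pi\eta_h}{2m}\sin\frac{\pi h}{2m}\right),$$ and for a real $c$ put $$A(c)=\prod_{h=1}^{2n}\frac{\sin\frac{\pi(c-n+h)}{4m}}{\sin\frac{\pi h}{4m}}\cdot B(c),\qquad B(c)=\prod_{h=1}^{n-1}\prod_{t=1}^n\frac{\sin\frac{\pi(c+t-h)}{2m}}{\sin\frac{\pi(n+t-h)}{2m}},\qquad D_h=\cos\frac{\pi(2h-1)}{4m}\sin\frac{\pi h}{2m}.$$ Then, as $k\to\infty$, the number of walks which start at $\eta$, consist of exactly $k$ standard steps (arbitrary end point), and stay in $\mathcal A^{\tilde B_n}_m$ is asymptotically: (a) if $m$ is an integer of the same parity as $n$: $$\frac{4^{n^2}}{2(2m)^n}R_k\Bigg(A(m)+A(m-1)+(-1)^{|\eta|+k+\binom{n+1}2}B(m)\prod_{h=1}^n\frac{\cos\frac{\pi(m-n+2h-1)}{4m}\sin\frac{\pi(m-n+2h)}{4m}}{D_h}+(-1)^{|\eta|+k+\binom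 n2}B(m-1)\prod_{h=1}^n\frac{\sin\frac{\pi(m-n+2h-2)}{4m}\cos\frac{\pi(m-n+2h-1)}{4m}}{D_h}\Bigg);$$ (b) if $m$ is an integer of parity different from that of $n$: $$\frac{4^{n^2}}{2(2m)^n}R_k\Bigg(A(m)+A(m-1)+(-1)^{|\eta|+k+\binom n2}B(m)\prod_{h=1}^n\frac{\sin\frac{\pi(m-n+2h-1)}{4m}\cos\frac{\pi(m-n+2h)}{4m}}{D_h}+(-1)^{|\eta|+k+\binom{n+1}2}B(m-1)\prod_{h=1}^n\frac{\cos\frac{\pi(m-n+2h-2)}{4m}\sin\frac{\pi(m-n+2h-1)}{4m}}{D_h}\Bigg);$$ (c) if $m$ is a half-integer: $\dfrac{4^{n^2}}{(2m)^n}R_kA(\lfloor m\rfloor)$.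
   Context: A half-integer is an odd integer divided by $2$; $\lfloor m\rfloor$ is the floor. For $\eta\in\mathbb R^n$, $|\eta|=\eta_1+\dots+\eta_n$. A walk with $k$ standard steps is a sequence $p_0,\dots,p_k$ with $p_i-p_{i-1}\in\{\pm e_1,\dots,\pm e_n\}$; it stays in $R$ if all $p_i\in R$. "Asymptotically $E$" means the ratio of the count to $E$ tends to $1$. *)

theory Defs
  imports "HOL-Analysis.Analysis" "HOL-Library.Landau_Symbols"
begin

text \<open>
  A vector of length \<open>n\<close> is a function on \<open>nat\<close> that vanishes outside \<open>{1..n}\<close>,
  so that the dimension can be an ordinary variable and the coordinates are numbered from 1.
\<close>

definition vectors :: "nat \<Rightarrow> (nat \<Rightarrow> 'a::zero) set" where
  "vectors n = {x. \<forall>i. i \<notin> {1..n} \<longrightarrow> x i = 0}"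

definition half_integer :: "real \<Rightarrow> bool" where
  "half_integer m \<longleftrightarrow> (\<exists>j::int. odd j \<and> m = of_int j / 2)"

text \<open>
  For \<open>n = 1\<close> the coordinate \<open>x 2\<close> is 0, so the alcove is the interval \<open>0 < x 1 < 2 * m\<close>.
\<close>

definition alcove_B :: "nat \<Rightarrow> real \<Rightarrow> (nat \<Rightarrow> real) set" where
  "alcove_B n m = {x \<in> vectors n.
     (\<forall>i\<in>{1..<n}. x i > x (Suc i)) \<and> x n > 0 \<and> x 1 + x 2 < 2 * m}"

definition standard_step :: "nat \<Rightarrow> (nat \<Rightarrow> real) \<Rightarrow> (nat \<Rightarrow> real) \<Rightarrow> bool" where
  "standard_step n p q \<longleftrightarrow> (\<exists>i\<in>{1..n}. q = p(i := p i + 1) \<or> q = p(i := p i - 1))"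

definition walks_within ::
    "nat \<Rightarrow> (nat \<Rightarrow> real) set \<Rightarrow> (nat \<Rightarrow> real) \<Rightarrow> nat \<Rightarrow> (nat \<Rightarrow> real) list set" where
  "walks_within n R x k = {p. length p = Suc k \<and> p ! 0 = x \<and>
     (\<forall>i<k. standard_step n (p ! i) (p ! Suc i)) \<and> set p \<subseteq> R}"

definition weight :: "nat \<Rightarrow> (nat \<Rightarrow> int) \<Rightarrow> int" where
  "weight n \<eta> = (\<Sum>i=1..n. \<eta> i)"

definition R_term :: "nat \<Rightarrow> real \<Rightarrow> (nat \<Rightarrow> int) \<Rightarrow> nat \<Rightarrow> real" where
  "R_term n m \<eta> k =
     (sin (real n * pi / m) / sin (pi / (2 * m))) ^ k *
     (\<Prod>h\<in>{1..n}. \<Prod>t\<in>{h<..n}.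
        sin (pi * (of_int (\<eta> h) - of_int (\<eta> t)) / (2 * m)) * sin (pi * (real t - real h) / (2 * m)) *
        sin (pi * (of_int (\<eta> h) + of_int (\<eta> t)) / (2 * m)) * sin (pi * (real t + real h) / (2 * m))) *
     (\<Prod>h\<in>{1..n}. sin (pi * of_int (\<eta> h) / (2 * m)) * sin (pi * real h / (2 * m)))"

definition B_term :: "nat \<Rightarrow> real \<Rightarrow> real \<Rightarrow> real" where
  "B_term n m c =
     (\<Prod>h\<in>{1..n-1}. \<Prod>t\<in>{1..n}.
        sin (pi * (c + real t - real h) / (2 * m)) /
        sin (pi * (real n + real t - real h) / (2 * m)))"

definition A_term :: "nat \<Rightarrow> real \<Rightarrow> real \<Rightarrow> real" where
  "A_term n m c =
     (\<Prod>h\<in>{1..2*n}. sin (pi * (c - real n + real h) / (4 * m)) / sin (pi * real h / (4 * m))) *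
     B_term n m c"

definition D_term :: "real \<Rightarrow> nat \<Rightarrow> real" where
  "D_term m h = cos (pi * (2 * real h - 1) / (4 * m)) * sin (pi * real h / (2 * m))"

end

(* The k-step counts in the alcove are diagonalised by the determinants d(u, x) = det (sin (pi u_h x_t / (2m)))
   with integral frequencies u_1, ..., u_n of equal parity: they vanish on every wall of the alcove, and summing
   over both parities they form a complete orthogonal system on its lattice points. The eigenvalue
   2 sum_h cos (pi u_h / (2m)) is largest in absolute value exactly for u = (1, 3, ..., 2n-1) and for its
   reflection 2m - u, up to permutation, so that only the sums of these two determinants over the alcove matter.

   Folding the alcove along x_1 = m reduces them to sums over c >= l_1 > ... > l_n >= 0, and for arbitrary y

     (sum_l det (sin (l_t y_h))) * det (sin ((j - 1/2) y_h))
       = det (sin (((c - n)/2 + j) y_h)) * det (sin (((c - n - 1)/2 + j) y_h)),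

   which follows from Macdonald's bounded sum of alternants det (x_h ^ l_t) by symmetrising over x_h -> 1/x_h.
   For y_h = (2h-1) pi / (2m), and for its reflection at pi, all these determinants are of Weyl denominator type
   and factor. *)

theory Submission
  imports Defs "Jordan_Normal_Form.Determinant"
begin

section \<open>Determinants given by entry functions\<close>

text \<open>Lattice points are integral and \<open>M = 2 * m\<close> is an integer, so a unit step
  cannot jump over a wall; this is what turns vanishing on the walls into a recursion for the
  counts. The reflection in x_1 + x_2 = M multiplies a sine of frequency u by a sign given by the
  parity of u, hence the demand for equal parity; distinct frequencies are then at least two apart,
  which leads to 1, 3, ..., 2n-1. The reflected frequencies have the opposite eigenvalue, so the
  leading term has period two in k and might vanish for one parity of k. This is excluded for M >
  2n: the weights of all alcove points are positive, and both parities of the coordinate sum occur.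
  For M = 2n the two frequency sets coincide, the leading eigenvalue contains sin pi, and both sides
  are 0 from k = 1 on. For even M the points on the fold belong to one half only, whence the two
  arguments m and m - 1; for odd M the two halves have equal range and opposite signed sums, so the
  oscillation disappears.\<close>

definition dt :: "nat \<Rightarrow> (nat \<Rightarrow> nat \<Rightarrow> 'a::comm_ring_1) \<Rightarrow> 'a" where
  "dt n f = det (mat n n (\<lambda>(i, j). f i j))"

lemma dt_Leibniz:
  "dt n f = (\<Sum>p | p permutes {0..<n}. signof p * (\<Prod>i = 0..<n. f i (p i)))"
proof -
  have "dt n f = (\<Sum>p | p permutes {0..<n}. signof p * (\<Prod>i = 0..<n. mat n n (\<lambda>(i, j). f i j) $$ (i, p i)))"
    unfolding dt_def by (rule det_def') simp
  also have "\<dots> = (\<Sum>p | p permutes {0..<n}. signof p * (\<Prod>i = 0..<n. f i (p i)))"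
    by (intro sum.cong refl arg_cong2[where f = "(*)"] prod.cong) (auto simp: permutes_in_image[of _ "{0..<n}", simplified])
  finally show ?thesis .
qed

lemma dt_cong:
  assumes "\<And>i j. i < n \<Longrightarrow> j < n \<Longrightarrow> f i j = g i j"
  shows "dt n f = dt n g"
  unfolding dt_def by (rule arg_cong[where f = det], rule eq_matI) (auto simp: assms)

lemma dt_0 [simp]: "dt 0 f = 1"
  unfolding dt_def by simp

lemma dt_row_scale: "dt n (\<lambda>i j. c i * f i j) = (\<Prod>i = 0..<n. c i) * dt n f"
  unfolding dt_Leibniz by (simp add: prod.distrib sum_distrib_left mult_ac)

lemma dt_col_scale: "dt n (\<lambda>i j. c j * f i j) = (\<Prod>j = 0..<n. c j) * dt n f"
proof -
  have "(\<Prod>i = 0..<n. c (p i) * f i (p i)) = (\<Prod>j = 0..<n. c j) * (\<Prod>i = 0..<n. f i (p i))"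
    if "p permutes {0..<n}" for p
    using prod.permute[OF that, of c] by (simp add: prod.distrib)
  then show ?thesis
    unfolding dt_Leibniz sum_distrib_left by (intro sum.cong refl) (simp add: mult_ac)
qed

lemma dt_permute_rows:
  assumes "p permutes {0..<n}"
  shows "dt n (\<lambda>i. f (p i)) = signof p * dt n f"
proof -
  have "dt n (\<lambda>i. f (p i)) = det (mat n n (\<lambda>(i, j). mat n n (\<lambda>(i, j). f i j) $$ (p i, j)))"
    unfolding dt_def using permutes_in_image[OF assms]
    by (intro arg_cong[where f = det] eq_matI) auto
  then show ?thesis
    unfolding dt_def by (simp add: det_permute_rows[OF _ assms])
qed

lemma dt_identical_rows:
  assumes "i < n" "j < n" "i \<noteq> j" "\<And>k. k < n \<Longrightarrow> f i k = f j k"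
  shows "dt n f = 0"
  unfolding dt_def
  by (rule det_identical_rows[of _ n i j]) (use assms in \<open>auto intro!: eq_vecI\<close>)

lemma dt_identical_cols:
  assumes "i < n" "j < n" "i \<noteq> j" "\<And>k. k < n \<Longrightarrow> f k i = f k j"
  shows "dt n f = 0"
  unfolding dt_def
  by (rule det_identical_columns[of _ n i j]) (use assms in \<open>auto intro!: eq_vecI\<close>)

lemma dt_proportional_cols:
  fixes f :: "nat \<Rightarrow> nat \<Rightarrow> 'a::comm_ring_1"
  assumes "i < n" "j < n" "i \<noteq> j" "\<And>k. k < n \<Longrightarrow> f k i = c * f k j"
  shows "dt n f = 0"
proof -
  define g where "g = (\<lambda>k l. if l = i then f k j else f k l)"
  have "dt n f = dt n (\<lambda>k l. (if l = i then c else 1) * g k l)"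
    by (rule dt_cong) (auto simp: g_def assms)
  also have "\<dots> = 0"
    unfolding dt_col_scale by (subst dt_identical_cols[of i n j]) (use assms in \<open>auto simp: g_def\<close>)
  finally show ?thesis .
qed

lemma dt_zero_col:
  assumes "j < n" "\<And>i. i < n \<Longrightarrow> f i j = 0"
  shows "dt n f = 0"
proof -
  have "dt n f = dt n (\<lambda>k l. (if l = j then 0 else 1) * f k l)"
    by (rule dt_cong) (use assms in auto)
  also have "\<dots> = 0"
    unfolding dt_col_scale using assms(1) by (auto intro!: prod_zero)
  finally show ?thesis .
qed

text \<open>With parts listed increasingly the last column carries the largest exponent, so this
  expansion is the step from \<open>Suc n\<close> variables to \<open>n\<close> of them;
  \<open>insert_index h\<close> enumerates the remaining rows in order.\<close>

lemma dt_Laplace_last: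
  "dt (Suc n) f = (\<Sum>h<Suc n. (-1) ^ (n - h) * f h n * dt n (\<lambda>i. f (insert_index h i)))"
proof -
  let ?A = "mat (Suc n) (Suc n) (\<lambda>(i, j). f i j)"
  have "det ?A = (\<Sum>h<Suc n. ?A $$ (h, n) * cofactor ?A h n)"
    by (rule laplace_expansion_column) auto
  also have "\<dots> = (\<Sum>h<Suc n. (-1) ^ (n - h) * f h n * dt n (\<lambda>i. f (insert_index h i)))"
  proof (rule sum.cong[OF refl])
    fix h assume h: "h \<in> {..<Suc n}"
    have "mat_delete ?A h n = mat n n (\<lambda>(i, j). f (insert_index h i) j)"
      using h by (intro eq_matI) (auto simp: mat_delete_def insert_index_def)
    moreover have "(-1 :: 'a) ^ (h + n) = (-1) ^ (n - h)"
      using h by (subst minus_one_power_iff, subst minus_one_power_iff) auto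
    ultimately show "?A $$ (h, n) * cofactor ?A h n = (-1) ^ (n - h) * f h n * dt n (\<lambda>i. f (insert_index h i))"
      using h by (simp add: cofactor_def dt_def mult_ac)
  qed
  finally show ?thesis by (simp add: dt_def)
qed

lemma dt_mult:
  "dt n (\<lambda>i j. \<Sum>k = 0..<n. f i k * g k j) = dt n f * dt n g"
proof -
  have "mat n n (\<lambda>(i, j). \<Sum>k = 0..<n. f i k * g k j) =
      mat n n (\<lambda>(i, j). f i j) * mat n n (\<lambda>(i, j). g i j)"
    by (intro eq_matI) (auto simp: scalar_prod_def)
  then show ?thesis
    unfolding dt_def by (simp add: det_mult[of _ n])
qed

lemma dt_upper_triangular:
  assumes "\<And>i j. j < i \<Longrightarrow> i < n \<Longrightarrow> g i j = 0"
  shows "dt n g = (\<Prod>j = 0..<n. g j j)"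
proof -
  have "dt n g = prod_list (diag_mat (mat n n (\<lambda>(i, j). g i j)))"
    unfolding dt_def by (rule det_upper_triangular[of _ n]) (use assms in \<open>auto simp: upper_triangular_def\<close>)
  also have "\<dots> = (\<Prod>j = 0..<n. g j j)"
  proof -
    have "diag_mat (mat n n (\<lambda>(i, j). g i j)) = map (\<lambda>j. g j j) [0..<n]"
      by (auto simp: diag_mat_def)
    then show ?thesis
      using prod.distinct_set_conv_list[of "[0..<n]" "\<lambda>j. g j j"] by simp
  qed
  finally show ?thesis .
qed

text \<open>The index set is arbitrary because the recursion for Macdonald's numerator deletes
  single indices from it.\<close>

definition pair_prod :: "nat set \<Rightarrow> (nat \<Rightarrow> nat \<Rightarrow> 'a::comm_monoid_mult) \<Rightarrow> 'a" where
  "pair_prod A F = (\<Prod>k\<in>A. \<Prod>h\<in>{h\<in>A. h < k}. F h k)"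

definition vdm :: "nat set \<Rightarrow> (nat \<Rightarrow> 'a::comm_ring_1) \<Rightarrow> 'a" where
  "vdm A t = pair_prod A (\<lambda>h k. t k - t h)"

text \<open>The matrix of values is the Vandermonde matrix times an upper triangular matrix of
  coefficients, so only the diagonal coefficients enter.\<close>

lemma dt_poly_lower:
  fixes z :: "nat \<Rightarrow> 'a::comm_ring_1"
  assumes "\<And>j. j < n \<Longrightarrow> degree (P j) \<le> j"
  shows "dt n (\<lambda>i j. poly (P j) (z i)) = (\<Prod>j = 0..<n. coeff (P j) j) * dt n (\<lambda>i j. z i ^ j)"
proof -
  have "dt n (\<lambda>i j. poly (P j) (z i)) = dt n (\<lambda>i j. \<Sum>k = 0..<n. z i ^ k * coeff (P j) k)"
  proof (rule dt_cong)
    fix i j assume "i < n" "j < n"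
    have "poly (P j) (z i) = (\<Sum>k\<le>degree (P j). coeff (P j) k * z i ^ k)"
      by (rule poly_altdef)
    also have "\<dots> = (\<Sum>k = 0..<n. coeff (P j) k * z i ^ k)"
      using assms[OF \<open>j < n\<close>] \<open>j < n\<close> by (intro sum.mono_neutral_left) (auto simp: coeff_eq_0)
    finally show "poly (P j) (z i) = (\<Sum>k = 0..<n. z i ^ k * coeff (P j) k)"
      by (simp add: mult.commute)
  qed
  also have "\<dots> = dt n (\<lambda>i j. z i ^ j) * dt n (\<lambda>k j. coeff (P j) k)"
    by (rule dt_mult)
  also have "dt n (\<lambda>k j. coeff (P j) k) = (\<Prod>j = 0..<n. coeff (P j) j)"
    by (rule dt_upper_triangular) (meson assms coeff_eq_0 le_less_trans less_trans)
  finally show ?thesis by (simp add: mult.commute)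
qed

lemma dt_Vandermonde:
  fixes z :: "nat \<Rightarrow> 'a::idom"
  shows "dt n (\<lambda>i j. z i ^ j) = vdm {0..<n} z"
proof (induction n)
  case 0
  then show ?case by (simp add: vdm_def pair_prod_def)
next
  case (Suc n)
  \<comment> \<open>The last column becomes the monic polynomial that vanishes at the first
    \<open>n\<close> nodes, which leaves the determinant unchanged and the expansion along that
    column with a single term.\<close>
  define P :: "nat \<Rightarrow> 'a poly" where
    "P j = (if j < n then monom 1 j else (\<Prod>h = 0..<n. [:- z h, 1:]))" for j
  have deg: "degree (\<Prod>h = 0..<n. [:- z h, 1:]) = n"
    by (subst degree_prod_eq_sum_degree) auto
  have lead: "coeff (\<Prod>h = 0..<n. [:- z h, 1:]) n = 1"
    using lead_coeff_prod[of "\<lambda>h. [:- z h, 1:]" "{0..<n}"] deg by simp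
  have "dt (Suc n) (\<lambda>i j. poly (P j) (z i)) = (\<Prod>j = 0..<Suc n. coeff (P j) j) * dt (Suc n) (\<lambda>i j. z i ^ j)"
    by (rule dt_poly_lower) (auto simp: P_def degree_monom_eq deg)
  also have "(\<Prod>j = 0..<Suc n. coeff (P j) j) = 1"
    by (simp add: P_def lead)
  finally have "dt (Suc n) (\<lambda>i j. z i ^ j) = dt (Suc n) (\<lambda>i j. poly (P j) (z i))"
    by simp
  also have "\<dots> = (\<Sum>h<Suc n. (-1) ^ (n - h) * poly (P n) (z h) * dt n (\<lambda>i j. poly (P j) (z (insert_index h i))))"
    by (rule dt_Laplace_last)
  also have "\<dots> = (\<Sum>h\<in>{n}. (-1) ^ (n - h) * poly (P n) (z h) * dt n (\<lambda>i j. poly (P j) (z (insert_index h i))))"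
    by (rule sum.mono_neutral_right) (auto simp: P_def poly_prod)
  also have "\<dots> = (\<Prod>h = 0..<n. z n - z h) * dt n (\<lambda>i j. z i ^ j)"
    by (auto simp: P_def poly_prod insert_index_def poly_monom intro!: dt_cong)
  also have "\<dots> = vdm {0..<Suc n} z"
    unfolding Suc.IH vdm_def pair_prod_def
    by (simp add: mult.commute) (intro arg_cong2[where f = "(*)"] prod.cong; auto)
  finally show ?case .
qed

section \<open>Lagrange interpolation and a partial fraction identity\<close>

lemma sum_Lagrange_coeff:
  fixes p :: "'a::field poly"
  assumes "finite S" "degree p < card S"
  shows "(\<Sum>s\<in>S. poly p s / (\<Prod>r\<in>S - {s}. s - r)) = coeff p (card S - 1)"
proof -
  \<comment> \<open>The Lagrange interpolant of \<open>p\<close> on \<open>S\<close>; the products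
    in it are monic of degree \<open>card S - 1\<close>, so its top coefficient is the sum in
    question.\<close>
  define q where "q = (\<Sum>s\<in>S. Polynomial.smult (poly p s / (\<Prod>r\<in>S - {s}. s - r)) (\<Prod>r\<in>S - {s}. [:- r, 1:]))"
  have deg: "degree (\<Prod>r\<in>S - {s}. [:- r, 1:]) = card S - 1" if "s \<in> S" for s
    using that assms(1) by (subst degree_prod_eq_sum_degree) auto
  have lead: "coeff (\<Prod>r\<in>S - {s}. [:- r, 1:]) (card S - 1) = 1" if "s \<in> S" for s
    using lead_coeff_prod[of "\<lambda>r. [:- r, 1:]" "S - {s}"] deg[OF that] by simp
  have "degree q \<le> card S - 1"
    unfolding q_def using assms(1) by (intro degree_sum_le) (auto intro: order.trans[OF degree_smult_le] simp: deg)
  then have "degree (p - q) < card S"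
    using assms(2) by (intro le_less_trans[OF degree_diff_le_max]) auto
  moreover have "poly (p - q) t = 0" if "t \<in> S" for t
  proof -
    have "poly q t = (\<Sum>s\<in>S. poly p s / (\<Prod>r\<in>S - {s}. s - r) * (\<Prod>r\<in>S - {s}. t - r))"
      by (simp add: q_def poly_sum poly_prod)
    also have "\<dots> = (\<Sum>s\<in>{t}. poly p s / (\<Prod>r\<in>S - {s}. s - r) * (\<Prod>r\<in>S - {s}. t - r))"
      using that assms(1) by (intro sum.mono_neutral_right) auto
    also have "\<dots> = poly p t"
      using assms(1) by simp
    finally show ?thesis by simp
  qed
  ultimately have "p - q = 0"
    using card_poly_roots_bound[of "p - q"] card_mono[of "{t. poly (p - q) t = 0}" S] poly_roots_finite[of "p - q"]
    by (metis (mono_tags, lifting) leD mem_Collect_eq order.strict_trans1 subsetI)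
  then have "coeff p (card S - 1) = coeff q (card S - 1)" by simp
  also have "\<dots> = (\<Sum>s\<in>S. poly p s / (\<Prod>r\<in>S - {s}. s - r))"
    unfolding q_def coeff_sum by (intro sum.cong refl) (simp add: lead del: One_nat_def)
  finally show ?thesis by simp
qed

lemma mult_divide_cancel_involution:
  fixes a b e :: "'a::field"
  assumes "e * e = 1" "b \<noteq> 0" "q \<noteq> 0"
  shows "a * b * p / (b * (e * q)) = e * (a * (p / q))"
proof -
  have "e \<noteq> 0" using assms(1) by auto
  then have "1 / e = e" using assms(1) by (simp add: field_simps)
  then have "p / (e * q) = e * (p / q)" by (metis divide_divide_eq_left mult.commute times_divide_eq_right mult_1)
  then have "a * (p / (e * q)) = e * (a * (p / q))" by simp
  then show ?thesis using assms(2) by simp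
qed

text \<open>Lagrange interpolation of the product of the factors 1 - x_k X at the nodes x_h and the
  extra node -1. At x_h the numerator contains 1 - x_h^2, whose factor 1 + x_h cancels against the
  distance to the extra node. The node -1 itself gives the constant 1, and the leading coefficient
  gives the product.\<close>

lemma partial_fraction_identity:
  fixes x :: "nat \<Rightarrow> 'a::field"
  assumes "finite I" "inj_on x I" "\<And>h. h \<in> I \<Longrightarrow> x h \<noteq> -1"
  shows "(\<Sum>h\<in>I. (1 - x h) * (\<Prod>k\<in>I - {h}. (1 - x h * x k) / (x k - x h))) = 1 - (\<Prod>h\<in>I. x h)"
proof -
  define p where "p = (\<Prod>k\<in>I. [:1, - x k:])"
  define S where "S = insert (-1) (x ` I)"
  have notin: "-1 \<notin> x ` I" using assms(3) by fastforce
  have card: "card S = Suc (card I)"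
    unfolding S_def using assms notin by (simp add: card_image)
  have degp: "degree p \<le> card I"
    unfolding p_def by (rule order.trans[OF degree_prod_sum_le[OF assms(1)]]) (rule sum_bounded_above[THEN order.trans], auto)
  have coeffp: "coeff p (card I) = (-1) ^ card I * (\<Prod>k\<in>I. x k)"
    unfolding p_def using assms(1)
  proof (induction I rule: finite_induct)
    case (insert k F)
    have "degree (\<Prod>k\<in>F. [:1, - x k:]) \<le> card F"
      by (rule order.trans[OF degree_prod_sum_le[OF insert(1)]]) (rule sum_bounded_above[THEN order.trans], auto)
    then show ?case using insert by (simp add: coeff_eq_0)
  qed simp
  have "coeff p (card I) = (\<Sum>s\<in>S. poly p s / (\<Prod>r\<in>S - {s}. s - r))"
    using sum_Lagrange_coeff[of S p] degp card assms(1) by (simp add: S_def)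
  also have "\<dots> = poly p (-1) / (\<Prod>r\<in>x ` I. -1 - r) + (\<Sum>s\<in>x ` I. poly p s / (\<Prod>r\<in>S - {s}. s - r))"
    unfolding S_def using assms(1) notin by simp
  also have "poly p (-1) / (\<Prod>r\<in>x ` I. -1 - r) = (-1) ^ card I"
  proof -
    have "(\<Prod>r\<in>x ` I. -1 - r) = (\<Prod>k\<in>I. (-1) * (1 + x k))"
      using assms(2) by (simp add: prod.reindex algebra_simps)
    also have "\<dots> = (-1) ^ card I * poly p (-1)"
      unfolding prod.distrib by (simp add: p_def poly_prod)
    finally have *: "(\<Prod>r\<in>x ` I. -1 - r) = (-1) ^ card I * poly p (-1)" .
    have "poly p (-1) \<noteq> 0"
      using assms(1,3) by (auto simp: p_def poly_prod add_eq_0_iff)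
    then show ?thesis unfolding * by (simp add: power_mult_distrib[symmetric] field_simps flip: power_add)
  qed
  also have "(\<Sum>s\<in>x ` I. poly p s / (\<Prod>r\<in>S - {s}. s - r)) =
      (\<Sum>h\<in>I. (-1) ^ (card I - 1) * ((1 - x h) * (\<Prod>k\<in>I - {h}. (1 - x h * x k) / (x k - x h))))"
    unfolding sum.reindex[OF assms(2)] o_def
  proof (rule sum.cong[OF refl])
    fix h assume h: "h \<in> I"
    have "S - {x h} = insert (-1) (x ` (I - {h}))"
      unfolding S_def using h assms(2,3) by (auto simp: inj_on_def) force
    then have "(\<Prod>r\<in>S - {x h}. x h - r) = (x h + 1) * (\<Prod>k\<in>I - {h}. x h - x k)"
      using assms(1,2) notin by (simp add: prod.reindex inj_on_diff image_iff)
    moreover have "poly p (x h) = (1 - x h * x h) * (\<Prod>k\<in>I - {h}. 1 - x h * x k)"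
      unfolding p_def poly_prod using assms(1) h by (subst prod.remove[of _ h]) (auto simp: algebra_simps)
    moreover have "(\<Prod>k\<in>I - {h}. x h - x k) = (-1) ^ (card I - 1) * (\<Prod>k\<in>I - {h}. x k - x h)"
    proof -
      have "(\<Prod>k\<in>I - {h}. x h - x k) = (\<Prod>k\<in>I - {h}. (-1) * (x k - x h))" by simp
      then show ?thesis unfolding prod.distrib using assms(1) h by simp
    qed
    moreover have "x h + 1 \<noteq> 0" using assms(3)[OF h] by (simp add: add_eq_0_iff2)
    moreover have "(1 - x h * x h) = (1 - x h) * (x h + 1)" by (simp add: algebra_simps)
    moreover have "(\<Prod>k\<in>I - {h}. x k - x h) \<noteq> 0"
      using assms(1,2) h by (auto simp: inj_on_def)
    ultimately show "poly p (x h) / (\<Prod>r\<in>S - {x h}. x h - r) =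
      (-1) ^ (card I - 1) * ((1 - x h) * (\<Prod>k\<in>I - {h}. (1 - x h * x k) / (x k - x h)))"
      by (simp only: prod_dividef) (rule mult_divide_cancel_involution, simp_all flip: power_add mult_2)
  qed
  finally have eq: "(-1) ^ card I * (\<Prod>k\<in>I. x k) = (-1) ^ card I +
      (-1) ^ (card I - 1) * (\<Sum>h\<in>I. (1 - x h) * (\<Prod>k\<in>I - {h}. (1 - x h * x k) / (x k - x h)))"
    by (simp add: coeffp sum_distrib_left)
  \<comment> \<open>\<open>card I - 1\<close> is truncated for empty \<open>I\<close>, where both
    sides are 0.\<close>
  show ?thesis
  proof (cases "card I")
    case 0
    then show ?thesis using assms(1) by simp
  next
    case (Suc r)
    then have "(-1) ^ r * (\<Sum>h\<in>I. (1 - x h) * (\<Prod>k\<in>I - {h}. (1 - x h * x k) / (x k - x h))) =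
      (-1) ^ r * (1 - (\<Prod>k\<in>I. x k))"
      using eq by (simp add: algebra_simps)
    then show ?thesis by simp
  qed
qed

section \<open>The bounded alternant sum\<close>

lemma pair_prod_cong:
  assumes "\<And>h k. h \<in> A \<Longrightarrow> k \<in> A \<Longrightarrow> h < k \<Longrightarrow> F h k = G h k"
  shows "pair_prod A F = pair_prod A G"
  unfolding pair_prod_def by (intro prod.cong refl) (auto simp: assms)

lemma pair_prod_insert:
  assumes "finite B" "a \<notin> B"
  shows "pair_prod (insert a B) F = pair_prod B F * (\<Prod>k\<in>B. if k < a then F k a else F a k)"
proof -
  have A: "(\<Prod>h\<in>{h\<in>insert a B. h < a}. F h a) = (\<Prod>k\<in>B. if k < a then F k a else 1)"
    by (subst prod.inter_filter[symmetric]) (use assms in \<open>auto intro: prod.cong\<close>)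
  have B: "(\<Prod>h\<in>{h\<in>insert a B. h < k}. F h k) = (\<Prod>h\<in>{h\<in>B. h < k}. F h k) * (if k < a then 1 else F a k)"
    if "k \<in> B" for k
  proof (cases "k < a")
    case True
    then have "{h\<in>insert a B. h < k} = {h\<in>B. h < k}" by auto
    then show ?thesis using True by simp
  next
    case False
    have "a < k" using False that assms(2) by (metis linorder_neqE_nat)
    then have "{h\<in>insert a B. h < k} = insert a {h\<in>B. h < k}" by auto
    then show ?thesis using False assms by (simp add: mult.commute)
  qed
  have "pair_prod (insert a B) F = (\<Prod>h\<in>{h\<in>insert a B. h < a}. F h a) *
      (\<Prod>k\<in>B. \<Prod>h\<in>{h\<in>insert a B. h < k}. F h k)"
    unfolding pair_prod_def by (rule prod.insert) (use assms in auto)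
  also have "(\<Prod>k\<in>B. \<Prod>h\<in>{h\<in>insert a B. h < k}. F h k) =
      (\<Prod>k\<in>B. (\<Prod>h\<in>{h\<in>B. h < k}. F h k) * (if k < a then 1 else F a k))"
    by (intro prod.cong refl B)
  also have "\<dots> = pair_prod B F * (\<Prod>k\<in>B. if k < a then 1 else F a k)"
    by (simp add: pair_prod_def prod.distrib)
  finally show ?thesis
    unfolding A by (simp add: mult_ac flip: prod.distrib) (auto intro!: arg_cong2[where f = "(*)"] prod.cong)
qed

lemma pair_prod_remove:
  assumes "finite A" "a \<in> A"
  shows "pair_prod A F = pair_prod (A - {a}) F * (\<Prod>k\<in>A - {a}. if k < a then F k a else F a k)"
  using pair_prod_insert[of "A - {a}" a F] assms by (simp add: insert_absorb)

lemma pair_prod_reindex: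
  assumes "strict_mono_on A f"
  shows "pair_prod (f ` A) F = pair_prod A (\<lambda>h k. F (f h) (f k))"
proof -
  have inj: "inj_on f A" using assms by (rule strict_mono_on_imp_inj_on)
  have "(\<Prod>h\<in>{h \<in> f ` A. h < f k}. F h (f k)) = (\<Prod>h\<in>{h\<in>A. h < k}. F (f h) (f k))" if "k \<in> A" for k
  proof -
    have "{h \<in> f ` A. h < f k} = f ` {h\<in>A. h < k}"
      using assms that by (auto simp: strict_mono_on_less)
    then show ?thesis by (simp add: prod.reindex inj_on_subset[OF inj])
  qed
  then show ?thesis
    unfolding pair_prod_def by (simp add: prod.reindex[OF inj])
qed

text \<open>The sign counts the indices above \<open>a\<close>; on an initial segment this is the
  cofactor sign of the expansion along the last column.\<close>

lemma vdm_remove: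
  assumes "finite A" "a \<in> A"
  shows "vdm A t = (-1) ^ card {k\<in>A. a < k} * vdm (A - {a}) t * (\<Prod>k\<in>A - {a}. t a - t k)"
proof -
  have "(\<Prod>k\<in>A - {a}. if k < a then t a - t k else t k - t a) =
      (\<Prod>k\<in>A - {a}. (if a < k then -1 else 1) * (t a - t k))"
    by (intro prod.cong) auto
  also have "\<dots> = (-1) ^ card {k\<in>A - {a}. a < k} * (\<Prod>k\<in>A - {a}. t a - t k)"
    unfolding prod.distrib by (subst prod.inter_filter[symmetric]) (use assms in auto)
  also have "{k\<in>A - {a}. a < k} = {k\<in>A. a < k}" by auto
  finally show ?thesis
    unfolding vdm_def by (simp add: pair_prod_remove[OF assms] mult_ac)
qed

text \<open>Partitions with distinct parts, listed increasingly and padded by zeros. Throughout, lattice points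
  of the alcove are listed in this order too, from index 0, while the alcove itself lists them
  decreasingly from index 1.\<close>

definition incs :: "nat \<Rightarrow> nat \<Rightarrow> (nat \<Rightarrow> nat) set" where
  "incs n M = {f. (\<forall>i\<ge>n. f i = 0) \<and> (\<forall>i<n. f i < M) \<and> (\<forall>i. Suc i < n \<longrightarrow> f i < f (Suc i))}"

lemma incs_strict_mono:
  assumes "f \<in> incs n M" "i < j" "j < n"
  shows "f i < f j"
  using assms(2,3)
proof (induction j)
  case (Suc j)
  have "f j < f (Suc j)" using assms(1) Suc.prems by (auto simp: incs_def)
  then show ?case using Suc by (cases "i = j") auto
qed simp

lemma incs_0 [simp]: "incs 0 M = {\<lambda>_. 0}"
  by (auto simp: incs_def)

lemma incs_Suc_0 [simp]: "incs (Suc n) 0 = {}"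
  by (auto simp: incs_def)

lemma incs_Suc_Suc:
  "incs (Suc n) (Suc M) = incs (Suc n) M \<union> (\<lambda>f. f(n := M)) ` incs n M"
proof (intro equalityI subsetI)
  fix f assume f: "f \<in> incs (Suc n) (Suc M)"
  show "f \<in> incs (Suc n) M \<union> (\<lambda>f. f(n := M)) ` incs n M"
  proof (cases "f n = M")
    case True
    have "f(n := 0) \<in> incs n M"
      using f True incs_strict_mono[OF f, of _ n] by (auto simp: incs_def)
    moreover have "f = (f(n := 0))(n := M)" using True by auto
    ultimately show ?thesis by blast
  next
    case False
    then have "f n < M" using f by (auto simp: incs_def less_Suc_eq)
    moreover have "f i < M" if "i < n" for i
      using incs_strict_mono[OF f, of i n] that \<open>f n < M\<close> by auto
    ultimately show ?thesis using f by (auto simp: incs_def less_Suc_eq)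
  qed
next
  fix f assume "f \<in> incs (Suc n) M \<union> (\<lambda>f. f(n := M)) ` incs n M"
  then show "f \<in> incs (Suc n) (Suc M)"
    by (auto simp: incs_def less_Suc_eq)
qed

lemma finite_incs [simp]: "finite (incs n M)"
proof (induction M arbitrary: n)
  case 0
  then show ?case by (cases n) auto
next
  case (Suc M)
  then show ?case by (cases n) (auto simp: incs_Suc_Suc)
qed

lemma sum_incs_Suc_Suc:
  "sum F (incs (Suc n) (Suc M)) = sum F (incs (Suc n) M) + (\<Sum>f\<in>incs n M. F (f(n := M)))"
proof -
  have "inj_on (\<lambda>f. f(n := M)) (incs n M)"
  proof (rule inj_onI)
    fix f g assume "f \<in> incs n M" "g \<in> incs n M" and eq: "f(n := M) = g(n := M)"
    then have "f n = g n" by (auto simp: incs_def)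
    with eq show "f = g" by (metis fun_upd_triv fun_upd_upd)
  qed
  moreover have "incs (Suc n) M \<inter> (\<lambda>f. f(n := M)) ` incs n M = {}"
    by (auto simp: incs_def)
  ultimately show ?thesis
    unfolding incs_Suc_Suc by (subst sum.union_disjoint) (auto simp: sum.reindex)
qed

text \<open>At this bound the alternant sum degenerates to one Vandermonde determinant. Comparison
  with this case eliminates the Weyl denominator in \<open>sine_sum_product\<close>.\<close>

lemma incs_self: "incs n n = {\<lambda>i. if i < n then i else 0}"
proof (induction n)
  case (Suc n)
  have "incs (Suc n) n = {}"
  proof (rule ccontr)
    assume "incs (Suc n) n \<noteq> {}"
    then obtain f where f: "f \<in> incs (Suc n) n" by blast
    have "inj_on f {0..<Suc n}"
      using incs_strict_mono[OF f] by (intro linorder_inj_onI) (auto, metis less_Suc_eq less_irrefl nat_less_le)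
    moreover have "f ` {0..<Suc n} \<subseteq> {0..<n}" using f by (auto simp: incs_def)
    ultimately show False using card_inj_on_le[of f "{0..<Suc n}" "{0..<n}"] by simp
  qed
  then show ?case unfolding incs_Suc_Suc Suc.IH by auto
qed auto

definition alt_sum :: "nat \<Rightarrow> nat \<Rightarrow> (nat \<Rightarrow> 'a::comm_ring_1) \<Rightarrow> 'a" where
  "alt_sum n M x = (\<Sum>f\<in>incs n M. dt n (\<lambda>h t. x h ^ f t))"

lemma alt_sum_Suc_Suc:
  "alt_sum (Suc n) (Suc M) x = alt_sum (Suc n) M x +
     (\<Sum>h<Suc n. (-1) ^ (n - h) * x h ^ M * alt_sum n M (\<lambda>i. x (insert_index h i)))"
proof -
  have "dt (Suc n) (\<lambda>h t. x h ^ (f(n := M)) t) =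
      (\<Sum>h<Suc n. (-1) ^ (n - h) * x h ^ M * dt n (\<lambda>i j. x (insert_index h i) ^ f j))" for f
    unfolding dt_Laplace_last
    by (intro sum.cong refl arg_cong2[where f = "(*)"] dt_cong) auto
  then have "(\<Sum>f\<in>incs n M. dt (Suc n) (\<lambda>h t. x h ^ (f(n := M)) t)) =
      (\<Sum>h<Suc n. (-1) ^ (n - h) * x h ^ M * alt_sum n M (\<lambda>i. x (insert_index h i)))"
    unfolding alt_sum_def sum_distrib_left by (simp only:) (rule sum.swap)
  then show ?thesis
    unfolding alt_sum_def sum_incs_Suc_Suc by simp
qed

definition flip_inv :: "nat set \<Rightarrow> (nat \<Rightarrow> 'a::field) \<Rightarrow> nat \<Rightarrow> 'a" where
  "flip_inv I x h = (if h \<in> I then inverse (x h) else x h)"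

text \<open>The Weyl denominator of type B, up to normalisation, with its Vandermonde factor
  removed.\<close>

definition weyl_den :: "nat set \<Rightarrow> (nat \<Rightarrow> 'a::comm_ring_1) \<Rightarrow> 'a" where
  "weyl_den A x = (\<Prod>h\<in>A. 1 - x h) * pair_prod A (\<lambda>h k. 1 - x h * x k)"

lemma weyl_den_remove:
  assumes "finite A" "a \<in> A"
  shows "weyl_den A x = weyl_den (A - {a}) x * ((1 - x a) * (\<Prod>k\<in>A - {a}. 1 - x a * x k))"
proof -
  have "(\<Prod>k\<in>A - {a}. if k < a then 1 - x k * x a else 1 - x a * x k) = (\<Prod>k\<in>A - {a}. 1 - x a * x k)"
    by (intro prod.cong) (auto simp: mult.commute)
  then show ?thesis
    unfolding weyl_den_def pair_prod_remove[OF assms] prod.remove[OF assms] by (simp only: mult_ac)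
qed

text \<open>The numerator \<open>det (x\<^sub>h ^ j - x\<^sub>h ^ (M + n - 1 - j))\<close> of Macdonald's formula, expanded over the set \<open>I\<close>
  of rows that contribute the second summand.\<close>

definition weyl_num :: "nat set \<Rightarrow> nat \<Rightarrow> (nat \<Rightarrow> 'a::field) \<Rightarrow> 'a" where
  "weyl_num A M x = (\<Sum>I\<in>Pow A. (\<Prod>i\<in>I. - (x i ^ (M + card A - 1))) * vdm A (flip_inv I x))"

lemma weyl_den_reindex:
  assumes "strict_mono_on A f"
  shows "weyl_den (f ` A) x = weyl_den A (\<lambda>i. x (f i))"
  unfolding weyl_den_def pair_prod_reindex[OF assms]
  by (simp add: prod.reindex strict_mono_on_imp_inj_on[OF assms])

text \<open>Bridges two conventions: \<open>weyl_num_Suc\<close> deletes an index from the set of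
  rows, while \<open>alt_sum_Suc_Suc\<close> renumbers the remaining rows to an initial
  segment.\<close>

lemma weyl_num_reindex:
  assumes "strict_mono_on A f"
  shows "weyl_num (f ` A) M x = weyl_num A M (\<lambda>i. x (f i))"
proof -
  have inj: "inj_on f A" using assms by (rule strict_mono_on_imp_inj_on)
  have "Pow (f ` A) = image f ` Pow A" by (rule image_Pow_surj[OF refl, symmetric])
  moreover have "inj_on (image f) (Pow A)" using inj by (rule inj_on_image_Pow)
  moreover have "vdm (f ` A) (flip_inv (f ` I) x) = vdm A (flip_inv I (\<lambda>i. x (f i)))" if "I \<subseteq> A" for I
  proof -
    have "f h \<in> f ` I \<longleftrightarrow> h \<in> I" if "h \<in> A" for h
      using inj that \<open>I \<subseteq> A\<close> by (auto simp: inj_on_def)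
    then show ?thesis
      unfolding vdm_def pair_prod_reindex[OF assms] by (intro pair_prod_cong) (auto simp: flip_inv_def)
  qed
  moreover have "(\<Prod>i\<in>f ` I. - (x i ^ m)) = (\<Prod>i\<in>I. - (x (f i) ^ m))" if "I \<subseteq> A" for I m
    using inj_on_subset[OF inj that] by (simp add: prod.reindex)
  ultimately show ?thesis
    unfolding weyl_num_def card_image[OF inj] by (simp add: sum.reindex)
qed

lemma dt_add_rows:
  "dt n (\<lambda>h t. a h t + b h t) = (\<Sum>I\<in>Pow {0..<n}. dt n (\<lambda>h t. if h \<in> I then a h t else b h t))"
proof -
  have "(\<Prod>h = 0..<n. a h (p h) + b h (p h)) =
      (\<Sum>I\<in>Pow {0..<n}. \<Prod>h = 0..<n. if h \<in> I then a h (p h) else b h (p h))" for p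
    by (subst prod_add) (auto simp: prod.If_cases Int_absorb1 Diff_eq intro!: sum.cong)
  then show ?thesis
    unfolding dt_Leibniz by (simp only: sum_distrib_left) (rule sum.swap)
qed

lemma dt_sub_reflect_eq_weyl_num:
  fixes x :: "nat \<Rightarrow> 'a::field"
  assumes "\<And>h. h < n \<Longrightarrow> x h \<noteq> 0"
  shows "dt n (\<lambda>h j. x h ^ j - x h ^ (M + n - 1 - j)) = weyl_num {0..<n} M x"
proof -
  let ?K = "M + n - 1"
  have "dt n (\<lambda>h j. x h ^ j - x h ^ (?K - j)) = dt n (\<lambda>h j. - (x h ^ ?K) * inverse (x h) ^ j + x h ^ j)"
  proof (rule dt_cong)
    fix h j assume "h < n" "j < n"
    then have "x h ^ ?K = x h ^ (?K - j) * x h ^ j" by (simp flip: power_add)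
    then show "x h ^ j - x h ^ (?K - j) = - (x h ^ ?K) * inverse (x h) ^ j + x h ^ j"
      using assms[OF \<open>h < n\<close>] by (simp add: power_inverse)
  qed
  also have "\<dots> = (\<Sum>I\<in>Pow {0..<n}. dt n (\<lambda>h j. (if h \<in> I then - (x h ^ ?K) else 1) * flip_inv I x h ^ j))"
    unfolding dt_add_rows by (intro sum.cong refl dt_cong) (auto simp: flip_inv_def)
  also have "\<dots> = weyl_num {0..<n} M x"
    unfolding dt_row_scale dt_Vandermonde weyl_num_def
    by (intro sum.cong refl) (auto simp: prod.If_cases Int_absorb1)
  finally show ?thesis .
qed

text \<open>For \<open>M = 0\<close> the columns \<open>j\<close> and \<open>n - 1 - j\<close> of
  Macdonald's numerator are negatives of each other. For \<open>n = 1\<close> they are the same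
  column, which is therefore zero.\<close>

lemma weyl_num_0:
  fixes x :: "nat \<Rightarrow> 'a::field"
  assumes "n > 0" "\<And>h. h < n \<Longrightarrow> x h \<noteq> 0"
  shows "weyl_num {0..<n} 0 x = 0"
proof -
  have "dt n (\<lambda>h j. x h ^ j - x h ^ (0 + n - 1 - j)) = 0"
  proof (cases "n = 1")
    case True
    then show ?thesis by (intro dt_zero_col[of 0]) auto
  next
    case False
    then show ?thesis using assms(1)
      by (intro dt_proportional_cols[of "n - 1" n 0 _ "-1"]) auto
  qed
  then show ?thesis using dt_sub_reflect_eq_weyl_num[of n x 0] assms(2) by simp
qed

text \<open>The recursion in \<open>M\<close> obeyed by the alternant sums holds separately for each \<open>I\<close>, where all factors
  pairing \<open>I\<close> with its complement cancel and the partial fraction identity remains.\<close>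

lemma weyl_num_Suc:
  fixes x :: "nat \<Rightarrow> 'a::field"
  assumes "finite A" "inj_on x A" and x: "\<And>h. h \<in> A \<Longrightarrow> x h \<noteq> 0 \<and> x h \<noteq> -1"
  shows "weyl_num A (Suc M) x = weyl_num A M x +
    (\<Sum>h\<in>A. (-1) ^ card {k\<in>A. h < k} * x h ^ M * (weyl_num (A - {h}) M x *
       ((1 - x h) * (\<Prod>k\<in>A - {h}. 1 - x h * x k))))"
proof -
  \<comment> \<open>The summand of row \<open>h\<close> for a subset \<open>J\<close> of the other
    rows. It will be grouped with all pairs that have the same set
    \<open>insert h J\<close>.\<close>
  define T where "T h J = (-1) ^ card {k\<in>A. h < k} * x h ^ M *
     ((\<Prod>i\<in>J. - (x i ^ (M + card (A - {h}) - 1))) * vdm (A - {h}) (flip_inv J x) *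
       ((1 - x h) * (\<Prod>k\<in>A - {h}. 1 - x h * x k)))" for h J
  let ?m = "M + card A - 1"
  \<comment> \<open>\<open>I\<close> plays the role of \<open>insert h J\<close>. The terms with
    fixed \<open>I\<close> add up to the difference between the summands of \<open>I\<close> in
    \<open>weyl_num\<close> at \<open>Suc M\<close> and at \<open>M\<close>.\<close>
  have per_set: "(\<Sum>h\<in>I. T h (I - {h})) = (\<Prod>i\<in>I. - (x i ^ ?m)) * ((\<Prod>i\<in>I. x i) - 1) * vdm A (flip_inv I x)"
    if I: "I \<subseteq> A" for I
  proof -
    have finI: "finite I" using I assms(1) finite_subset by blast
    have "T h (I - {h}) = - ((\<Prod>i\<in>I. - (x i ^ ?m)) * vdm A (flip_inv I x)) *
        ((1 - x h) * (\<Prod>k\<in>I - {h}. (1 - x h * x k) / (x k - x h)))" if h: "h \<in> I" for h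
    proof -
      have hA: "h \<in> A" using h I by auto
      have nz: "x h \<noteq> 0" using x[OF hA] by simp
      have cA: "card A \<ge> 1" using hA assms(1) by (metis One_nat_def Suc_leI card_gt_0_iff empty_iff)
      let ?t = "flip_inv I x"
      have 1: "vdm (A - {h}) (flip_inv (I - {h}) x) = vdm (A - {h}) ?t"
        unfolding vdm_def by (intro pair_prod_cong) (auto simp: flip_inv_def)
      have split: "prod F (A - {h}) = prod F (I - {h}) * prod F (A - I)" for F :: "nat \<Rightarrow> 'a"
      proof -
        have "A - {h} = (I - {h}) \<union> (A - I)" using h I by auto
        moreover have "(I - {h}) \<inter> (A - I) = {}" by auto
        ultimately show ?thesis using finI assms(1) by (simp add: prod.union_disjoint)
      qed
      \<comment> \<open>For \<open>k\<close> outside \<open>I\<close> the flipped values are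
        \<open>1 / x h\<close> and \<open>x k\<close>, so the factor \<open>1 - x h * x k\<close> is
        \<open>x h\<close> times a factor of the Vandermonde product.\<close>
      have 2: "(\<Prod>k\<in>A - I. 1 - x h * x k) = x h ^ card (A - I) * (\<Prod>k\<in>A - I. ?t h - ?t k)"
      proof -
        have "(\<Prod>k\<in>A - I. 1 - x h * x k) = (\<Prod>k\<in>A - I. x h * (?t h - ?t k))"
          by (intro prod.cong refl) (use h nz in \<open>auto simp: flip_inv_def field_simps\<close>)
        then show ?thesis by (simp add: prod.distrib)
      qed
      \<comment> \<open>For \<open>k\<close> inside \<open>I\<close> both values are flipped and
        their difference is \<open>(x k - x h) / (x h * x k)\<close>; exchanging it for
        \<open>1 - x h * x k\<close> leaves the quotient of the partial fraction identity.\<close>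
      have 3: "(\<Prod>k\<in>I - {h}. 1 - x h * x k) = x h ^ card (I - {h}) * (\<Prod>k\<in>I - {h}. x k) *
          (\<Prod>k\<in>I - {h}. ?t h - ?t k) * (\<Prod>k\<in>I - {h}. (1 - x h * x k) / (x k - x h))"
      proof -
        have "(\<Prod>k\<in>I - {h}. 1 - x h * x k) =
            (\<Prod>k\<in>I - {h}. x h * x k * (?t h - ?t k) * ((1 - x h * x k) / (x k - x h)))"
        proof (rule prod.cong[OF refl])
          fix k assume k: "k \<in> I - {h}"
          have "x k \<noteq> x h" using k h I assms(2) by (auto simp: inj_on_def)
          moreover have "x k \<noteq> 0" using x[of k] k I by auto
          ultimately have "x h * x k * (?t h - ?t k) = x k - x h" "x k - x h \<noteq> 0"
            using h k nz by (auto simp: flip_inv_def field_simps)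
          then show "1 - x h * x k = x h * x k * (?t h - ?t k) * ((1 - x h * x k) / (x k - x h))"
            by simp
        qed
        then show ?thesis by (simp only: prod.distrib) simp
      qed
      \<comment> \<open>The powers of \<open>x h\<close> collected in the two preceding facts number
        \<open>card A - 1\<close>, which raises \<open>M\<close> to the exponent that row
        \<open>h\<close> carries as a member of \<open>I\<close>.\<close>
      have 4: "x h ^ M * (x h ^ card (I - {h}) * x h ^ card (A - I)) = x h ^ ?m"
      proof -
        have "card (A - I) = card A - card I" "card (I - {h}) = card I - 1"
          "card I \<le> card A" "card I \<ge> 1"
          using I finI h assms(1) by (auto simp: card_Diff_subset card_mono Suc_le_eq card_gt_0_iff)
        then have "M + (card (I - {h}) + card (A - I)) = ?m" by simp
        then show ?thesis by (metis power_add)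
      qed
      have 5: "(\<Prod>i\<in>I - {h}. - (x i ^ (M + card (A - {h}) - 1))) * (\<Prod>k\<in>I - {h}. x k) =
          (\<Prod>i\<in>I - {h}. - (x i ^ ?m))"
        unfolding prod.distrib[symmetric]
      proof (rule prod.cong[OF refl])
        fix i assume i: "i \<in> I - {h}"
        then have "card {i, h} \<le> card A" using h I assms(1) by (intro card_mono) auto
        then have "card A \<ge> 2" using i by simp
        then have "Suc (M + card (A - {h}) - 1) = ?m" using hA assms(1) by simp
        then show "- (x i ^ (M + card (A - {h}) - 1)) * x i = - (x i ^ ?m)"
          by (metis mult.commute mult_minus_left power_Suc)
      qed
      have 6: "(\<Prod>i\<in>I. - (x i ^ ?m)) = - (x h ^ ?m) * (\<Prod>i\<in>I - {h}. - (x i ^ ?m))"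
        by (rule prod.remove[OF finI h])
      have 7: "vdm A ?t = (-1) ^ card {k\<in>A. h < k} * vdm (A - {h}) ?t *
         ((\<Prod>k\<in>I - {h}. ?t h - ?t k) * (\<Prod>k\<in>A - I. ?t h - ?t k))"
        using vdm_remove[OF assms(1) hA, of ?t] split by simp
      show ?thesis
        unfolding T_def 1 7 6 5[symmetric] 4[symmetric] split[of "\<lambda>k. 1 - x h * x k"] 2 3
        by (simp only: mult_ac mult_minus_left mult_minus_right minus_minus)
    qed
    then have "(\<Sum>h\<in>I. T h (I - {h})) = - ((\<Prod>i\<in>I. - (x i ^ ?m)) * vdm A (flip_inv I x)) *
        (\<Sum>h\<in>I. (1 - x h) * (\<Prod>k\<in>I - {h}. (1 - x h * x k) / (x k - x h)))"
      by (simp add: sum_distrib_left)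
    also have "(\<Sum>h\<in>I. (1 - x h) * (\<Prod>k\<in>I - {h}. (1 - x h * x k) / (x k - x h))) = 1 - (\<Prod>h\<in>I. x h)"
      by (rule partial_fraction_identity) (use finI I assms(2) x in \<open>auto intro: inj_on_subset\<close>)
    finally show ?thesis by (simp add: algebra_simps)
  qed
  have "(\<Sum>h\<in>A. (-1) ^ card {k\<in>A. h < k} * x h ^ M * (weyl_num (A - {h}) M x *
       ((1 - x h) * (\<Prod>k\<in>A - {h}. 1 - x h * x k)))) = (\<Sum>h\<in>A. \<Sum>J\<in>Pow (A - {h}). T h J)"
    unfolding weyl_num_def T_def by (simp add: sum_distrib_left sum_distrib_right)
  also have "\<dots> = (\<Sum>(h, J)\<in>Sigma A (\<lambda>h. Pow (A - {h})). T h J)"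
    by (rule sum.Sigma) (use assms(1) in auto)
  also have "\<dots> = (\<Sum>(I, h)\<in>Sigma (Pow A) (\<lambda>I. I). T h (I - {h}))"
    by (rule sum.reindex_bij_witness[of _ "\<lambda>(I, h). (h, I - {h})" "\<lambda>(h, J). (insert h J, h)"])
      (auto intro!: arg_cong2[where f = T])
  also have "\<dots> = (\<Sum>I\<in>Pow A. \<Sum>h\<in>I. T h (I - {h}))"
    by (rule sum.Sigma[symmetric]) (use assms(1) in \<open>auto intro: finite_subset\<close>)
  also have "\<dots> = (\<Sum>I\<in>Pow A. (\<Prod>i\<in>I. - (x i ^ ?m)) * ((\<Prod>i\<in>I. x i) - 1) * vdm A (flip_inv I x))"
    by (intro sum.cong refl per_set) auto
  also have "\<dots> = (\<Sum>I\<in>Pow A. (\<Prod>i\<in>I. - (x i ^ (Suc M + card A - 1))) * vdm A (flip_inv I x) -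
      (\<Prod>i\<in>I. - (x i ^ ?m)) * vdm A (flip_inv I x))"
  proof (rule sum.cong[OF refl])
    fix I assume I: "I \<in> Pow A"
    have "(\<Prod>i\<in>I. - (x i ^ (Suc M + card A - 1))) = (\<Prod>i\<in>I. - (x i ^ ?m)) * (\<Prod>i\<in>I. x i)"
      unfolding prod.distrib[symmetric]
    proof (rule prod.cong[OF refl])
      fix i assume "i \<in> I"
      then have "card A \<ge> 1" using I assms(1) by (auto simp: Suc_le_eq card_gt_0_iff)
      then have m: "Suc M + card A - 1 = Suc ?m" by simp
      show "- (x i ^ (Suc M + card A - 1)) = - (x i ^ ?m) * x i" unfolding m by simp
    qed
    then show "(\<Prod>i\<in>I. - (x i ^ ?m)) * ((\<Prod>i\<in>I. x i) - 1) * vdm A (flip_inv I x) =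
      (\<Prod>i\<in>I. - (x i ^ (Suc M + card A - 1))) * vdm A (flip_inv I x) -
      (\<Prod>i\<in>I. - (x i ^ ?m)) * vdm A (flip_inv I x)"
      by (simp only: ring_distribs mult_1_right mult_1_left)
  qed
  also have "\<dots> = weyl_num A (Suc M) x - weyl_num A M x"
    unfolding weyl_num_def by (simp only: sum_subtractf)
  finally show ?thesis by simp
qed

lemma strict_mono_on_insert_index: "strict_mono_on A (insert_index a)"
  by (auto simp: strict_mono_on_def insert_index_def)

lemma insert_index_image_atLeastLessThan:
  assumes "a < Suc n"
  shows "insert_index a ` {0..<n} = {0..<Suc n} - {a}"
  using insert_index_image[OF assms] by simp

text \<open>Macdonald's formula with denominators cleared. Both sides obey the same recursion in
  \<open>M\<close>: on the left by expansion along the column of the part \<open>M\<close>, on the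
  right by \<open>weyl_num_Suc\<close>. At \<open>M = 0\<close> both sides vanish unless
  \<open>n = 0\<close>, where both are 1.\<close>

theorem alt_sum_mult_weyl_den:
  fixes x :: "nat \<Rightarrow> 'a::field"
  assumes "inj_on x {0..<n}" "\<And>h. h < n \<Longrightarrow> x h \<noteq> 0 \<and> x h \<noteq> -1"
  shows "alt_sum n M x * weyl_den {0..<n} x = weyl_num {0..<n} M x"
  using assms
proof (induction M arbitrary: n x)
  case 0
  have "alt_sum n 0 x = 0" "weyl_num {0..<n} 0 x = 0" if "n > 0"
    using that 0 weyl_num_0[of n x] by (auto simp: alt_sum_def gr0_conv_Suc)
  then show ?case
    by (cases "n = 0") (auto simp: alt_sum_def weyl_den_def weyl_num_def vdm_def pair_prod_def)
next
  case (Suc M)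
  show ?case
  proof (cases n)
    case 0
    then show ?thesis
      by (auto simp: alt_sum_def weyl_den_def weyl_num_def vdm_def pair_prod_def)
  next
    case n: (Suc n')
    let ?A = "{0..<Suc n'}"
    have "alt_sum n' M (\<lambda>i. x (insert_index h i)) * weyl_den ?A x =
        weyl_num (?A - {h}) M x * ((1 - x h) * (\<Prod>k\<in>?A - {h}. 1 - x h * x k))" if h: "h < Suc n'" for h
    proof -
      note img = insert_index_image_atLeastLessThan[OF h]
      have "alt_sum n' M (\<lambda>i. x (insert_index h i)) * weyl_den {0..<n'} (\<lambda>i. x (insert_index h i)) =
          weyl_num {0..<n'} M (\<lambda>i. x (insert_index h i))"
      proof (rule Suc.IH)
        have "inj_on x (insert_index h ` {0..<n'})"
          unfolding img using Suc.prems(1) n by (auto intro: inj_on_subset)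
        then show "inj_on (\<lambda>i. x (insert_index h i)) {0..<n'}"
          using comp_inj_on[OF strict_mono_on_imp_inj_on[OF strict_mono_on_insert_index]] by (auto simp: comp_def)
      next
        fix i assume "i < n'"
        then show "x (insert_index h i) \<noteq> 0 \<and> x (insert_index h i) \<noteq> -1"
          using Suc.prems(2) n by (auto simp: insert_index_def)
      qed
      then have "alt_sum n' M (\<lambda>i. x (insert_index h i)) * weyl_den (?A - {h}) x = weyl_num (?A - {h}) M x"
        unfolding img[symmetric] by (simp add: weyl_den_reindex weyl_num_reindex strict_mono_on_insert_index)
      then show ?thesis
        using h by (subst weyl_den_remove[of _ h]) (auto simp: mult.assoc[symmetric])
    qed
    note step = this
    have card: "card {k \<in> ?A. h < k} = n' - h" "card {k. k < Suc n' \<and> h < k} = n' - h" if "h \<in> ?A" for h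
    proof -
      have "{k. k < Suc n' \<and> h < k} = {Suc h..<Suc n'}" by auto
      then show "card {k. k < Suc n' \<and> h < k} = n' - h" using that by simp
      have "{k \<in> ?A. h < k} = {Suc h..<Suc n'}" by auto
      then show "card {k \<in> ?A. h < k} = n' - h" using that by simp
    qed
    have "alt_sum n (Suc M) x * weyl_den {0..<n} x = alt_sum (Suc n') M x * weyl_den ?A x +
      (\<Sum>h\<in>?A. (-1) ^ (n' - h) * x h ^ M * (alt_sum n' M (\<lambda>i. x (insert_index h i)) * weyl_den ?A x))"
      unfolding n alt_sum_Suc_Suc by (simp add: ring_distribs sum_distrib_right mult.assoc atLeast0LessThan)
    also have "\<dots> = weyl_num ?A M x +
      (\<Sum>h\<in>?A. (-1) ^ card {k \<in> ?A. h < k} * x h ^ M *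
        (weyl_num (?A - {h}) M x * ((1 - x h) * (\<Prod>k\<in>?A - {h}. 1 - x h * x k))))"
      using Suc.IH[of x "Suc n'"] Suc.prems n
      by (intro arg_cong2[where f = "(+)"] sum.cong refl) (auto simp: step card)
    also have "\<dots> = weyl_num ?A (Suc M) x"
      using Suc.prems n by (intro weyl_num_Suc[symmetric]) auto
    finally show ?thesis using n by simp
  qed
qed

section \<open>Sums of sine determinants\<close>

lemma of_real_dt: "of_real (dt n f) = dt n (\<lambda>i j. of_real (f i j) :: complex)"
proof -
  have "of_real (of_int z * u) = (of_int z * of_real u :: complex)" for z u
    by simp
  then show ?thesis unfolding dt_Leibniz by (simp del: of_real_mult)
qed

definition flip_sign :: "nat set \<Rightarrow> (nat \<Rightarrow> real) \<Rightarrow> nat \<Rightarrow> real" where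
  "flip_sign I y h = (if h \<in> I then - y h else y h)"

text \<open>Each row is a difference of two exponentials. Expanding all rows gives the signed sum
  over sign changes of the angles, which for the variables \<open>cis (y h)\<close> are the
  inversions that Macdonald's quotient is symmetrised over.\<close>

lemma dt_sin_expand:
  fixes g y :: "nat \<Rightarrow> real"
  shows "(2 * \<i>) ^ n * of_real (dt n (\<lambda>h t. sin (g t * y h))) =
    (\<Sum>I\<in>Pow {0..<n}. (\<Prod>h = 0..<n. if h \<in> I then -1 else 1) * dt n (\<lambda>h t. cis (g t * flip_sign I y h)))"
proof -
  have "(2 * \<i>) ^ n * of_real (dt n (\<lambda>h t. sin (g t * y h))) =
      dt n (\<lambda>h t. 2 * \<i> * of_real (sin (g t * y h)))"
    unfolding dt_row_scale of_real_dt by simp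
  also have "\<dots> = dt n (\<lambda>h t. - cis (- (g t * y h)) + cis (g t * y h))"
    by (intro dt_cong) (simp add: complex_eq_iff)
  also have "\<dots> = (\<Sum>I\<in>Pow {0..<n}. dt n (\<lambda>h t. (if h \<in> I then -1 else 1) * cis (g t * flip_sign I y h)))"
    unfolding dt_add_rows by (intro sum.cong refl dt_cong) (auto simp: flip_sign_def)
  finally show ?thesis unfolding dt_row_scale .
qed

text \<open>A summand with a part 0 has a zero column and vanishes, so the sum effectively runs over
  positive parts below \<open>M\<close>.\<close>

definition sine_sum :: "nat \<Rightarrow> nat \<Rightarrow> (nat \<Rightarrow> real) \<Rightarrow> real" where
  "sine_sum n M y = (\<Sum>f\<in>incs n M. dt n (\<lambda>h t. sin (real (f t) * y h)))"

lemma one_minus_cis_nonzero: "sin a \<noteq> 0 \<Longrightarrow> 1 - cis a \<noteq> 0"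
  by (auto simp: complex_eq_iff)

lemma one_minus_cis_mult_nonzero: "cos a \<noteq> cos b \<Longrightarrow> 1 - cis a * cis b \<noteq> 0"
proof
  assume ne: "cos a \<noteq> cos b" and "1 - cis a * cis b = 0"
  then have "cis a * cis b = 1" by simp
  then have "cis a = cis (- b)" by (metis cis_mult cis_zero add.commute add_minus_cancel mult.assoc mult.left_neutral mult.right_neutral right_minus)
  then have "cos a = cos (- b)" by (metis cis.sel(1))
  with ne show False by simp
qed

text \<open>Taking the mean exponent \<open>(real M + real n - 1) / 2\<close> out of every row turns
  the two powers into a sine. Sines are odd, so the sign changes in \<open>I\<close> affect only the
  signs and phases in front. The hypothesis keeps \<open>M + n - 1\<close> from being
  truncated.\<close>

lemma weyl_num_cis:
  fixes y :: "nat \<Rightarrow> real"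
  assumes "n > 0 \<or> M > 0"
  shows "weyl_num {0..<n} M (\<lambda>h. cis (flip_sign I y h)) =
    (\<Prod>h = 0..<n. - 2 * \<i> * (if h \<in> I then -1 else 1)) *
    (\<Prod>h = 0..<n. cis ((real M + real n - 1) / 2 * flip_sign I y h)) *
    of_real (dt n (\<lambda>h j. sin (((real M + real n - 1) / 2 - real j) * y h)))"
proof -
  let ?K = "(real M + real n - 1) / 2"
  have K: "real (M + n - 1) = 2 * ?K"
    using assms by (auto simp: of_nat_diff)
  have "weyl_num {0..<n} M (\<lambda>h. cis (flip_sign I y h)) =
      dt n (\<lambda>h j. cis (flip_sign I y h) ^ j - cis (flip_sign I y h) ^ (M + n - 1 - j))"
    by (rule dt_sub_reflect_eq_weyl_num[symmetric]) simp
  also have "\<dots> = dt n (\<lambda>h j. (- 2 * \<i> * (if h \<in> I then -1 else 1)) * (cis (?K * flip_sign I y h) *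
      of_real (sin ((?K - real j) * y h))))"
  proof (rule dt_cong)
    fix h j assume "h < n" "j < n"
    then have j: "real (M + n - 1 - j) = 2 * ?K - real j"
      using K by (simp add: of_nat_diff)
    define v where "v = flip_sign I y h"
    have "cis v ^ j - cis v ^ (M + n - 1 - j) =
        cis (?K * v) * (cis (- ((?K - real j) * v)) - cis ((?K - real j) * v))"
      unfolding Complex.DeMoivre right_diff_distrib cis_mult j
      by (intro arg_cong2[where f = "(-)"] arg_cong[where f = cis]) (auto simp: field_simps)
    also have "cis (- ((?K - real j) * v)) - cis ((?K - real j) * v) = - 2 * \<i> * of_real (sin ((?K - real j) * v))"
      by (simp add: complex_eq_iff)
    also have "sin ((?K - real j) * v) = (if h \<in> I then -1 else 1) * sin ((?K - real j) * y h)"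
      by (simp add: v_def flip_sign_def)
    finally show "cis (flip_sign I y h) ^ j - cis (flip_sign I y h) ^ (M + n - 1 - j) =
      (- 2 * \<i> * (if h \<in> I then -1 else 1)) * (cis (?K * flip_sign I y h) * of_real (sin ((?K - real j) * y h)))"
      by (simp add: v_def)
  qed
  finally show ?thesis
    unfolding dt_row_scale of_real_dt by (simp only: mult.assoc)
qed

text \<open>In Macdonald's formula the quotient of the two determinants is invariant under \<open>x\<^sub>h \<mapsto> 1 / x\<^sub>h\<close>, so the
  signed sum over these reflections acts on the remaining Vandermonde factor only.\<close>

theorem sine_sum_product:
  fixes y :: "nat \<Rightarrow> real"
  assumes n: "n > 0" and sin: "\<And>h. h < n \<Longrightarrow> sin (y h) \<noteq> 0" and inj: "inj_on (\<lambda>h. cos (y h)) {0..<n}"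
  shows "sine_sum n M y * dt n (\<lambda>h j. sin ((real n - 1/2 - real j) * y h)) =
    dt n (\<lambda>h j. sin (((real M + real n - 1) / 2 - real j) * y h)) *
    dt n (\<lambda>h j. sin (((real M - real n) / 2 + real j) * y h))"
    (is "_ * ?S = ?SK * ?S'")
proof -
  define sg :: "nat set \<Rightarrow> complex" where "sg I = (\<Prod>h = 0..<n. if h \<in> I then -1 else 1)" for I
  define x where "x I h = cis (flip_sign I y h)" for I h
  have cosf: "cos (flip_sign I y h) = cos (y h)" for I h by (simp add: flip_sign_def)
  have sinf: "sin (flip_sign I y h) \<noteq> 0" if "h < n" for I h
    using sin[OF that] by (simp add: flip_sign_def)
  have pow: "x I h ^ k = cis (real k * flip_sign I y h)" for I h k
    by (simp add: x_def Complex.DeMoivre)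
  \<comment> \<open>For fixed \<open>I\<close> the Weyl denominator, the signs and the common phases
    are removed by comparing the formula at bound \<open>M\<close> with the one at bound
    \<open>n\<close>, where the alternant sum is a Vandermonde determinant.\<close>
  have key: "alt_sum n M (x I) * of_real ?S =
      of_real ?SK * dt n (\<lambda>h t. cis (((real M - real n) / 2 + real t) * flip_sign I y h))" for I
  proof -
    let ?P = "\<Prod>h = 0..<n. - 2 * \<i> * (if h \<in> I then -1 else 1 :: complex)"
    let ?C = "\<lambda>r. \<Prod>h = 0..<n. cis (r * flip_sign I y h)"
    let ?D = "weyl_den {0..<n} (x I)"
    have xI: "x I = (\<lambda>h. cis (flip_sign I y h))"
      by (rule ext) (simp add: x_def)
    have injx: "inj_on (x I) {0..<n}"
    proof (rule inj_onI)
      fix h k assume hk: "h \<in> {0..<n}" "k \<in> {0..<n}" "x I h = x I k"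
      then have "cos (y h) = cos (y k)" by (metis cis.sel(1) x_def cosf)
      then show "h = k" using inj hk by (auto simp: inj_on_def)
    qed
    have nz: "x I h \<noteq> 0 \<and> x I h \<noteq> -1" if "h < n" for h
      using sinf[OF that, of I] by (auto simp: x_def complex_eq_iff)
    have aw: "alt_sum n k (x I) * ?D = weyl_num {0..<n} k (x I)" for k
      using injx nz by (rule alt_sum_mult_weyl_den)
    have D: "?D \<noteq> 0"
    proof -
      have "(\<Prod>h = 0..<n. 1 - x I h) \<noteq> 0"
        using sinf one_minus_cis_nonzero by (auto simp: x_def)
      moreover have "1 - x I h * x I k \<noteq> 0" if "h < k" "k < n" for h k
        unfolding x_def by (rule one_minus_cis_mult_nonzero)
          (use inj that inj_on_eq_iff[OF inj, of h k] in \<open>simp add: cosf\<close>)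
      ultimately show ?thesis by (auto simp: weyl_den_def pair_prod_def)
    qed
    have P: "?P \<noteq> 0" by auto
    have C: "?C r \<noteq> 0" for r by auto
    have eM: "alt_sum n M (x I) * ?D = ?P * ?C ((real M + real n - 1) / 2) * of_real ?SK"
      unfolding aw unfolding xI using n by (intro weyl_num_cis) simp
    have V: "alt_sum n n (x I) = vdm {0..<n} (x I)"
    proof -
      have "alt_sum n n (x I) = dt n (\<lambda>h j. x I h ^ j)"
        unfolding alt_sum_def incs_self by (simp, intro dt_cong) simp
      then show ?thesis by (simp add: dt_Vandermonde)
    qed
    have en: "alt_sum n n (x I) * ?D = ?P * ?C (real n - 1/2) * of_real ?S"
    proof -
      have half: "(real n + real n - 1) / 2 = real n - 1/2" by simp
      show ?thesis
        unfolding aw unfolding xI by (rule weyl_num_cis[of n n I y, OF disjI1[OF n], unfolded half])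
    qed
    \<comment> \<open>The phases of the two formulas differ by the exponent
      \<open>(M - n) / 2\<close>. Absorbed into the Vandermonde determinant it shifts all exponents,
      which yields the second determinant on the right.\<close>
    have CC: "?C ((real M + real n - 1) / 2) = ?C (real n - 1/2) * ?C ((real M - real n) / 2)"
      unfolding prod.distrib[symmetric] cis_mult
      by (intro prod.cong refl arg_cong[where f = cis]) (simp add: field_simps)
    have "alt_sum n M (x I) * of_real ?S * (?P * ?C (real n - 1/2) * ?D) =
        (alt_sum n M (x I) * ?D) * (?P * ?C (real n - 1/2) * of_real ?S)"
      by (simp only: mult_ac)
    also have "\<dots> = of_real ?SK * (?C ((real M - real n) / 2) * vdm {0..<n} (x I)) * (?P * ?C (real n - 1/2) * ?D)"
      unfolding eM en[symmetric] V CC by (simp only: mult_ac)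
    finally have "alt_sum n M (x I) * of_real ?S * (?P * ?C (real n - 1/2) * ?D) =
        of_real ?SK * (?C ((real M - real n) / 2) * vdm {0..<n} (x I)) * (?P * ?C (real n - 1/2) * ?D)" .
    moreover have "?P * ?C (real n - 1/2) * ?D \<noteq> 0"
      using P C D by (simp only: mult_eq_0_iff) simp
    ultimately have "alt_sum n M (x I) * of_real ?S = of_real ?SK * (?C ((real M - real n) / 2) * vdm {0..<n} (x I))"
      by (simp only: mult_cancel_right simp_thms)
    also have "?C ((real M - real n) / 2) * vdm {0..<n} (x I) =
        dt n (\<lambda>h t. cis (((real M - real n) / 2 + real t) * flip_sign I y h))"
      unfolding dt_Vandermonde[symmetric] dt_row_scale[symmetric]
      by (intro dt_cong) (simp add: pow cis_mult ring_distribs)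
    finally show ?thesis .
  qed
  have "(2 * \<i>) ^ n * of_real (sine_sum n M y) = (\<Sum>f\<in>incs n M. \<Sum>I\<in>Pow {0..<n}. sg I * dt n (\<lambda>h t. x I h ^ f t))"
    unfolding sine_sum_def of_real_sum sum_distrib_left dt_sin_expand pow sg_def ..
  also have "\<dots> = (\<Sum>I\<in>Pow {0..<n}. sg I * alt_sum n M (x I))"
    unfolding alt_sum_def sum_distrib_left by (rule sum.swap)
  finally have "(2 * \<i>) ^ n * of_real (sine_sum n M y) * of_real ?S =
      (\<Sum>I\<in>Pow {0..<n}. sg I * (alt_sum n M (x I) * of_real ?S))"
    by (simp only: sum_distrib_right mult.assoc)
  also have "\<dots> = of_real ?SK * (\<Sum>I\<in>Pow {0..<n}. sg I *
      dt n (\<lambda>h t. cis (((real M - real n) / 2 + real t) * flip_sign I y h)))"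
    unfolding key sum_distrib_left by (simp only: mult_ac)
  also have "\<dots> = of_real ?SK * ((2 * \<i>) ^ n * of_real ?S')"
    unfolding sg_def dt_sin_expand[symmetric] ..
  finally have "(2 * \<i>) ^ n * of_real (sine_sum n M y * ?S) = (2 * \<i>) ^ n * complex_of_real (?SK * ?S')"
    by (simp only: of_real_mult mult_ac)
  then have "complex_of_real (sine_sum n M y * ?S) = complex_of_real (?SK * ?S')"
    by (simp only: mult_cancel_left) simp
  then show ?thesis by (simp only: of_real_eq_iff)
qed

section \<open>Walks in the alcove\<close>

text \<open>\<open>M\<close> stands for 2m, and \<open>f (n - 1)\<close> is the coordinate x_1. The
  case distinction matters for \<open>n = 1\<close>: there \<open>n - 2\<close> truncates to 0, and
  \<open>f (n - 2)\<close> would be x_1 once more instead of the coordinate 0.\<close>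

definition alc :: "nat \<Rightarrow> nat \<Rightarrow> (nat \<Rightarrow> nat) set" where
  "alc n M = {f. (\<forall>i\<ge>n. f i = 0) \<and> (\<forall>i<n. 0 < f i) \<and> (\<forall>i. Suc i < n \<longrightarrow> f i < f (Suc i)) \<and>
     f (n - 1) + (if n \<ge> 2 then f (n - 2) else 0) < M}"

definition sine_det :: "nat \<Rightarrow> (nat \<Rightarrow> real) \<Rightarrow> (nat \<Rightarrow> nat) \<Rightarrow> real" where
  "sine_det n y f = dt n (\<lambda>h t. sin (real (f t) * y h))"

text \<open>In each Leibniz term a step changes one factor, and sin((f+1)y) + sin((f-1)y) = 2 cos y
  sin(fy). Positivity makes \<open>f t - 1\<close> a genuine predecessor.\<close>

lemma sine_det_step:
  assumes "\<And>t. t < n \<Longrightarrow> f t > 0"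
  shows "(\<Sum>t<n. sine_det n y (f(t := Suc (f t))) + sine_det n y (f(t := f t - 1))) =
    2 * (\<Sum>h<n. cos (y h)) * sine_det n y f"
proof -
  let ?P = "\<lambda>g p. \<Prod>h = 0..<n. sin (real (g (p h)) * y h)"
  have "(\<Sum>t = 0..<n. ?P (f(t := Suc (f t))) p + ?P (f(t := f t - 1)) p) = 2 * (\<Sum>h<n. cos (y h)) * ?P f p"
    if p: "p permutes {0..<n}" for p
  proof -
    have one: "?P (f(p h := v)) p = sin (real v * y h) * (\<Prod>k\<in>{0..<n} - {h}. sin (real (f (p k)) * y k))"
      if h: "h \<in> {0..<n}" for h v
    proof -
      have "p k \<noteq> p h" if "k \<in> {0..<n} - {h}" for k
        using permutes_inj[OF p] that by (auto dest: injD)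
      then show ?thesis using h by (subst prod.remove[of _ h]) auto
    qed
    have "(\<Sum>t = 0..<n. ?P (f(t := Suc (f t))) p + ?P (f(t := f t - 1)) p) =
        (\<Sum>h = 0..<n. ?P (f(p h := Suc (f (p h)))) p + ?P (f(p h := f (p h) - 1)) p)"
      using sum.permute[OF p] by (simp add: o_def)
    also have "\<dots> = (\<Sum>h = 0..<n. 2 * cos (y h) * ?P f p)"
    proof (rule sum.cong[OF refl])
      fix h assume h: "h \<in> {0..<n}"
      then have "f (p h) > 0" using assms permutes_in_image[OF p, of h] by auto
      then have "sin (real (Suc (f (p h))) * y h) + sin (real (f (p h) - 1) * y h) =
          2 * cos (y h) * sin (real (f (p h)) * y h)"
        by (simp add: of_nat_diff sin_add sin_diff ring_distribs)
      moreover have "?P f p = sin (real (f (p h)) * y h) * (\<Prod>k\<in>{0..<n} - {h}. sin (real (f (p k)) * y k))"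
        using one[OF h, of "f (p h)"] by simp
      ultimately show "?P (f(p h := Suc (f (p h)))) p + ?P (f(p h := f (p h) - 1)) p = 2 * cos (y h) * ?P f p"
        unfolding one[OF h] by (simp only: distrib_right[symmetric] mult.assoc)
    qed
    also have "\<dots> = 2 * (\<Sum>h<n. cos (y h)) * ?P f p"
      by (simp add: sum_distrib_left sum_distrib_right atLeast0LessThan)
    finally show ?thesis .
  qed
  note per_perm = this
  have "(\<Sum>t = 0..<n. sine_det n y (f(t := Suc (f t))) + sine_det n y (f(t := f t - 1))) =
      (\<Sum>t = 0..<n. \<Sum>p | p permutes {0..<n}. signof p * (?P (f(t := Suc (f t))) p + ?P (f(t := f t - 1)) p))"
    unfolding sine_det_def dt_Leibniz by (simp only: sum.distrib distrib_left)
  also have "\<dots> = (\<Sum>p | p permutes {0..<n}. \<Sum>t = 0..<n. signof p * (?P (f(t := Suc (f t))) p + ?P (f(t := f t - 1)) p))"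
    by (rule sum.swap)
  also have "\<dots> = (\<Sum>p | p permutes {0..<n}. signof p * (2 * (\<Sum>h<n. cos (y h)) * ?P f p))"
    unfolding sum_distrib_left[symmetric] by (intro sum.cong refl arg_cong2[where f = "(*)"] per_perm) simp
  also have "\<dots> = 2 * (\<Sum>h<n. cos (y h)) * sine_det n y f"
    unfolding sine_det_def dt_Leibniz sum_distrib_left[of "2 * _"] by (simp only: mult_ac)
  finally show ?thesis by (simp only: lessThan_atLeast0)
qed

section \<open>Vanishing of the sine determinants on the walls\<close>

lemma sin_reflect:
  assumes "M > 0" "y = pi * real u / real M" "f + g = M"
  shows "sin (real f * y) = - ((-1) ^ u) * sin (real g * y)"
proof -
  have "real f * y = real u * pi - real g * y"
    using assms by (auto simp: field_simps)
  then show ?thesis by (simp add: sin_diff)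
qed

text \<open>Extensional functions, so that a sum over them of a product over the rows factors into
  one sum per row. All orderings and repetitions are included; repetitions are harmless because
  their determinants vanish.\<close>

definition freqs :: "nat \<Rightarrow> nat \<Rightarrow> nat \<Rightarrow> (nat \<Rightarrow> nat) set" where
  "freqs n M e = {0..<n} \<rightarrow>\<^sub>E {u \<in> {1..<M}. u mod 2 = e}"

definition angle :: "nat \<Rightarrow> (nat \<Rightarrow> nat) \<Rightarrow> nat \<Rightarrow> real" where
  "angle M u h = pi * real (u h) / real M"

lemma sine_det_wall_zero:
  assumes "t < n" "f t = 0" shows "sine_det n y f = 0"
  unfolding sine_det_def by (rule dt_zero_col[OF assms(1)]) (simp add: assms)

lemma sine_det_wall_eq:
  assumes "s < n" "t < n" "s \<noteq> t" "f s = f t" shows "sine_det n y f = 0"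
  unfolding sine_det_def by (rule dt_identical_cols[OF assms(1-3)]) (simp add: assms)

text \<open>Reflecting a coordinate at \<open>M\<close> multiplies row \<open>k\<close> by a sign
  that depends only on the parity of \<open>u k\<close>. Equal parity gives one sign for all rows,
  so the two columns are proportional.\<close>

lemma sine_det_wall_sum:
  assumes "u \<in> freqs n M e" "M > 0" "s < n" "t < n" "s \<noteq> t" "f s + f t = M"
  shows "sine_det n (angle M u) f = 0"
  unfolding sine_det_def
proof (rule dt_proportional_cols[OF assms(3-5), of _ "- ((-1) ^ e)"])
  fix k assume "k < n"
  then have "u k mod 2 = e" using assms(1) by (auto simp: freqs_def)
  then have "(-1 :: real) ^ u k = (-1) ^ e" by (auto simp: minus_one_power_iff)
  then show "sin (real (f s) * angle M u k) = - ((-1) ^ e) * sin (real (f t) * angle M u k)"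
    using sin_reflect[OF assms(2) _ assms(6), of "angle M u k" "u k"] by (simp add: angle_def)
qed

text \<open>Serves the case \<open>n = 1\<close>, where x_1 = M is the outer wall.\<close>

lemma sine_det_wall_top:
  assumes "M > 0" "t < n" "f t = M"
  shows "sine_det n (angle M u) f = 0"
  unfolding sine_det_def
proof (rule dt_zero_col[OF assms(2)])
  fix k
  have "real M * angle M u k = real (u k) * pi" using assms(1) by (simp add: angle_def)
  then show "sin (real (f t) * angle M u k) = 0" using assms(3) by simp
qed

lemma alc_strict_mono:
  assumes "f \<in> alc n M" "i < j" "j < n"
  shows "f i < f j"
  using assms(2,3)
proof (induction j)
  case (Suc j)
  have "f j < f (Suc j)" using assms(1) Suc.prems by (auto simp: alc_def)
  then show ?case using Suc by (cases "i = j") auto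
qed simp

lemma alc_mono: "f \<in> alc n M \<Longrightarrow> i \<le> j \<Longrightarrow> j < n \<Longrightarrow> f i \<le> f j"
  using alc_strict_mono[of f n M i j] by (cases "i = j") auto

lemma alc_pair_sum:
  assumes f: "f \<in> alc n M" and ij: "i < n" "j < n" "i \<noteq> j"
  shows "f i + f j < M"
proof -
  have *: "f i + f j < M" if ij: "i < j" "j < n" for i j
  proof -
    have "f j \<le> f (n - 1)"
      using ij by (intro alc_mono[OF f]) auto
    moreover have "f i \<le> f (n - 2)"
      using ij by (intro alc_mono[OF f]) auto
    moreover have "f (n - 1) + (if n \<ge> 2 then f (n - 2) else 0) < M" using f by (simp add: alc_def)
    then have "f (n - 1) + f (n - 2) < M" using ij by simp
    ultimately show ?thesis by simp
  qed
  show ?thesis using *[of i j] *[of j i] ij by (cases "i < j") auto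
qed

lemma alc_less:
  assumes "f \<in> alc n M" "i < n" shows "f i < M"
proof -
  have "f i \<le> f (n - 1)"
    using assms(2) by (intro alc_mono[OF assms(1)]) auto
  then show ?thesis using assms(1) by (auto simp: alc_def)
qed

lemma finite_alc [simp]: "finite (alc n M)"
proof (rule finite_subset)
  show "alc n M \<subseteq> incs n M"
  proof
    fix f assume f: "f \<in> alc n M"
    then have "\<forall>i\<ge>n. f i = 0" "\<forall>i. Suc i < n \<longrightarrow> f i < f (Suc i)" by (simp_all add: alc_def)
    then show "f \<in> incs n M" using alc_less[OF f] by (simp add: incs_def)
  qed
qed simp

lemma not_in_alc_cases:
  assumes "g \<notin> alc n M" "\<forall>i\<ge>n. g i = 0"
  shows "(\<exists>i<n. g i = 0) \<or> (\<exists>i. Suc i < n \<and> g i \<ge> g (Suc i)) \<or>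
    g (n - 1) + (if n \<ge> 2 then g (n - 2) else 0) \<ge> M"
proof (rule ccontr)
  assume *: "\<not> ?thesis"
  have "\<forall>i<n. 0 < g i" using * by (metis gr0I)
  moreover have "\<forall>i. Suc i < n \<longrightarrow> g i < g (Suc i)" using * leI by blast
  moreover have "g (n - 1) + (if n \<ge> 2 then g (n - 2) else 0) < M" using * leI by blast
  ultimately have "g \<in> alc n M" unfolding alc_def mem_Collect_eq using assms(2) by (intro conjI)
  with assms(1) show False ..
qed

text \<open>The two sides of each strict integer inequality that defines the alcove approach each
  other by at most one in a unit step, so a step out of the alcove ends exactly on a wall.\<close>

lemma sine_det_outside_alc:
  assumes f: "f \<in> alc n M" and t: "t < n" and u: "u \<in> freqs n M e" and v: "v = Suc (f t) \<or> v = f t - 1"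
    and notin: "f(t := v) \<notin> alc n M"
  shows "sine_det n (angle M u) (f(t := v)) = 0"
proof -
  define g where "g = f(t := v)"
  have gt: "g t = v" and g_other: "\<And>i. i \<noteq> t \<Longrightarrow> g i = f i" by (simp_all add: g_def)
  have v_le: "v \<le> Suc (f t)" "f t \<le> Suc v" using v by auto
  have M: "M > 0" using f by (auto simp: alc_def)
  have ft: "f t > 0" using f t by (auto simp: alc_def)
  consider "g t = 0" | i where "Suc i < n" "g i = g (Suc i)" | "n = 1" "g t = M"
    | "n \<ge> 2" "g (n - 1) + g (n - 2) = M"
  proof -
    have "(\<exists>i<n. g i = 0) \<or> (\<exists>i. Suc i < n \<and> g i \<ge> g (Suc i)) \<or>
        g (n - 1) + (if n \<ge> 2 then g (n - 2) else 0) \<ge> M"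
      by (rule not_in_alc_cases[OF notin[folded g_def]]) (use f t in \<open>auto simp: alc_def g_other\<close>)
    then consider i where "i < n" "g i = 0" | i where "Suc i < n" "g i \<ge> g (Suc i)"
      | "g (n - 1) + (if n \<ge> 2 then g (n - 2) else 0) \<ge> M" by blast
    then show ?thesis
    proof cases
      case (1 i)
      then have "i = t" using f g_other[of i] by (cases "i = t") (auto simp: alc_def)
      then show ?thesis using that(1) 1 by blast
    next
      case (2 i)
      have "f i < f (Suc i)" using f 2 by (auto simp: alc_def)
      moreover have "g i \<le> f (Suc i)" if "i = t" using that calculation gt v_le(1) by simp
      ultimately have "g i = g (Suc i)"
        using 2 gt v_le g_other[of i] g_other[of "Suc i"] by (cases "i = t"; cases "Suc i = t") auto
      then show ?thesis using that(2) 2 by blast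
    next
      case 3
      have "f (n - 1) + (if n \<ge> 2 then f (n - 2) else 0) < M" using f by (auto simp: alc_def)
      moreover have "g (n - 1) + (if n \<ge> 2 then g (n - 2) else 0) \<le> Suc (f (n - 1) + (if n \<ge> 2 then f (n - 2) else 0))"
      proof -
        have "g (n - 1) \<le> (if t = n - 1 then Suc (f (n - 1)) else f (n - 1))"
          "g (n - 2) \<le> (if t = n - 2 then Suc (f (n - 2)) else f (n - 2))"
          using gt v_le(1) g_other by auto
        moreover have "n - 1 \<noteq> n - 2" if "n \<ge> 2" using that by auto
        ultimately show ?thesis by (auto split: if_splits)
      qed
      ultimately have eq: "g (n - 1) + (if n \<ge> 2 then g (n - 2) else 0) = M"
        using 3 by linarith
      show ?thesis
      proof (cases "n \<ge> 2")
        case True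
        then show ?thesis using that(4) eq by simp
      next
        case False
        then have "n = 1" "t = 0" using t by auto
        then show ?thesis using that(3) eq by simp
      qed
    qed
  qed
  then have "sine_det n (angle M u) g = 0"
  proof cases
    case 1
    then show ?thesis using t by (intro sine_det_wall_zero[of t])
  next
    case (2 i)
    then show ?thesis by (intro sine_det_wall_eq[of i n "Suc i"]) auto
  next
    case 3
    then show ?thesis using t M by (intro sine_det_wall_top[of M t])
  next
    case 4
    then show ?thesis using t M by (intro sine_det_wall_sum[OF u M, of "n - 1" "n - 2"]) auto
  qed
  then show ?thesis by (simp add: g_def)
qed

section \<open>Orthogonality of sines, and completeness\<close>

lemma sum_cos_multiples:
  assumes "0 < a" "a < 2 * M"
  shows "(\<Sum>u<M. cos (pi * real u * real a / real M)) = (if even a then 0 else 1)"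
proof -
  define b where "b = pi * real a / real M"
  have M: "M > 0" using assms by auto
  \<comment> \<open>Multiplication by \<open>2 * sin (b / 2)\<close> makes the sum telescope; at
    \<open>N = M\<close> the upper end is \<open>real a * pi - b / 2\<close>, so only the parity of
    \<open>a\<close> survives.\<close>
  have tele: "2 * sin (b / 2) * (\<Sum>u<N. cos (real u * b)) = sin ((real N - 1/2) * b) + sin (b / 2)" for N
  proof (induction N)
    case (Suc N)
    have "2 * sin (b / 2) * cos (real N * b) = sin (real N * b + b / 2) - sin (real N * b - b / 2)"
      by (simp add: sin_add sin_diff)
    also have "real N * b + b / 2 = (real (Suc N) - 1/2) * b" by (simp add: field_simps)
    also have "real N * b - b / 2 = (real N - 1/2) * b" by (simp add: field_simps)
    finally show ?case using Suc by (simp add: ring_distribs)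
  qed simp
  have "0 < b / 2" "b / 2 < pi" using assms M by (auto simp: b_def field_simps)
  then have s: "sin (b / 2) > 0" by (rule sin_gt_zero)
  have "(real M - 1/2) * b = real a * pi - b / 2" using M by (simp add: b_def field_simps)
  then have "sin ((real M - 1/2) * b) = - ((-1) ^ a) * sin (b / 2)" by (simp add: sin_diff)
  then have "2 * sin (b / 2) * (\<Sum>u<M. cos (real u * b)) = 2 * sin (b / 2) * (if even a then 0 else 1)"
    using tele[of M] by (auto simp: minus_one_power_iff)
  then have "(\<Sum>u<M. cos (real u * b)) = (if even a then 0 else 1)"
    using s by simp
  then show ?thesis by (simp add: b_def mult_ac)
qed

lemma sum_sin_sin:
  assumes "0 < f" "f < M" "0 < g" "g < M"
  shows "(\<Sum>u\<in>{1..<M}. sin (real f * (pi * real u / real M)) * sin (real g * (pi * real u / real M))) =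
    (if f = g then real M / 2 else 0)"
proof -
  have *: "(\<Sum>u\<in>{1..<M}. sin (real f * (pi * real u / real M)) * sin (real g * (pi * real u / real M))) =
    (if f = g then real M / 2 else 0)" if "0 < g" "g \<le> f" "f < M" for f g
  proof -
    have trig: "sin A * sin B = (cos (A - B) - cos (A + B)) / 2" for A B :: real
      by (simp add: cos_add cos_diff)
    have "(\<Sum>u\<in>{1..<M}. sin (real f * (pi * real u / real M)) * sin (real g * (pi * real u / real M))) =
        (\<Sum>u<M. sin (real f * (pi * real u / real M)) * sin (real g * (pi * real u / real M)))"
      by (rule sum.mono_neutral_left) (auto simp: not_le Suc_le_eq)
    also have "\<dots> = (\<Sum>u<M. (cos (pi * real u * real (f - g) / real M) - cos (pi * real u * real (f + g) / real M)) / 2)"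
    proof (rule sum.cong[OF refl])
      fix u
      have "pi * real u * real (f - g) / real M = real f * (pi * real u / real M) - real g * (pi * real u / real M)"
        "pi * real u * real (f + g) / real M = real f * (pi * real u / real M) + real g * (pi * real u / real M)"
        using that by (simp_all add: of_nat_diff field_simps)
      then show "sin (real f * (pi * real u / real M)) * sin (real g * (pi * real u / real M)) =
          (cos (pi * real u * real (f - g) / real M) - cos (pi * real u * real (f + g) / real M)) / 2"
        by (simp only: trig)
    qed
    also have "\<dots> = ((\<Sum>u<M. cos (pi * real u * real (f - g) / real M)) -
        (\<Sum>u<M. cos (pi * real u * real (f + g) / real M))) / 2"
      by (simp add: sum_subtractf flip: sum_divide_distrib)
    also have "\<dots> = (if f = g then real M / 2 else 0)"
    proof (cases "f = g")
      case True
      then show ?thesis using sum_cos_multiples[of "f + g" M] that by simp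
    next
      \<comment> \<open>\<open>f - g\<close> and \<open>f + g\<close> have the same parity, so the
        two cosine sums agree.\<close>
      case False
      then show ?thesis using sum_cos_multiples[of "f + g" M] sum_cos_multiples[of "f - g" M] that
        by (simp add: even_diff_nat)
    qed
    finally show ?thesis .
  qed
  show ?thesis
  proof (cases "g \<le> f")
    case True
    then show ?thesis using * assms by blast
  next
    case False
    then show ?thesis using *[of f g] assms by (simp add: mult.commute)
  qed
qed

text \<open>The parity class is selected by the factor (1 + (-1)^(u+e)) / 2, and (-1)^u times the
  sine at \<open>f\<close> is minus the sine at \<open>M - f\<close>. Hence one class sees
  \<open>f\<close> and \<open>M - f\<close> together.\<close>

lemma sum_sin_sin_parity:
  assumes "0 < f" "f < M" "0 < g" "g < M" "e < 2"
  shows "(\<Sum>u\<in>{u \<in> {1..<M}. u mod 2 = e}. sin (real g * (pi * real u / real M)) * sin (real f * (pi * real u / real M))) =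
    real M / 4 * (of_bool (g = f) - ((-1) ^ e) * of_bool (g + f = M))"
proof -
  define s where "s f u = sin (real f * (pi * real u / real M))" for f u
  have M: "M > 0" using assms by auto
  have "(\<Sum>u\<in>{u \<in> {1..<M}. u mod 2 = e}. s g u * s f u) =
      (\<Sum>u\<in>{1..<M}. if u mod 2 = e then s g u * s f u else 0)"
    by (rule sum.inter_filter) simp
  also have "\<dots> = (\<Sum>u\<in>{1..<M}. (s g u * s f u - ((-1) ^ e) * (s g u * s (M - f) u)) / 2)"
  proof (rule sum.cong[OF refl])
    fix u
    have "s (M - f) u = - ((-1) ^ u) * s f u"
      unfolding s_def using assms by (intro sin_reflect[OF M]) auto
    moreover have "e = 0 \<or> e = 1" using assms(5) by auto
    ultimately show "(if u mod 2 = e then s g u * s f u else 0) =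
        (s g u * s f u - ((-1) ^ e) * (s g u * s (M - f) u)) / 2"
      by (cases "even u") (auto simp: even_iff_mod_2_eq_zero odd_iff_mod_2_eq_one minus_one_power_iff)
  qed
  also have "\<dots> = ((\<Sum>u\<in>{1..<M}. s g u * s f u) - ((-1) ^ e) * (\<Sum>u\<in>{1..<M}. s g u * s (M - f) u)) / 2"
    by (simp add: sum_subtractf sum_distrib_left flip: sum_divide_distrib)
  also have "\<dots> = real M / 4 * (of_bool (g = f) - ((-1) ^ e) * of_bool (g + f = M))"
  proof -
    have 1: "(\<Sum>u\<in>{1..<M}. s g u * s f u) = (if g = f then real M / 2 else 0)"
      unfolding s_def using assms by (intro sum_sin_sin) auto
    have 2: "(\<Sum>u\<in>{1..<M}. s g u * s (M - f) u) = (if g = M - f then real M / 2 else 0)"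
      unfolding s_def using assms by (intro sum_sin_sin) auto
    have 3: "g = M - f \<longleftrightarrow> g + f = M" using assms by auto
    show ?thesis unfolding 1 2 3 by (simp add: field_simps)
  qed
  finally show ?thesis by (simp add: s_def)
qed

lemma permutes_strict_mono_id:
  fixes n :: nat
  assumes p: "p permutes {0..<n}" and mono: "\<And>i j. i < j \<Longrightarrow> j < n \<Longrightarrow> p i < p j"
  shows "p = id"
proof
  fix i
  have ge: "i \<le> p i" if "i < n" for i
    using that
  proof (induction i)
    case (Suc i)
    then show ?case using mono[of i "Suc i"] by simp
  qed simp
  \<comment> \<open>A permutation preserves the sum of the indices, so the pointwise inequality
    \<open>ge\<close> cannot be strict anywhere.\<close>
  have eq: "sum p {0..<n} = sum id {0..<n}"
    using sum.permute[OF p, of id] by (simp add: o_def)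
  show "p i = id i"
  proof (cases "i < n")
    case True
    have "id i = p i"
      by (rule sum_mono_inv[OF eq[symmetric]]) (use ge True in auto)
    then show ?thesis by simp
  next
    case False
    then show ?thesis using p by (simp add: permutes_def)
  qed
qed

text \<open>At most one \<open>b\<close> is nonzero, so both products are affine in that
  \<open>b\<close> and the linear terms cancel.\<close>

lemma sum_two_signs_prod:
  fixes a b :: "'i \<Rightarrow> real"
  assumes "finite A" "\<And>h k. h \<in> A \<Longrightarrow> k \<in> A \<Longrightarrow> h \<noteq> k \<Longrightarrow> b h = 0 \<or> b k = 0"
  shows "(\<Prod>h\<in>A. a h - b h) + (\<Prod>h\<in>A. a h + b h) = 2 * (\<Prod>h\<in>A. a h)"
proof (cases "\<exists>h\<in>A. b h \<noteq> 0")
  case True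
  then obtain h where h: "h \<in> A" "b h \<noteq> 0" by blast
  have *: "b k = 0" if "k \<in> A - {h}" for k using assms(2)[of h k] h that by auto
  show ?thesis
    unfolding prod.remove[OF assms(1) h(1)] using * by (simp add: algebra_simps)
next
  case False
  then show ?thesis by simp
qed

text \<open>Each parity class alone also sees the reflected pairs \<open>g\<^sub>h + f\<^sub>t = M\<close>, with opposite signs. Inside the
  alcove at most one factor of a Leibniz term can be such a pair, so the sum over both classes
  removes them.\<close>

lemma freqs_completeness:
  assumes f: "f \<in> alc n M" and g: "g \<in> alc n M"
  shows "(\<Sum>e<2. \<Sum>u\<in>freqs n M e. (\<Prod>h = 0..<n. sin (real (g h) * angle M u h)) * sine_det n (angle M u) f) =
    2 * (real M / 4) ^ n * of_bool (f = g)"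
proof -
  let ?U = "\<lambda>e. {u \<in> {1..<M}. u mod 2 = e}"
  define a where "a p h = (of_bool (g h = f (p h)) :: real)" for p h
  define b where "b p h = (of_bool (g h + f (p h) = M) :: real)" for p h
  have per_e: "(\<Sum>u\<in>freqs n M e. (\<Prod>h = 0..<n. sin (real (g h) * angle M u h)) * sine_det n (angle M u) f) =
      (\<Sum>p | p permutes {0..<n}. signof p * ((real M / 4) ^ n * (\<Prod>h = 0..<n. a p h - ((-1) ^ e) * b p h)))"
    if e: "e < 2" for e
  proof -
    have "(\<Sum>u\<in>freqs n M e. (\<Prod>h = 0..<n. sin (real (g h) * angle M u h)) * sine_det n (angle M u) f) =
        (\<Sum>u\<in>freqs n M e. \<Sum>p | p permutes {0..<n}. signof p *
          (\<Prod>h = 0..<n. sin (real (g h) * (pi * real (u h) / real M)) * sin (real (f (p h)) * (pi * real (u h) / real M))))"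
      unfolding sine_det_def dt_Leibniz sum_distrib_left prod.distrib angle_def by (simp only: mult_ac)
    also have "\<dots> = (\<Sum>p | p permutes {0..<n}. signof p * (\<Sum>u\<in>freqs n M e.
          (\<Prod>h = 0..<n. sin (real (g h) * (pi * real (u h) / real M)) * sin (real (f (p h)) * (pi * real (u h) / real M)))))"
      unfolding sum_distrib_left by (rule sum.swap)
    also have "\<dots> = (\<Sum>p | p permutes {0..<n}. signof p * (\<Prod>h = 0..<n. \<Sum>u\<in>?U e.
          sin (real (g h) * (pi * real u / real M)) * sin (real (f (p h)) * (pi * real u / real M))))"
      unfolding freqs_def by (subst prod_sum_PiE) auto
    also have "\<dots> = (\<Sum>p | p permutes {0..<n}. signof p * (\<Prod>h = 0..<n. real M / 4 * (a p h - ((-1) ^ e) * b p h)))"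
    proof (intro sum.cong refl arg_cong2[where f = "(*)"] prod.cong)
      fix p h assume "p \<in> {p. p permutes {0..<n}}" "h \<in> {0..<n}"
      then have "p h < n" "h < n" using permutes_in_image[of p "{0..<n}" h] by auto
      then show "(\<Sum>u\<in>?U e. sin (real (g h) * (pi * real u / real M)) * sin (real (f (p h)) * (pi * real u / real M))) =
          real M / 4 * (a p h - ((-1) ^ e) * b p h)"
        unfolding a_def b_def using alc_less[OF f, of "p h"] alc_less[OF g, of h] f g e
        by (intro sum_sin_sin_parity) (auto simp: alc_def)
    qed
    finally show ?thesis by (simp only: prod.distrib) simp
  qed
  have perm: "(\<Prod>h = 0..<n. a p h - b p h) + (\<Prod>h = 0..<n. a p h + b p h) = 2 * of_bool (f = g \<and> p = id)"
    if p: "p permutes {0..<n}" for p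
  proof -
    have "(\<Prod>h = 0..<n. a p h - b p h) + (\<Prod>h = 0..<n. a p h + b p h) = 2 * (\<Prod>h = 0..<n. a p h)"
    proof (rule sum_two_signs_prod)
      fix h k assume hk: "h \<in> {0..<n}" "k \<in> {0..<n}" "h \<noteq> k"
      have "p h \<noteq> p k" using permutes_inj[OF p] hk by (auto dest: injD)
      moreover have "p h < n" "p k < n" using permutes_in_image[OF p] hk by auto
      ultimately have "f (p h) + f (p k) < M" "g h + g k < M"
        using alc_pair_sum[OF f] alc_pair_sum[OF g] hk by auto
      then show "b p h = 0 \<or> b p k = 0" by (auto simp: b_def)
    qed simp
    also have "(\<Prod>h = 0..<n. a p h) = of_bool (f = g \<and> p = id)"
    proof (cases "\<forall>h<n. g h = f (p h)")
      case True
      have "p = id"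
      proof (rule permutes_strict_mono_id[OF p])
        fix i j assume ij: "i < j" "j < n"
        have "f (p i) < f (p j)" using alc_strict_mono[OF g ij] True ij by simp
        moreover have "p i < n" using permutes_in_image[OF p, of i] ij by simp
        ultimately show "p i < p j"
          using alc_strict_mono[OF f, of "p j" "p i"] by (metis less_asym linorder_neqE_nat nat_neq_iff)
      qed
      moreover have "f = g"
      proof
        fix i show "f i = g i" using True \<open>p = id\<close> f g by (cases "i < n") (auto simp: alc_def)
      qed
      ultimately show ?thesis by (simp add: a_def)
    next
      case False
      then have "(\<Prod>h = 0..<n. a p h) = 0" by (auto simp: a_def)
      then show ?thesis using False by auto
    qed
    finally show ?thesis .
  qed
  have "(\<Sum>e<2. \<Sum>u\<in>freqs n M e. (\<Prod>h = 0..<n. sin (real (g h) * angle M u h)) * sine_det n (angle M u) f) =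
      (\<Sum>p | p permutes {0..<n}. signof p * ((real M / 4) ^ n * (\<Prod>h = 0..<n. a p h - b p h))) +
      (\<Sum>p | p permutes {0..<n}. signof p * ((real M / 4) ^ n * (\<Prod>h = 0..<n. a p h + b p h)))"
    using per_e[of 0] per_e[of 1] by (simp add: numeral_2_eq_2)
  also have "\<dots> = (\<Sum>p | p permutes {0..<n}. signof p * ((real M / 4) ^ n * (2 * of_bool (f = g \<and> p = id))))"
    unfolding sum.distrib[symmetric] distrib_left[symmetric] by (intro sum.cong refl) (simp add: perm)
  also have "\<dots> = (\<Sum>p\<in>{id}. signof p * ((real M / 4) ^ n * (2 * of_bool (f = g \<and> p = id))))"
    by (rule sum.mono_neutral_right) (auto simp: permutes_id finite_permutations)
  also have "\<dots> = 2 * (real M / 4) ^ n * of_bool (f = g)"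
    by (simp add: sign_id)
  finally show ?thesis .
qed

section \<open>Walks and their recursion\<close>

definition alcove_point :: "nat \<Rightarrow> (nat \<Rightarrow> nat) \<Rightarrow> nat \<Rightarrow> real" where
  "alcove_point n f i = (if i \<in> {1..n} then real (f (n - i)) else 0)"

lemma alcove_point_in_alcove_iff:
  assumes "n \<ge> 1" "real M = 2 * m" "\<And>i. i \<ge> n \<Longrightarrow> f i = 0"
  shows "alcove_point n f \<in> alcove_B n m \<longleftrightarrow> f \<in> alc n M"
proof -
  have "(\<forall>i\<in>{1..<n}. alcove_point n f i > alcove_point n f (Suc i)) \<longleftrightarrow> (\<forall>i. Suc i < n \<longrightarrow> f i < f (Suc i))"
  proof safe
    fix i assume *: "\<forall>i\<in>{1..<n}. alcove_point n f i > alcove_point n f (Suc i)" "Suc i < n"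
    then have "alcove_point n f (Suc (n - Suc i)) < alcove_point n f (n - Suc i)"
      by (intro *(1)[rule_format]) auto
    moreover have "n - (n - Suc i) = Suc i" "n - (n - i) = i" "1 \<le> n - Suc i" "1 \<le> n - i"
      using *(2) by auto
    ultimately show "f i < f (Suc i)" using *(2) by (simp add: alcove_point_def Suc_diff_Suc)
  next
    fix i assume *: "\<forall>i. Suc i < n \<longrightarrow> f i < f (Suc i)" "i \<in> {1..<n}"
    then have "f (n - Suc i) < f (Suc (n - Suc i))" by auto
    then show "alcove_point n f i > alcove_point n f (Suc i)" using *(2) by (auto simp: alcove_point_def Suc_diff_Suc)
  qed
  moreover have "alcove_point n f n > 0 \<longleftrightarrow> 0 < f 0" using assms(1) by (auto simp: alcove_point_def)
  moreover have "alcove_point n f 1 + alcove_point n f 2 < 2 * m \<longleftrightarrow> f (n - 1) + (if n \<ge> 2 then f (n - 2) else 0) < M"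
    using assms(1) unfolding assms(2)[symmetric] by (auto simp: alcove_point_def simp flip: of_nat_add)
  moreover have "(\<forall>i<n. 0 < f i) \<longleftrightarrow> 0 < f 0" if *: "\<forall>i. Suc i < n \<longrightarrow> f i < f (Suc i)"
  proof
    assume "0 < f 0"
    have "0 < f i" if "i < n" for i
      using that
    proof (induction i)
      case (Suc i)
      then show ?case using *[rule_format, of i] by linarith
    qed (use \<open>0 < f 0\<close> in simp)
    then show "\<forall>i<n. 0 < f i" by blast
  qed (use assms(1) in auto)
  moreover have "alcove_point n f \<in> vectors n" by (auto simp: vectors_def alcove_point_def)
  ultimately show ?thesis
    using assms(3) unfolding alcove_B_def alc_def by auto
qed

lemma walks_within_outside: "x \<notin> R \<Longrightarrow> walks_within n R x k = {}"
  by (force simp: walks_within_def in_set_conv_nth)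

lemma standard_step_iff:
  "standard_step n x q \<longleftrightarrow> q \<in> (\<lambda>i. x(i := x i + 1)) ` {1..n} \<union> (\<lambda>i. x(i := x i - 1)) ` {1..n}"
  by (auto simp: standard_step_def)

lemma walks_within_0: "x \<in> R \<Longrightarrow> walks_within n R x 0 = {[x]}"
  by (auto simp: walks_within_def length_Suc_conv)

lemma walks_within_Suc:
  assumes "x \<in> R"
  shows "walks_within n R x (Suc k) = (\<Union>q\<in>{q. standard_step n x q}. Cons x ` walks_within n R q k)"
proof (intro equalityI subsetI)
  fix p assume p: "p \<in> walks_within n R x (Suc k)"
  then obtain p' where p': "p = x # p'" "length p' = Suc k"
    by (auto simp: walks_within_def length_Suc_conv)
  have st: "standard_step n (p ! i) (p ! Suc i)" if "i < Suc k" for i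
    using p that by (auto simp: walks_within_def)
  have "standard_step n x (p' ! 0)" using st[of 0] p' by simp
  moreover have "standard_step n (p' ! i) (p' ! Suc i)" if "i < k" for i
    using st[of "Suc i"] that p' by simp
  then have "p' \<in> walks_within n R (p' ! 0) k"
    using p p' by (auto simp: walks_within_def)
  ultimately show "p \<in> (\<Union>q\<in>{q. standard_step n x q}. Cons x ` walks_within n R q k)"
    using p' by blast
next
  fix p assume "p \<in> (\<Union>q\<in>{q. standard_step n x q}. Cons x ` walks_within n R q k)"
  then obtain q p' where *: "standard_step n x q" "p' \<in> walks_within n R q k" "p = x # p'" by blast
  then have "standard_step n (p ! i) (p ! Suc i)" if "i < Suc k" for i
    using that by (cases i) (auto simp: walks_within_def)
  then show "p \<in> walks_within n R x (Suc k)"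
    using * assms by (auto simp: walks_within_def)
qed

lemma finite_walks_within: "finite (walks_within n R x k)"
proof (induction k arbitrary: x)
  case 0
  then show ?case by (cases "x \<in> R") (auto simp: walks_within_0 walks_within_outside)
next
  case (Suc k)
  have "finite {q. standard_step n x q}" unfolding standard_step_iff by auto
  then show ?case
    using Suc by (cases "x \<in> R") (auto simp: walks_within_Suc walks_within_outside)
qed

lemma card_walks_within_Suc:
  assumes "x \<in> R"
  shows "card (walks_within n R x (Suc k)) =
    (\<Sum>i\<in>{1..n}. card (walks_within n R (x(i := x i + 1)) k) + card (walks_within n R (x(i := x i - 1)) k))"
proof -
  let ?up = "\<lambda>i. x(i := x i + 1)" and ?down = "\<lambda>i. x(i := x i - 1)"
  have S: "{q. standard_step n x q} = ?up ` {1..n} \<union> ?down ` {1..n}"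
    by (auto simp: standard_step_iff)
  have inj: "inj_on ?up {1..n}" "inj_on ?down {1..n}"
    by (auto simp: inj_on_def fun_eq_iff split: if_splits)
  have disj: "?up ` {1..n} \<inter> ?down ` {1..n} = {}"
  proof -
    have "?up i \<noteq> ?down j" for i j
    proof
      assume eq: "?up i = ?down j"
      have "x i + 1 = (if i = j then x i - 1 else x i)"
        using fun_cong[OF eq, of i] by (auto split: if_splits)
      then show False by (auto split: if_splits)
    qed
    then show ?thesis by blast
  qed
  have "card (walks_within n R x (Suc k)) = (\<Sum>q\<in>{q. standard_step n x q}. card (Cons x ` walks_within n R q k))"
    unfolding walks_within_Suc[OF assms]
  proof (rule card_UN_disjoint)
    have "walks_within n R q k \<inter> walks_within n R q' k = {}" if "q \<noteq> q'" for q q'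
      using that by (auto simp: walks_within_def)
    then show "\<forall>i\<in>{q. standard_step n x q}. \<forall>j\<in>{q. standard_step n x q}. i \<noteq> j \<longrightarrow>
        (#) x ` walks_within n R i k \<inter> (#) x ` walks_within n R j k = {}"
      by blast
  qed (auto simp: S finite_walks_within)
  also have "\<dots> = (\<Sum>q\<in>{q. standard_step n x q}. card (walks_within n R q k))"
    by (intro sum.cong refl card_image) auto
  also have "\<dots> = (\<Sum>i\<in>{1..n}. card (walks_within n R (?up i) k)) + (\<Sum>i\<in>{1..n}. card (walks_within n R (?down i) k))"
    unfolding S by (subst sum.union_disjoint[OF _ _ disj]) (simp_all del: One_nat_def add: sum.reindex[OF inj(1)] sum.reindex[OF inj(2)] o_def)
  finally show ?thesis by (simp add: sum.distrib)
qed

text \<open>Only the diagonal product of each determinant appears, because the spectral sum runs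
  over all functions in \<open>freqs\<close> rather than increasing ones;
  \<open>sum_permuted_freqs\<close> restores the determinants by collecting the orderings of one
  frequency set.\<close>

definition mass :: "nat \<Rightarrow> nat \<Rightarrow> (nat \<Rightarrow> nat) \<Rightarrow> real" where
  "mass n M u = (\<Sum>g\<in>alc n M. \<Prod>h = 0..<n. sin (real (g h) * angle M u h))"

definition eigval :: "nat \<Rightarrow> (nat \<Rightarrow> real) \<Rightarrow> real" where
  "eigval n y = 2 * (\<Sum>h<n. cos (y h))"

text \<open>Both sides obey the same recursion in \<open>k\<close> inside the alcove and vanish at
  neighbours outside it: the count because walks must start inside, the spectral sum because those
  neighbours lie on walls. At \<open>k = 0\<close> completeness gives 1; the prefactor inverts its
  constant \<open>2 * (real M / 4) ^ n\<close>.\<close>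

theorem card_walks_within_alcove:
  assumes n: "n \<ge> 1" and M: "real M = 2 * m" and f: "f \<in> alc n M"
  shows "real (card (walks_within n (alcove_B n m) (alcove_point n f) k)) =
    (4 / real M) ^ n / 2 *
    (\<Sum>e<2. \<Sum>u\<in>freqs n M e. eigval n (angle M u) ^ k * mass n M u * sine_det n (angle M u) f)"
  using f
proof (induction k arbitrary: f)
  case 0
  have M0: "M > 0" using 0 by (auto simp: alc_def)
  have "alcove_point n f \<in> alcove_B n m"
    using alcove_point_in_alcove_iff[OF n M, of f] 0 by (auto simp: alc_def)
  then have "real (card (walks_within n (alcove_B n m) (alcove_point n f) 0)) = 1"
    by (simp add: walks_within_0)
  moreover have "(\<Sum>e<2. \<Sum>u\<in>freqs n M e. mass n M u * sine_det n (angle M u) f) = 2 * (real M / 4) ^ n"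
  proof -
    have "(\<Sum>e<2. \<Sum>u\<in>freqs n M e. mass n M u * sine_det n (angle M u) f) =
      (\<Sum>e<2. \<Sum>g\<in>alc n M. \<Sum>u\<in>freqs n M e. (\<Prod>h = 0..<n. sin (real (g h) * angle M u h)) * sine_det n (angle M u) f)"
      unfolding mass_def sum_distrib_right by (rule sum.cong[OF refl], rule sum.swap)
    also have "\<dots> = (\<Sum>g\<in>alc n M. \<Sum>e<2. \<Sum>u\<in>freqs n M e. (\<Prod>h = 0..<n. sin (real (g h) * angle M u h)) * sine_det n (angle M u) f)"
      by (rule sum.swap)
    also have "\<dots> = (\<Sum>g\<in>alc n M. 2 * (real M / 4) ^ n * of_bool (f = g))"
      by (intro sum.cong refl freqs_completeness 0)
    also have "\<dots> = (\<Sum>g\<in>{f}. 2 * (real M / 4) ^ n * of_bool (f = g))"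
      using 0 by (intro sum.mono_neutral_right) auto
    finally show ?thesis by simp
  qed
  ultimately show ?case using M0 by (simp add: power_divide)
next
  case (Suc k)
  define C where "C = (4 / real M) ^ n / 2"
  define F where "F g = C * (\<Sum>e<2. \<Sum>u\<in>freqs n M e. eigval n (angle M u) ^ k * mass n M u * sine_det n (angle M u) g)" for g
  let ?W = "\<lambda>x. real (card (walks_within n (alcove_B n m) x k))"
  have in_alc: "alcove_point n f \<in> alcove_B n m"
    using alcove_point_in_alcove_iff[OF n M, of f] Suc.prems by (auto simp: alc_def)
  have nb: "?W (alcove_point n (f(t := v))) = F (f(t := v))"
    if t: "t < n" and v: "v = Suc (f t) \<or> v = f t - 1" for t v
  proof (cases "f(t := v) \<in> alc n M")
    case True
    then show ?thesis unfolding F_def C_def by (rule Suc.IH)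
  next
    case False
    have "alcove_point n (f(t := v)) \<notin> alcove_B n m"
    proof -
      have "(f(t := v)) i = 0" if "i \<ge> n" for i
        using that Suc.prems t by (auto simp: alc_def)
      then show ?thesis using alcove_point_in_alcove_iff[OF n M] False by blast
    qed
    then have "?W (alcove_point n (f(t := v))) = 0" by (simp add: walks_within_outside)
    moreover have "F (f(t := v)) = 0"
      unfolding F_def using sine_det_outside_alc[OF Suc.prems t _ v False] by simp
    ultimately show ?thesis by simp
  qed
  have up: "(alcove_point n f)(i := alcove_point n f i + 1) = alcove_point n (f(n - i := Suc (f (n - i))))"
    and down: "(alcove_point n f)(i := alcove_point n f i - 1) = alcove_point n (f(n - i := f (n - i) - 1))"
    if i: "i \<in> {1..n}" for i
  proof -
    have "f (n - i) > 0" using Suc.prems i by (auto simp: alc_def)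
    then show "(alcove_point n f)(i := alcove_point n f i + 1) = alcove_point n (f(n - i := Suc (f (n - i))))"
      "(alcove_point n f)(i := alcove_point n f i - 1) = alcove_point n (f(n - i := f (n - i) - 1))"
      using i by (auto simp: fun_eq_iff alcove_point_def of_nat_diff)
  qed
  have "real (card (walks_within n (alcove_B n m) (alcove_point n f) (Suc k))) =
      (\<Sum>i\<in>{1..n}. ?W ((alcove_point n f)(i := alcove_point n f i + 1)) + ?W ((alcove_point n f)(i := alcove_point n f i - 1)))"
    unfolding card_walks_within_Suc[OF in_alc] by simp
  also have "\<dots> = (\<Sum>i\<in>{1..n}. F (f(n - i := Suc (f (n - i)))) + F (f(n - i := f (n - i) - 1)))"
  proof (rule sum.cong[OF refl])
    fix i assume i: "i \<in> {1..n}"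
    then have "n - i < n" by auto
    then show "?W ((alcove_point n f)(i := alcove_point n f i + 1)) + ?W ((alcove_point n f)(i := alcove_point n f i - 1)) =
        F (f(n - i := Suc (f (n - i)))) + F (f(n - i := f (n - i) - 1))"
      unfolding up[OF i] down[OF i] using nb by simp
  qed
  also have "\<dots> = (\<Sum>t<n. F (f(t := Suc (f t))) + F (f(t := f t - 1)))"
    by (rule sum.reindex_bij_witness[of _ "\<lambda>t. n - t" "\<lambda>i. n - i"]) auto
  also have "\<dots> = C * (\<Sum>e<2. \<Sum>u\<in>freqs n M e. eigval n (angle M u) ^ k * mass n M u *
      (\<Sum>t<n. sine_det n (angle M u) (f(t := Suc (f t))) + sine_det n (angle M u) (f(t := f t - 1))))"
    unfolding F_def sum_distrib_left distrib_left sum.distrib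
    by (simp only: sum.swap[of _ _ "{..<n}"])
  also have "\<dots> = C * (\<Sum>e<2. \<Sum>u\<in>freqs n M e. eigval n (angle M u) ^ Suc k * mass n M u * sine_det n (angle M u) f)"
  proof -
    have "(\<Sum>t<n. sine_det n (angle M u) (f(t := Suc (f t))) + sine_det n (angle M u) (f(t := f t - 1))) =
        eigval n (angle M u) * sine_det n (angle M u) f" for u
      unfolding eigval_def by (rule sine_det_step) (use Suc.prems in \<open>auto simp: alc_def\<close>)
    then show ?thesis by (simp add: mult_ac)
  qed
  finally show ?case by (simp add: C_def)
qed

section \<open>Products at odd multiples of an angle\<close>

lemma dt_transpose: "dt n (\<lambda>i j. f j i) = dt n f"
proof -
  have "mat n n (\<lambda>(i, j). f j i) = transpose_mat (mat n n (\<lambda>(i, j). f i j))"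
    by (intro eq_matI) auto
  then show ?thesis unfolding dt_def by (simp add: det_transpose[of _ n])
qed

lemma dt_permute_cols:
  assumes "p permutes {0..<n}"
  shows "dt n (\<lambda>i j. f i (p j)) = signof p * dt n f"
proof -
  have "dt n (\<lambda>i j. f i (p j)) = dt n (\<lambda>i j. f j (p i))"
    by (rule dt_transpose[symmetric])
  also have "\<dots> = signof p * dt n (\<lambda>i j. f j i)"
    by (rule dt_permute_rows[OF assms])
  also have "dt n (\<lambda>i j. f j i) = dt n f"
    by (rule dt_transpose)
  finally show ?thesis .
qed

text \<open>The factor is the sign of the reversal. Only its being nonzero is recorded, since it
  occurs once on each side of the product formula and cancels.\<close>

lemma ex_dt_reverse_cols:
  fixes f :: "nat \<Rightarrow> nat \<Rightarrow> 'a::idom"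
  obtains r :: 'a where "r \<noteq> 0" "\<And>f. dt n (\<lambda>i j. f i (n - 1 - j)) = r * dt n f"
proof -
  define p where "p j = (if j < n then n - 1 - j else j)" for j
  have p: "p permutes {0..<n}"
  proof (rule bij_imp_permutes)
    show "bij_betw p {0..<n} {0..<n}"
      by (rule bij_betw_byWitness[of _ p]) (auto simp: p_def)
  qed (auto simp: p_def)
  have rev: "dt n (\<lambda>i j. f i (n - 1 - j)) = signof p * dt n f" for f :: "nat \<Rightarrow> nat \<Rightarrow> 'a"
  proof -
    have "dt n (\<lambda>i j. f i (n - 1 - j)) = dt n (\<lambda>i j. f i (p j))"
      by (rule dt_cong) (simp add: p_def)
    then show ?thesis by (simp only: dt_permute_cols[OF p])
  qed
  have nz: "(signof p :: 'a) \<noteq> 0" by (simp add: sign_def)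
  show thesis by (rule that[OF nz rev])
qed

text \<open>The bound \<open>Suc c\<close> means parts at most \<open>c\<close>, so that
  \<open>c\<close> is the argument of \<open>A_term\<close> and \<open>B_term\<close>; all
  progressions now increase.\<close>

theorem sine_sum_product_ascending:
  fixes y :: "nat \<Rightarrow> real"
  assumes "n > 0" "\<And>h. h < n \<Longrightarrow> sin (y h) \<noteq> 0" "inj_on (\<lambda>h. cos (y h)) {0..<n}"
  shows "sine_sum n (Suc c) y * dt n (\<lambda>h j. sin ((1/2 + real j) * y h)) =
    dt n (\<lambda>h j. sin (((real c - real n + 2) / 2 + real j) * y h)) *
    dt n (\<lambda>h j. sin (((real c - real n + 1) / 2 + real j) * y h))"
proof -
  obtain r :: real where r: "r \<noteq> 0" "\<And>f. dt n (\<lambda>i j. f i (n - 1 - j)) = r * dt n f"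
    using ex_dt_reverse_cols[where 'a = real] by blast
  have rev: "real (n - 1 - j) = real n - 1 - real j" if "j < n" for j
    using that by (simp add: of_nat_diff)
  have rev1: "real n - 1/2 - real j = 1/2 + real (n - 1 - j)"
    and rev2: "(real (Suc c) + real n - 1) / 2 - real j = (real c - real n + 2) / 2 + real (n - 1 - j)"
    if "j < n" for j
    unfolding rev[OF that] by (simp_all add: field_simps)
  have 1: "dt n (\<lambda>h j. sin ((real n - 1/2 - real j) * y h)) = r * dt n (\<lambda>h j. sin ((1/2 + real j) * y h))"
    unfolding r(2)[symmetric] by (rule dt_cong) (simp only: rev1)
  have 2: "dt n (\<lambda>h j. sin (((real (Suc c) + real n - 1) / 2 - real j) * y h)) =
      r * dt n (\<lambda>h j. sin (((real c - real n + 2) / 2 + real j) * y h))"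
    unfolding r(2)[symmetric] by (rule dt_cong) (simp only: rev2)
  have 3: "(real (Suc c) - real n) / 2 = (real c - real n + 1) / 2" by simp
  have "r * (sine_sum n (Suc c) y * dt n (\<lambda>h j. sin ((1/2 + real j) * y h))) =
      r * (dt n (\<lambda>h j. sin (((real c - real n + 2) / 2 + real j) * y h)) *
        dt n (\<lambda>h j. sin (((real c - real n + 1) / 2 + real j) * y h)))"
    using sine_sum_product[OF assms, of "Suc c"] unfolding 1 2 3 by (simp only: mult_ac)
  then show ?thesis using r(1) by (simp only: mult_cancel_left simp_thms)
qed

text \<open>Chebyshev polynomials of the fourth (\<open>c = 3\<close>) and third
  (\<open>c = 1\<close>) kind, written in the variable (sin x)^2: the quotients sin((2h+1)x) / sin x
  and cos((2h+1)x) / cos x. The factor \<open>[:2, -4:]\<close> is 2 cos(2x).\<close>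

fun odd_trig_poly :: "real \<Rightarrow> nat \<Rightarrow> real poly" where
  "odd_trig_poly c 0 = 1"
| "odd_trig_poly c (Suc 0) = [:c, -4:]"
| "odd_trig_poly c (Suc (Suc h)) = [:2, -4:] * odd_trig_poly c (Suc h) - odd_trig_poly c h"

lemma degree_odd_trig_poly: "degree (odd_trig_poly c h) \<le> h"
proof (induction c h rule: odd_trig_poly.induct)
  case (3 c h)
  have "degree ([:2, -4:] * odd_trig_poly c (Suc h)) \<le> Suc (Suc h)"
    by (rule order.trans[OF degree_mult_le]) (use 3 in simp)
  then show ?case using 3 by (auto intro!: degree_diff_le)
qed auto

lemma coeff_odd_trig_poly: "coeff (odd_trig_poly c h) h = (-4) ^ h"
proof (induction c h rule: odd_trig_poly.induct)
  case (3 c h)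
  have "coeff (odd_trig_poly c (Suc h)) (Suc (Suc h)) = 0" "coeff (odd_trig_poly c h) (Suc (Suc h)) = 0"
    using degree_odd_trig_poly[of c "Suc h"] degree_odd_trig_poly[of c h] by (auto intro!: coeff_eq_0)
  then show ?case using 3 by simp
qed auto

lemma odd_multiple_step:
  fixes x :: real
  shows "sin ((2 * real (Suc (Suc h)) + 1) * x) = (2 - 4 * (sin x)\<^sup>2) * sin ((2 * real (Suc h) + 1) * x) - sin ((2 * real h + 1) * x)"
    and "cos ((2 * real (Suc (Suc h)) + 1) * x) = (2 - 4 * (sin x)\<^sup>2) * cos ((2 * real (Suc h) + 1) * x) - cos ((2 * real h + 1) * x)"
proof -
  define b where "b = (2 * real (Suc h) + 1) * x"
  have 1: "(2 * real (Suc (Suc h)) + 1) * x = b + 2 * x" "(2 * real h + 1) * x = b - 2 * x"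
    by (simp_all add: b_def algebra_simps)
  have 3: "sin (b + d) = 2 * cos d * sin b - sin (b - d)" for d
    unfolding sin_add sin_diff by simp
  have 4: "cos (b + d) = 2 * cos d * cos b - cos (b - d)" for d
    unfolding cos_add cos_diff by simp
  have 2: "2 - 4 * (sin x)\<^sup>2 = 2 * cos (2 * x)"
    by (simp add: cos_double_sin)
  show "sin ((2 * real (Suc (Suc h)) + 1) * x) = (2 - 4 * (sin x)\<^sup>2) * sin ((2 * real (Suc h) + 1) * x) - sin ((2 * real h + 1) * x)"
    "cos ((2 * real (Suc (Suc h)) + 1) * x) = (2 - 4 * (sin x)\<^sup>2) * cos ((2 * real (Suc h) + 1) * x) - cos ((2 * real h + 1) * x)"
    unfolding 1 2 b_def[symmetric] by (rule 3 4)+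
qed

lemma sin_odd_multiple: "sin ((2 * real h + 1) * x) = sin x * poly (odd_trig_poly 3 h) ((sin x)\<^sup>2)"
proof (induction h rule: induct_nat_012)
  case 1
  have "sin (3 * x) = sin (x + 2 * x)" by simp
  also have "\<dots> = sin x * (3 - 4 * (sin x)\<^sup>2)"
  proof -
    have "cos x * (2 * sin x * cos x) = 2 * sin x * (cos x)\<^sup>2"
      by (simp add: power2_eq_square)
    then have "cos x * (2 * sin x * cos x) = 2 * sin x * (1 - (sin x)\<^sup>2)"
      by (simp only: cos_squared_eq)
    then show ?thesis unfolding sin_add cos_double_sin sin_double by (simp add: algebra_simps)
  qed
  finally show ?case by (simp add: algebra_simps)
next
  case (ge2 h)
  show ?case unfolding odd_multiple_step(1) ge2 by (simp add: algebra_simps)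
qed simp

lemma cos_odd_multiple: "cos ((2 * real h + 1) * x) = cos x * poly (odd_trig_poly 1 h) ((sin x)\<^sup>2)"
proof (induction h rule: induct_nat_012)
  case 1
  have "cos (3 * x) = cos (x + 2 * x)" by simp
  also have "\<dots> = cos x * (1 - 4 * (sin x)\<^sup>2)"
    unfolding cos_add cos_double_sin sin_double by (simp add: power2_eq_square algebra_simps)
  finally show ?case by (simp add: algebra_simps)
next
  case (ge2 h)
  show ?case unfolding odd_multiple_step(2) ge2 by (simp add: algebra_simps)
qed simp

text \<open>At odd multiples of one angle the frequencies and the points exchange roles: column
  \<open>j\<close> lists the values at \<open>z j\<close> of polynomials of degrees 0, 1, 2, and so
  on, so up to leading coefficients the determinant is a Vandermonde product.\<close>

lemma dt_odd_trig_poly: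
  "dt n (\<lambda>h j. s j * poly (odd_trig_poly c h) (z j)) =
    (\<Prod>h = 0..<n. (-4) ^ h) * ((\<Prod>j = 0..<n. s j) * vdm {0..<n} z)"
proof -
  have "dt n (\<lambda>h j. s j * poly (odd_trig_poly c h) (z j)) = (\<Prod>j = 0..<n. s j) * dt n (\<lambda>i j. poly (odd_trig_poly c j) (z i))"
    by (subst dt_transpose[symmetric]) (rule dt_row_scale)
  also have "dt n (\<lambda>i j. poly (odd_trig_poly c j) (z i)) = (\<Prod>h = 0..<n. (-4) ^ h) * vdm {0..<n} z"
    by (subst dt_poly_lower) (simp_all add: degree_odd_trig_poly coeff_odd_trig_poly dt_Vandermonde)
  finally show ?thesis by simp
qed

text \<open>For \<open>s = sin\<close> this is the product form of the type B Weyl denominator at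
  the angles \<open>2 * \<alpha> * z j\<close>; \<open>s = cos\<close> is the variant that arises
  from the reflected frequencies.\<close>

definition trig_weight :: "(real \<Rightarrow> real) \<Rightarrow> nat \<Rightarrow> real \<Rightarrow> (nat \<Rightarrow> real) \<Rightarrow> real" where
  "trig_weight s n \<alpha> z = (\<Prod>j = 0..<n. s (\<alpha> * z j)) * pair_prod {0..<n} (\<lambda>h k. sin (\<alpha> * (z k - z h)) * sin (\<alpha> * (z k + z h)))"

lemma sin_squared_diff: "(sin a)\<^sup>2 - (sin b)\<^sup>2 = sin (a - b) * sin (a + b)" for a b :: real
proof -
  have "sin (a - b) * sin (a + b) = (sin a)\<^sup>2 * (cos b)\<^sup>2 - (cos a)\<^sup>2 * (sin b)\<^sup>2"
    unfolding sin_add sin_diff by (simp add: power2_eq_square algebra_simps)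
  then show ?thesis unfolding cos_squared_eq by (simp add: algebra_simps)
qed

lemma vdm_sin_squared:
  fixes \<alpha> :: real
  shows "vdm A (\<lambda>j. (sin (\<alpha> * z j))\<^sup>2) = pair_prod A (\<lambda>h k. sin (\<alpha> * (z k - z h)) * sin (\<alpha> * (z k + z h)))"
  unfolding vdm_def by (intro pair_prod_cong) (simp only: right_diff_distrib distrib_left, rule sin_squared_diff)

definition lead_const :: "nat \<Rightarrow> real" where
  "lead_const n = (\<Prod>h = 0..<n. (-4) ^ h)"

lemma lead_const_nonzero: "lead_const n \<noteq> 0"
  by (simp add: lead_const_def)

lemma dt_sin_odd_multiples:
  "dt n (\<lambda>h j. sin (z j * ((2 * real h + 1) * \<alpha>))) = lead_const n * trig_weight sin n \<alpha> z"
proof -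
  have "dt n (\<lambda>h j. sin (z j * ((2 * real h + 1) * \<alpha>))) =
      dt n (\<lambda>h j. sin (\<alpha> * z j) * poly (odd_trig_poly 3 h) ((sin (\<alpha> * z j))\<^sup>2))"
  proof (rule dt_cong)
    fix h j
    have "z j * ((2 * real h + 1) * \<alpha>) = (2 * real h + 1) * (\<alpha> * z j)" by (simp only: mult_ac)
    then show "sin (z j * ((2 * real h + 1) * \<alpha>)) = sin (\<alpha> * z j) * poly (odd_trig_poly 3 h) ((sin (\<alpha> * z j))\<^sup>2)"
      by (simp only: sin_odd_multiple)
  qed
  then show ?thesis
    by (simp only: dt_odd_trig_poly vdm_sin_squared trig_weight_def lead_const_def)
qed

lemma dt_cos_odd_multiples:
  "dt n (\<lambda>h j. cos (z j * ((2 * real h + 1) * \<alpha>))) = lead_const n * trig_weight cos n \<alpha> z"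
proof -
  have "dt n (\<lambda>h j. cos (z j * ((2 * real h + 1) * \<alpha>))) =
      dt n (\<lambda>h j. cos (\<alpha> * z j) * poly (odd_trig_poly 1 h) ((sin (\<alpha> * z j))\<^sup>2))"
  proof (rule dt_cong)
    fix h j
    have "z j * ((2 * real h + 1) * \<alpha>) = (2 * real h + 1) * (\<alpha> * z j)" by (simp only: mult_ac)
    then show "cos (z j * ((2 * real h + 1) * \<alpha>)) = cos (\<alpha> * z j) * poly (odd_trig_poly 1 h) ((sin (\<alpha> * z j))\<^sup>2)"
      by (simp only: cos_odd_multiple)
  qed
  then show ?thesis
    by (simp only: dt_odd_trig_poly vdm_sin_squared trig_weight_def lead_const_def)
qed

lemma trig_weight_eq_0: "j < n \<Longrightarrow> z j = 0 \<Longrightarrow> trig_weight sin n \<alpha> z = 0"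
  unfolding trig_weight_def by (simp, rule disjI1, rule bexI[of _ j]) auto

context
  fixes n :: nat and \<alpha> :: real
  assumes n: "n > 0" and \<alpha>: "\<alpha> > 0" "(2 * real n - 1) * \<alpha> < pi"
begin

text \<open>Strictly between 0 and pi the sine is positive and the cosine injective; these are the
  two hypotheses of the product formula.\<close>

lemma odd_multiple_bounds:
  assumes "h < n" shows "0 < (2 * real h + 1) * \<alpha>" "(2 * real h + 1) * \<alpha> < pi"
proof -
  have "real h + 1 \<le> real n" using assms unfolding nat_less_real_le .
  then have "2 * real h + 1 \<le> 2 * real n - 1" by linarith
  then have "(2 * real h + 1) * \<alpha> \<le> (2 * real n - 1) * \<alpha>"
    by (rule mult_right_mono) (use \<alpha>(1) in simp)
  then show "(2 * real h + 1) * \<alpha> < pi" using \<alpha>(2) by (rule le_less_trans)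
next
  show "0 < (2 * real h + 1) * \<alpha>" by (rule mult_pos_pos[OF _ \<alpha>(1)]) simp
qed

lemma inj_on_cos_odd_multiple: "inj_on (\<lambda>h. cos ((2 * real h + 1) * \<alpha>)) {0..<n}"
proof (rule inj_onI)
  fix h k assume hk: "h \<in> {0..<n}" "k \<in> {0..<n}" "cos ((2 * real h + 1) * \<alpha>) = cos ((2 * real k + 1) * \<alpha>)"
  have hn: "h < n" and kn: "k < n" using hk(1,2) by simp_all
  have "(2 * real h + 1) * \<alpha> = (2 * real k + 1) * \<alpha>"
    by (rule cos_inj_pi[OF _ _ _ _ hk(3)]) (rule less_imp_le odd_multiple_bounds hn kn)+
  then have "2 * real h + 1 = 2 * real k + 1"
    by (rule mult_right_cancel[OF less_imp_neq[OF \<alpha>(1), symmetric], THEN iffD1])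
  then show "h = k" by simp
qed

text \<open>All four determinants of the product formula factor with the same constant
  \<open>lead_const n\<close>, twice on each side, so the formula passes to the products.\<close>

lemma trig_weight_incs:
  "(\<Sum>g\<in>incs n (Suc c). trig_weight sin n \<alpha> (\<lambda>j. real (g j))) * trig_weight sin n \<alpha> (\<lambda>j. 1/2 + real j) =
    trig_weight sin n \<alpha> (\<lambda>j. (real c - real n + 2) / 2 + real j) *
    trig_weight sin n \<alpha> (\<lambda>j. (real c - real n + 1) / 2 + real j)"
proof -
  let ?y = "\<lambda>h. (2 * real h + 1) * \<alpha>" and ?T = "trig_weight sin n \<alpha>"
  have "sin (?y h) \<noteq> 0" if "h < n" for h
    using sin_gt_zero[OF odd_multiple_bounds[OF that]] by simp
  note prod = sine_sum_product_ascending[OF n this inj_on_cos_odd_multiple, of c]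
  have dt: "dt n (\<lambda>h j. sin ((b + real j) * ?y h)) = lead_const n * ?T (\<lambda>j. b + real j)" for b
    by (rule dt_sin_odd_multiples)
  have sum: "sine_sum n (Suc c) ?y = lead_const n * (\<Sum>g\<in>incs n (Suc c). ?T (\<lambda>j. real (g j)))"
    unfolding sine_sum_def sum_distrib_left
  proof (rule sum.cong[OF refl])
    fix g :: "nat \<Rightarrow> nat"
    show "dt n (\<lambda>h t. sin (real (g t) * ?y h)) = lead_const n * ?T (\<lambda>j. real (g j))"
      by (rule dt_sin_odd_multiples)
  qed
  have "(lead_const n * lead_const n) * ((\<Sum>g\<in>incs n (Suc c). ?T (\<lambda>j. real (g j))) * ?T (\<lambda>j. 1/2 + real j)) =
     (lead_const n * lead_const n) * (?T (\<lambda>j. (real c - real n + 2) / 2 + real j) * ?T (\<lambda>j. (real c - real n + 1) / 2 + real j))"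
    using prod unfolding dt sum by (simp only: mult_ac)
  moreover have "lead_const n * lead_const n \<noteq> 0" using lead_const_nonzero[of n] by simp
  ultimately show ?thesis by (rule mult_left_cancel[THEN iffD1, rotated])
qed

end

lemma pair_prod_mult: "pair_prod A (\<lambda>h k. F h k * G h k) = pair_prod A F * pair_prod A G"
  unfolding pair_prod_def by (simp only: prod.distrib)

lemma trig_weight_altdef:
  "trig_weight s n \<alpha> z = (\<Prod>j = 0..<n. s (\<alpha> * z j)) * vdm {0..<n} (\<lambda>j. (sin (\<alpha> * z j))\<^sup>2)"
  unfolding trig_weight_def vdm_sin_squared ..

lemma trig_weight_sin_cong:
  assumes "\<And>j. j < n \<Longrightarrow> sin (\<alpha> * z j) = sin (\<alpha> * w j)"
  shows "trig_weight sin n \<alpha> z = trig_weight sin n \<alpha> w"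
  unfolding trig_weight_altdef vdm_def
  by (intro arg_cong2[where f = "(*)"] prod.cong pair_prod_cong) (simp_all add: assms)

section \<open>Reflection of the angles at pi\<close>

lemma sin_nat_mult_pi_minus: "sin (real k * (pi - x)) = (-1) ^ Suc k * sin (real k * x)"
proof -
  have "real k * (pi - x) = real k * pi - real k * x" by (simp only: right_diff_distrib)
  then show ?thesis by (simp add: sin_diff)
qed

text \<open>At half-integral multiples the reflection exchanges sine and cosine; this is the source
  of the cosines in the oscillating terms.\<close>

lemma sin_half_nat_mult_pi_minus: "sin ((real k + 1/2) * (pi - x)) = (-1) ^ k * cos ((real k + 1/2) * x)"
proof -
  have "(real k + 1/2) * (pi - x) = real k * pi + (pi / 2 - (real k + 1/2) * x)" by (simp add: field_simps)
  then show ?thesis by (simp only: sin_add sin_npi cos_npi sin_diff sin_pi_half cos_pi_half) simp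
qed

lemma dt_sin_pi_minus:
  "dt n (\<lambda>h j. sin (real (k j) * (pi - (2 * real h + 1) * \<alpha>))) =
    (-1) ^ (\<Sum>j = 0..<n. Suc (k j)) * (lead_const n * trig_weight sin n \<alpha> (\<lambda>j. real (k j)))"
  unfolding sin_nat_mult_pi_minus dt_col_scale dt_sin_odd_multiples power_sum ..

lemma dt_sin_half_pi_minus:
  "dt n (\<lambda>h j. sin ((real (k j) + 1/2) * (pi - (2 * real h + 1) * \<alpha>))) =
    (-1) ^ (\<Sum>j = 0..<n. k j) * (lead_const n * trig_weight cos n \<alpha> (\<lambda>j. real (k j) + 1/2))"
  unfolding sin_half_nat_mult_pi_minus dt_col_scale dt_cos_odd_multiples power_sum ..

lemma sum_lessThan_choose_two: "(\<Sum>j = 0..<n. j) = n choose 2"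
  by (induction n) (simp_all add: numeral_2_eq_2)

lemma sine_sum_pi_minus:
  "sine_sum n M (\<lambda>h. pi - (2 * real h + 1) * \<alpha>) = (-1) ^ n * lead_const n *
    (\<Sum>g\<in>incs n M. (-1) ^ (\<Sum>j = 0..<n. g j) * trig_weight sin n \<alpha> (\<lambda>j. real (g j)))"
proof -
  have "(\<Sum>j = 0..<n. Suc (g j)) = n + (\<Sum>j = 0..<n. g j)" for g
    by (induction n) simp_all
  then show ?thesis
    unfolding sine_sum_def dt_sin_pi_minus sum_distrib_left by (simp only: power_add mult_ac)
qed

lemma signed_product_cancel:
  fixes L :: "'a::field"
  assumes eq: "(a * L * S) * (b * (L * D)) = (s * (L * W)) * (t * (L * C))"
    and st: "s * t = a * b * e" and nz: "L \<noteq> 0" "a \<noteq> 0" "b \<noteq> 0"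
  shows "S * D = e * (W * C)"
proof -
  have "(a * b * (L * L)) * (S * D) = (a * L * S) * (b * (L * D))" by (simp only: mult_ac)
  also have "\<dots> = (s * t) * (L * L) * (W * C)" unfolding eq by (simp only: mult_ac)
  also have "\<dots> = (a * b * (L * L)) * (e * (W * C))" unfolding st by (simp only: mult_ac)
  finally have "(a * b * (L * L)) * (S * D) = (a * b * (L * L)) * (e * (W * C))" .
  moreover have "a * b * (L * L) \<noteq> 0" using nz by simp
  ultimately show ?thesis by (rule mult_left_cancel[THEN iffD1, rotated])
qed

context
  fixes n :: nat and \<alpha> :: real
  assumes n: "n > 0" and \<alpha>: "\<alpha> > 0" "(2 * real n - 1) * \<alpha> < pi"
begin

lemma sine_sum_pi_minus_product:
  "sine_sum n (Suc c) (\<lambda>h. pi - (2 * real h + 1) * \<alpha>) *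
     dt n (\<lambda>h j. sin ((1/2 + real j) * (pi - (2 * real h + 1) * \<alpha>))) =
   dt n (\<lambda>h j. sin (((real c - real n + 2) / 2 + real j) * (pi - (2 * real h + 1) * \<alpha>))) *
   dt n (\<lambda>h j. sin (((real c - real n + 1) / 2 + real j) * (pi - (2 * real h + 1) * \<alpha>)))"
proof (rule sine_sum_product_ascending[OF n])
  fix h assume "h < n"
  from sin_gt_zero[OF odd_multiple_bounds[OF n \<alpha> this]]
  show "sin (pi - (2 * real h + 1) * \<alpha>) \<noteq> 0" by (simp only: sin_pi_minus)
next
  show "inj_on (\<lambda>h. cos (pi - (2 * real h + 1) * \<alpha>)) {0..<n}"
    using inj_on_cos_odd_multiple[OF n \<alpha>] unfolding cos_pi_minus inj_on_def by (simp only: neg_equal_iff_equal)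
qed

text \<open>For even \<open>c - n\<close> the progression from \<open>(c - n + 2) / 2\<close> is
  integral and keeps its sines, while the one from \<open>(c - n + 1) / 2\<close> is half-integral
  and turns into cosines. The signs of these two cancel; \<open>n\<close> and
  \<open>n choose 2\<close> from the other side add up to the exponent
  \<open>Suc n choose 2\<close>.\<close>

lemma trig_weight_incs_signed_even:
  assumes c: "c = n + 2 * q"
  shows "(\<Sum>g\<in>incs n (Suc c). (-1) ^ (\<Sum>j = 0..<n. g j) * trig_weight sin n \<alpha> (\<lambda>j. real (g j))) *
      trig_weight cos n \<alpha> (\<lambda>j. 1/2 + real j) =
    (-1) ^ (Suc n choose 2) * (trig_weight sin n \<alpha> (\<lambda>j. (real c - real n + 2) / 2 + real j) *
      trig_weight cos n \<alpha> (\<lambda>j. (real c - real n + 1) / 2 + real j))"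
proof -
  let ?L = "lead_const n" and ?S = "\<Sum>g\<in>incs n (Suc c). (-1) ^ (\<Sum>j = 0..<n. g j) * trig_weight sin n \<alpha> (\<lambda>j. real (g j))"
  have e: "(real c - real n + 2) / 2 + real j = real (q + 1 + j)"
    "(real c - real n + 1) / 2 + real j = real (q + j) + 1/2" "1/2 + real j = real j + 1/2" for j
    unfolding c by (simp_all add: field_simps)
  let ?W = "trig_weight sin n \<alpha> (\<lambda>j. real (q + 1 + j))" and ?C = "trig_weight cos n \<alpha> (\<lambda>j. real (q + j) + 1/2)"
  let ?D = "trig_weight cos n \<alpha> (\<lambda>j. real j + 1/2)"
  have eq: "((-1) ^ n * ?L * ?S) * ((-1) ^ (n choose 2) * (?L * ?D)) =
      ((-1) ^ (\<Sum>j = 0..<n. Suc (q + 1 + j)) * (?L * ?W)) * ((-1) ^ (\<Sum>j = 0..<n. q + j) * (?L * ?C))"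
    using sine_sum_pi_minus_product[of c]
    unfolding e sine_sum_pi_minus dt_sin_pi_minus dt_sin_half_pi_minus sum_lessThan_choose_two .
  have "(-1 :: real) ^ (\<Sum>j = 0..<n. Suc (q + 1 + j)) * (-1) ^ (\<Sum>j = 0..<n. q + j) = 1"
  proof -
    have "(\<Sum>j = 0..<n. Suc (q + 1 + j)) + (\<Sum>j = 0..<n. q + j) = (\<Sum>j = 0..<n. 2 * (q + 1 + j))"
      unfolding sum.distrib[symmetric] by (intro sum.cong) simp_all
    then show ?thesis by (simp only: power_add[symmetric] sum_distrib_left[symmetric] power_mult) simp
  qed
  moreover have "(-1 :: real) ^ n * (-1) ^ (n choose 2) * (-1) ^ (Suc n choose 2) = 1"
  proof -
    have "n + (n choose 2) + (Suc n choose 2) = 2 * (n + (n choose 2))" by (simp add: numeral_2_eq_2)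
    then show ?thesis by (simp only: power_add[symmetric] power_mult) simp
  qed
  ultimately have "(-1 :: real) ^ (\<Sum>j = 0..<n. Suc (q + 1 + j)) * (-1) ^ (\<Sum>j = 0..<n. q + j) =
      (-1) ^ n * (-1) ^ (n choose 2) * (-1) ^ (Suc n choose 2)" by (simp only:)
  from signed_product_cancel[OF eq this lead_const_nonzero]
  show ?thesis unfolding e by simp
qed

text \<open>Here the progression from \<open>(c - n + 2) / 2\<close> is the half-integral one. The
  signs on the right leave \<open>(-1) ^ n\<close>, which cancels the same sign on the left, so only
  \<open>n choose 2\<close> remains.\<close>

lemma trig_weight_incs_signed_odd:
  assumes c: "c = n + 2 * q + 1"
  shows "(\<Sum>g\<in>incs n (Suc c). (-1) ^ (\<Sum>j = 0..<n. g j) * trig_weight sin n \<alpha> (\<lambda>j. real (g j))) *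
      trig_weight cos n \<alpha> (\<lambda>j. 1/2 + real j) =
    (-1) ^ (n choose 2) * (trig_weight cos n \<alpha> (\<lambda>j. (real c - real n + 2) / 2 + real j) *
      trig_weight sin n \<alpha> (\<lambda>j. (real c - real n + 1) / 2 + real j))"
proof -
  let ?L = "lead_const n" and ?S = "\<Sum>g\<in>incs n (Suc c). (-1) ^ (\<Sum>j = 0..<n. g j) * trig_weight sin n \<alpha> (\<lambda>j. real (g j))"
  have e: "(real c - real n + 2) / 2 + real j = real (q + 1 + j) + 1/2"
    "(real c - real n + 1) / 2 + real j = real (q + 1 + j)" "1/2 + real j = real j + 1/2" for j
    unfolding c by (simp_all add: field_simps)
  let ?W = "trig_weight sin n \<alpha> (\<lambda>j. real (q + 1 + j))" and ?C = "trig_weight cos n \<alpha> (\<lambda>j. real (q + 1 + j) + 1/2)"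
  let ?D = "trig_weight cos n \<alpha> (\<lambda>j. real j + 1/2)"
  have eq: "((-1) ^ n * ?L * ?S) * ((-1) ^ (n choose 2) * (?L * ?D)) =
      ((-1) ^ (\<Sum>j = 0..<n. q + 1 + j) * (?L * ?C)) * ((-1) ^ (\<Sum>j = 0..<n. Suc (q + 1 + j)) * (?L * ?W))"
    using sine_sum_pi_minus_product[of c]
    unfolding e sine_sum_pi_minus dt_sin_pi_minus dt_sin_half_pi_minus sum_lessThan_choose_two .
  have "(-1 :: real) ^ (\<Sum>j = 0..<n. q + 1 + j) * (-1) ^ (\<Sum>j = 0..<n. Suc (q + 1 + j)) = (-1) ^ n"
  proof -
    have "(\<Sum>j = 0..<n. q + 1 + j) + (\<Sum>j = 0..<n. Suc (q + 1 + j)) = (\<Sum>j = 0..<n. 2 * (q + 1 + j) + 1)"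
      unfolding sum.distrib[symmetric] by (intro sum.cong) simp_all
    also have "\<dots> = 2 * (\<Sum>j = 0..<n. q + 1 + j) + n"
      by (simp only: sum.distrib sum_distrib_left[symmetric]) simp
    finally show ?thesis by (simp only: power_add[symmetric]) (simp add: power_add power_mult)
  qed
  moreover have "(-1 :: real) ^ n * (-1) ^ (n choose 2) * (-1) ^ (n choose 2) = (-1) ^ n"
    by (simp only: mult.assoc power_add[symmetric] mult_2[symmetric]) (simp add: power_mult power_add)
  ultimately have "(-1 :: real) ^ (\<Sum>j = 0..<n. q + 1 + j) * (-1) ^ (\<Sum>j = 0..<n. Suc (q + 1 + j)) =
      (-1) ^ n * (-1) ^ (n choose 2) * (-1) ^ (n choose 2)" by (simp only:)
  from signed_product_cancel[OF eq this lead_const_nonzero]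
  show ?thesis unfolding e by simp
qed

end

section \<open>Evaluation of the sums\<close>

lemma prod_two_step: "(\<Prod>h\<in>{1..2*n}. F h) = (\<Prod>j = 0..<n. F (2 * j + 2) * F (2 * j + 1))"
  for F :: "nat \<Rightarrow> 'a::comm_monoid_mult"
proof (induction n)
  case (Suc n)
  have "{1..2 * Suc n} = insert (2 * n + 2) (insert (2 * n + 1) {1..2*n})" by auto
  then show ?case using Suc by (simp add: mult_ac)
qed simp

lemma prod_atLeast1_shift: "(\<Prod>h\<in>{1..n}. F h) = (\<Prod>j = 0..<n. F (Suc j))"
  for F :: "nat \<Rightarrow> 'a::comm_monoid_mult"
  by (rule prod.reindex_bij_witness[of _ Suc "\<lambda>h. h - 1"]) auto

lemma pair_prod_Suc_top:
  "pair_prod {0..<Suc n} F = pair_prod {0..<n} F * (\<Prod>h = 0..<n. F h n)"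
proof -
  have "{0..<Suc n} = insert n {0..<n}" by auto
  then have "pair_prod {0..<Suc n} F = pair_prod {0..<n} F * (\<Prod>k = 0..<n. if k < n then F k n else F n k)"
    by (simp only:) (rule pair_prod_insert, simp_all)
  then show ?thesis by simp
qed

lemma pair_prod_Suc_bottom:
  "pair_prod {0..<Suc n} F = pair_prod {0..<n} (\<lambda>h k. F (Suc h) (Suc k)) * (\<Prod>k = 0..<n. F 0 (Suc k))"
proof -
  have "{0..<Suc n} = insert 0 (Suc ` {0..<n})" by (simp add: atLeast0_lessThan_Suc_eq_insert_0)
  then have "pair_prod {0..<Suc n} F = pair_prod (Suc ` {0..<n}) F *
      (\<Prod>k\<in>Suc ` {0..<n}. if k < 0 then F k 0 else F 0 k)"
    by (simp only:) (rule pair_prod_insert, auto)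
  also have "pair_prod (Suc ` {0..<n}) F = pair_prod {0..<n} (\<lambda>h k. F (Suc h) (Suc k))"
    by (rule pair_prod_reindex) (simp add: strict_mono_on_def)
  also have "(\<Prod>k\<in>Suc ` {0..<n}. if k < 0 then F k 0 else F 0 k) = (\<Prod>k = 0..<n. F 0 (Suc k))"
    by (subst prod.reindex) (simp_all add: o_def)
  finally show ?thesis .
qed

text \<open>The multiset of values \<open>h + k + 2 - n\<close> and \<open>h + k + 1 - n\<close> over pairs \<open>h < k < n\<close> is that
  of the differences \<open>t - h\<close> over a rectangle; both grow by the interval \<open>[1 - n, n]\<close> with each
  step of \<open>n\<close>.\<close>

lemma pair_prod_rectangle:
  fixes F :: "int \<Rightarrow> 'a::comm_monoid_mult"
  shows "pair_prod {0..<n} (\<lambda>h k. F (int h + int k + 2 - int n) * F (int h + int k + 1 - int n)) =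
    (\<Prod>h\<in>{1..n-1}. \<Prod>t\<in>{1..n}. F (int t - int h))"
proof (induction n)
  case (Suc n)
  have "pair_prod {0..<Suc n} (\<lambda>h k. F (int h + int k + 2 - int (Suc n)) * F (int h + int k + 1 - int (Suc n))) =
      pair_prod {0..<Suc n} (\<lambda>h k. F (int h + int k + 1 - int n)) * pair_prod {0..<Suc n} (\<lambda>h k. F (int h + int k - int n))"
    unfolding pair_prod_mult[symmetric] by (rule pair_prod_cong) (simp add: algebra_simps)
  \<comment> \<open>Removing the top index from the first family and the bottom index from the
    second brings both back to size \<open>n\<close>, with their roles exchanged. The removed
    factors are the values at 1, ..., n and at 1 - n, ..., 0.\<close>
  also have "pair_prod {0..<Suc n} (\<lambda>h k. F (int h + int k + 1 - int n)) =
      pair_prod {0..<n} (\<lambda>h k. F (int h + int k + 1 - int n)) * (\<Prod>h = 0..<n. F (int h + 1))"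
    unfolding pair_prod_Suc_top by (simp add: algebra_simps)
  also have "pair_prod {0..<Suc n} (\<lambda>h k. F (int h + int k - int n)) =
      pair_prod {0..<n} (\<lambda>h k. F (int h + int k + 2 - int n)) * (\<Prod>k = 0..<n. F (int k + 1 - int n))"
    unfolding pair_prod_Suc_bottom by (simp add: algebra_simps)
  finally have "pair_prod {0..<Suc n} (\<lambda>h k. F (int h + int k + 2 - int (Suc n)) * F (int h + int k + 1 - int (Suc n))) =
      pair_prod {0..<n} (\<lambda>h k. F (int h + int k + 2 - int n) * F (int h + int k + 1 - int n)) *
      ((\<Prod>k = 0..<n. F (int k + 1 - int n)) * (\<Prod>h = 0..<n. F (int h + 1)))"
    unfolding pair_prod_mult by (simp only: mult_ac)
  also have "\<dots> = (\<Prod>h\<in>{1..n-1}. \<Prod>t\<in>{1..n}. F (int t - int h)) *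
      ((\<Prod>k = 0..<n. F (int k + 1 - int n)) * (\<Prod>h = 0..<n. F (int h + 1)))"
    unfolding Suc.IH ..
  also have "\<dots> = (\<Prod>h\<in>{1..Suc n-1}. \<Prod>t\<in>{1..Suc n}. F (int t - int h))"
  proof (cases n)
    case (Suc n')
    have inner: "(\<Prod>t\<in>{1..Suc n}. F (int t - int h)) = (\<Prod>t\<in>{1..n}. F (int t - int h)) * F (int n + 1 - int h)" for h
    proof -
      have "{1..Suc n} = insert (Suc n) {1..n}" by auto
      then show ?thesis by (simp add: mult.commute algebra_simps)
    qed
    have outer: "{1..Suc n - 1} = insert n {1..n-1}" using Suc by auto
    have "(\<Prod>h\<in>{1..Suc n-1}. \<Prod>t\<in>{1..Suc n}. F (int t - int h)) =
        ((\<Prod>t\<in>{1..n}. F (int t - int n)) * F 1) *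
        ((\<Prod>h\<in>{1..n-1}. \<Prod>t\<in>{1..n}. F (int t - int h)) * (\<Prod>h\<in>{1..n-1}. F (int n + 1 - int h)))"
      unfolding inner outer using Suc by (subst prod.insert) (auto simp: prod.distrib)
    also have "(\<Prod>t\<in>{1..n}. F (int t - int n)) = (\<Prod>k = 0..<n. F (int k + 1 - int n))"
      unfolding prod_atLeast1_shift by (simp add: add.commute)
    also have "(\<Prod>h\<in>{1..n-1}. F (int n + 1 - int h)) = (\<Prod>h = 1..<n. F (int h + 1))"
      by (rule prod.reindex_bij_witness[of _ "\<lambda>h. n - h" "\<lambda>h. n - h"]) (auto simp: of_nat_diff algebra_simps)
    also have "F 1 = F (int 0 + 1)" by simp
    finally have "(\<Prod>h\<in>{1..Suc n-1}. \<Prod>t\<in>{1..Suc n}. F (int t - int h)) =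
        (\<Prod>h\<in>{1..n-1}. \<Prod>t\<in>{1..n}. F (int t - int h)) *
        ((\<Prod>k = 0..<n. F (int k + 1 - int n)) * (F (int 0 + 1) * (\<Prod>h = 1..<n. F (int h + 1))))"
      by (simp only: mult_ac)
    also have "F (int 0 + 1) * (\<Prod>h = 1..<n. F (int h + 1)) = (\<Prod>h = 0..<n. F (int h + 1))"
    proof -
      have "{0..<n} = insert 0 {1..<n}" using Suc by auto
      then show ?thesis by simp
    qed
    finally show ?thesis by (simp only:)
  qed simp
  finally show ?case .
qed (simp add: pair_prod_def)

definition pair_sum_sines :: "nat \<Rightarrow> real \<Rightarrow> real \<Rightarrow> real" where
  "pair_sum_sines n \<alpha> x = pair_prod {0..<n} (\<lambda>h k. sin (\<alpha> * (x + real h + real k)))"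

definition pair_diff_sines :: "nat \<Rightarrow> real \<Rightarrow> real" where
  "pair_diff_sines n \<alpha> = pair_prod {0..<n} (\<lambda>h k. sin (\<alpha> * (real k - real h)))"

text \<open>For a progression of step 1 the pair differences are independent of the start
  \<open>b\<close>; only the pair sums and the single factors depend on it.\<close>

lemma trig_weight_progression:
  "trig_weight s n \<alpha> (\<lambda>j. b + real j) =
    (\<Prod>j = 0..<n. s (\<alpha> * (b + real j))) * (pair_diff_sines n \<alpha> * pair_sum_sines n \<alpha> (2 * b))"
  unfolding trig_weight_def pair_diff_sines_def pair_sum_sines_def pair_prod_mult
  by (intro arg_cong2[where f = "(*)"] refl pair_prod_cong arg_cong[where f = sin]) (simp_all add: algebra_simps)

lemma pair_sum_sines_rectangle:
  "pair_sum_sines n \<alpha> (c - real n + 2) * pair_sum_sines n \<alpha> (c - real n + 1) =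
    (\<Prod>h\<in>{1..n-1}. \<Prod>t\<in>{1..n}. sin (\<alpha> * (c + real t - real h)))"
proof -
  have "(\<Prod>h\<in>{1..n-1}. \<Prod>t\<in>{1..n}. sin (\<alpha> * (c + real t - real h))) =
      (\<Prod>h\<in>{1..n-1}. \<Prod>t\<in>{1..n}. sin (\<alpha> * (c + real_of_int (int t - int h))))"
    by (intro prod.cong refl) (simp add: algebra_simps)
  also have "\<dots> = pair_prod {0..<n} (\<lambda>h k. sin (\<alpha> * (c + real_of_int (int h + int k + 2 - int n))) *
      sin (\<alpha> * (c + real_of_int (int h + int k + 1 - int n))))"
    by (rule pair_prod_rectangle[symmetric])
  also have "\<dots> = pair_sum_sines n \<alpha> (c - real n + 2) * pair_sum_sines n \<alpha> (c - real n + 1)"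
    unfolding pair_sum_sines_def pair_prod_mult[symmetric]
    by (intro pair_prod_cong arg_cong2[where f = "(*)"] arg_cong[where f = sin] arg_cong2[where f = "(*)" and a = \<alpha>] refl) simp_all
  finally show ?thesis ..
qed

lemma pair_prod_nonzero:
  fixes F :: "nat \<Rightarrow> nat \<Rightarrow> 'a::idom"
  assumes "finite A" "\<And>h k. h \<in> A \<Longrightarrow> k \<in> A \<Longrightarrow> h < k \<Longrightarrow> F h k \<noteq> 0"
  shows "pair_prod A F \<noteq> 0"
  using assms unfolding pair_prod_def by auto

text \<open>The numerator of \<open>B_term\<close> consists of the pair sums of the two shifted
  progressions; its denominator is the same product at \<open>c = n\<close>, that is, for
  progressions starting at 1 and at 1/2.\<close>

lemma B_term_pair_sum_sines:
  assumes "\<alpha> = pi / (2 * m)"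
  shows "B_term n m c = (pair_sum_sines n \<alpha> (c - real n + 2) * pair_sum_sines n \<alpha> (c - real n + 1)) /
    (pair_sum_sines n \<alpha> 2 * pair_sum_sines n \<alpha> 1)"
proof -
  have "pair_sum_sines n \<alpha> 2 * pair_sum_sines n \<alpha> 1 = (\<Prod>h\<in>{1..n-1}. \<Prod>t\<in>{1..n}. sin (\<alpha> * (real n + real t - real h)))"
    using pair_sum_sines_rectangle[of n \<alpha> "real n"] by simp
  then show ?thesis
    unfolding pair_sum_sines_rectangle B_term_def prod_dividef assms by (simp only: times_divide_eq_left)
qed

context
  fixes n :: nat and m \<alpha> :: real
  assumes n: "n > 0" and m: "m > 0" and \<alpha>_def: "\<alpha> = pi / (2 * m)" and bound: "2 * real n - 1 < 2 * m"
begin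

lemma angle_pos: "\<alpha> > 0" using m \<alpha>_def by simp

lemma angle_bound: "(2 * real n - 1) * \<alpha> < pi"
proof -
  have "(2 * real n - 1) * \<alpha> < (2 * m) * \<alpha>" using bound angle_pos by (rule mult_strict_right_mono)
  also have "\<dots> = pi" using m by (simp add: \<alpha>_def)
  finally show ?thesis .
qed

lemma sin_angle_nonzero:
  assumes "0 < x" "x \<le> 2 * real n - 1" shows "sin (\<alpha> * x) > 0"
proof (rule sin_gt_zero)
  show "0 < \<alpha> * x" by (rule mult_pos_pos[OF angle_pos assms(1)])
  have "\<alpha> * x \<le> \<alpha> * (2 * real n - 1)" by (rule mult_left_mono[OF assms(2) less_imp_le[OF angle_pos]])
  also have "\<dots> < pi" using angle_bound by (simp only: mult.commute)
  finally show "\<alpha> * x < pi" .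
qed

lemma cos_angle_nonzero:
  assumes "0 \<le> x" "2 * x \<le> 2 * real n - 1" shows "cos (\<alpha> * x) > 0"
proof (rule cos_gt_zero_pi)
  have "0 \<le> \<alpha> * x" by (rule mult_nonneg_nonneg[OF less_imp_le[OF angle_pos] assms(1)])
  then show "- (pi / 2) < \<alpha> * x" using pi_gt_zero by linarith
  have "\<alpha> * (2 * x) \<le> \<alpha> * (2 * real n - 1)" by (rule mult_left_mono[OF assms(2) less_imp_le[OF angle_pos]])
  also have "\<dots> < pi" using angle_bound by (simp only: mult.commute)
  finally have "2 * (\<alpha> * x) < pi" by (simp only: mult.left_commute)
  then show "\<alpha> * x < pi / 2" by linarith
qed

lemma less_le_pred: "k < n \<Longrightarrow> real k \<le> real n - 1" by (simp add: nat_less_real_le)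

lemma pair_diff_sines_nonzero: "pair_diff_sines n \<alpha> \<noteq> 0"
  unfolding pair_diff_sines_def
proof (rule pair_prod_nonzero)
  fix h k assume "h \<in> {0..<n}" "k \<in> {0..<n}" "h < k"
  then have "real h < real k" "real k \<le> real n - 1" using less_le_pred[of k] by simp_all
  then have "sin (\<alpha> * (real k - real h)) > 0" by (intro sin_angle_nonzero) linarith+
  then show "sin (\<alpha> * (real k - real h)) \<noteq> 0" by simp
qed simp

lemma pair_sum_sines_nonzero:
  assumes "0 < x" "x \<le> 2" shows "pair_sum_sines n \<alpha> x \<noteq> 0"
  unfolding pair_sum_sines_def
proof (rule pair_prod_nonzero)
  fix h k assume "h \<in> {0..<n}" "k \<in> {0..<n}" "h < k"
  then have "real h + 1 \<le> real k" "real k \<le> real n - 1" using less_le_pred[of k] by (simp_all add: nat_less_real_le)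
  then have "sin (\<alpha> * (x + real h + real k)) > 0" using assms by (intro sin_angle_nonzero) linarith+
  then show "sin (\<alpha> * (x + real h + real k)) \<noteq> 0" by simp
qed simp

lemma sin_angle_Suc_nonzero:
  assumes "j < n" "0 < b" "b \<le> 1" shows "sin (\<alpha> * (b + real j)) \<noteq> 0"
proof -
  have "0 < b + real j" "b + real j \<le> 2 * real n - 1" using less_le_pred[OF assms(1)] assms n by linarith+
  then show ?thesis using sin_angle_nonzero[of "b + real j"] by simp
qed

lemma cos_angle_half_nonzero:
  assumes "j < n" shows "cos (\<alpha> * (1/2 + real j)) \<noteq> 0"
proof -
  have "2 * (1/2 + real j) = 1 + 2 * real j" by simp
  then have "0 \<le> 1/2 + real j" "2 * (1/2 + real j) \<le> 2 * real n - 1" using less_le_pred[OF assms(1)] by linarith+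
  then show ?thesis using cos_angle_nonzero[of "1/2 + real j"] by simp
qed

text \<open>One evaluation serves all three sums, with sine or cosine for \<open>s1\<close>,
  \<open>s2\<close>, \<open>s3\<close>. The weight of the point 1, ..., n is split off because it is
  a factor of \<open>R_term\<close>; its pair sums complete the denominator of
  \<open>B_term\<close>.\<close>

lemma trig_weight_ratio:
  assumes eq: "S * trig_weight s3 n \<alpha> (\<lambda>j. 1/2 + real j) =
      e * (trig_weight s1 n \<alpha> (\<lambda>j. (real c - real n + 2) / 2 + real j) *
      trig_weight s2 n \<alpha> (\<lambda>j. (real c - real n + 1) / 2 + real j))"
    and nz: "\<And>j. j < n \<Longrightarrow> s3 (\<alpha> * (1/2 + real j)) \<noteq> 0"
  shows "S = trig_weight sin n \<alpha> (\<lambda>j. 1 + real j) * (e * (B_term n m (real c) *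
    (\<Prod>j = 0..<n. s1 (\<alpha> * ((real c - real n + 2) / 2 + real j)) * s2 (\<alpha> * ((real c - real n + 1) / 2 + real j)) /
      (s3 (\<alpha> * (1/2 + real j)) * sin (\<alpha> * (1 + real j))))))"
proof -
  let ?D = "pair_diff_sines n \<alpha>" and ?P = "pair_sum_sines n \<alpha>"
  let ?p1 = "\<Prod>j = 0..<n. s1 (\<alpha> * ((real c - real n + 2) / 2 + real j))"
    and ?p2 = "\<Prod>j = 0..<n. s2 (\<alpha> * ((real c - real n + 1) / 2 + real j))"
    and ?p3 = "\<Prod>j = 0..<n. s3 (\<alpha> * (1/2 + real j))"
    and ?p4 = "\<Prod>j = 0..<n. sin (\<alpha> * (1 + real j))"
  have two: "2 * ((real c - real n + 2) / 2) = real c - real n + 2" "2 * ((real c - real n + 1) / 2) = real c - real n + 1"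
    "2 * (1/2) = (1::real)" "2 * 1 = (2::real)" by simp_all
  have D: "?D \<noteq> 0" by (rule pair_diff_sines_nonzero)
  have P: "?P 1 \<noteq> 0" "?P 2 \<noteq> 0" by (rule pair_sum_sines_nonzero; simp)+
  have p3: "?p3 \<noteq> 0" using nz by simp
  have p4: "?p4 \<noteq> 0" using sin_angle_Suc_nonzero[of _ 1] by simp
  have abstract: "S = w * (e * (x * y / (q2 * q1) * (a1 * a2 / (a3 * a4))))"
    if "S * (a3 * (d * q1)) = e * ((a1 * (d * x)) * (a2 * (d * y)))" "w = a4 * (d * q2)"
      "d \<noteq> 0" "q1 \<noteq> 0" "q2 \<noteq> 0" "a3 \<noteq> 0" "a4 \<noteq> 0" for S w x y q1 q2 a1 a2 a3 a4 d :: real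
  proof -
    have "S = e * ((a1 * (d * x)) * (a2 * (d * y))) / (a3 * (d * q1))"
      using that by (simp add: eq_divide_eq)
    also have "\<dots> = w * (e * (x * y / (q2 * q1) * (a1 * a2 / (a3 * a4))))"
      unfolding that(2) using that(3-7) by (simp add: field_simps)
    finally show ?thesis .
  qed
  show ?thesis
    unfolding B_term_pair_sum_sines[OF \<alpha>_def] prod_dividef prod.distrib
    by (rule abstract[OF _ _ D P p3 p4])
      (use eq in \<open>simp_all only: trig_weight_progression two\<close>)
qed

lemma sum_trig_weight_incs:
  "(\<Sum>g\<in>incs n (Suc c). trig_weight sin n \<alpha> (\<lambda>j. real (g j))) =
    trig_weight sin n \<alpha> (\<lambda>j. 1 + real j) * A_term n m (real c)"
proof -
  have eq: "(\<Sum>g\<in>incs n (Suc c). trig_weight sin n \<alpha> (\<lambda>j. real (g j))) * trig_weight sin n \<alpha> (\<lambda>j. 1/2 + real j) =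
      1 * (trig_weight sin n \<alpha> (\<lambda>j. (real c - real n + 2) / 2 + real j) *
      trig_weight sin n \<alpha> (\<lambda>j. (real c - real n + 1) / 2 + real j))"
    unfolding trig_weight_incs[OF n angle_pos angle_bound] by (simp only: mult_1_left)
  have "(\<Prod>j = 0..<n. sin (\<alpha> * ((real c - real n + 2) / 2 + real j)) * sin (\<alpha> * ((real c - real n + 1) / 2 + real j)) /
      (sin (\<alpha> * (1/2 + real j)) * sin (\<alpha> * (1 + real j)))) =
      (\<Prod>h\<in>{1..2*n}. sin (pi * (real c - real n + real h) / (4 * m)) / sin (pi * real h / (4 * m)))"
    unfolding prod_two_step
  proof (rule prod.cong[OF refl])
    fix j
    have e: "\<alpha> * ((real c - real n + 2) / 2 + real j) = pi * (real c - real n + real (2 * j + 2)) / (4 * m)"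
      "\<alpha> * ((real c - real n + 1) / 2 + real j) = pi * (real c - real n + real (2 * j + 1)) / (4 * m)"
      "\<alpha> * (1/2 + real j) = pi * real (2 * j + 1) / (4 * m)" "\<alpha> * (1 + real j) = pi * real (2 * j + 2) / (4 * m)"
      using m by (simp_all add: \<alpha>_def field_simps)
    show "sin (\<alpha> * ((real c - real n + 2) / 2 + real j)) * sin (\<alpha> * ((real c - real n + 1) / 2 + real j)) /
      (sin (\<alpha> * (1/2 + real j)) * sin (\<alpha> * (1 + real j))) =
      sin (pi * (real c - real n + real (2 * j + 2)) / (4 * m)) / sin (pi * real (2 * j + 2) / (4 * m)) *
      (sin (pi * (real c - real n + real (2 * j + 1)) / (4 * m)) / sin (pi * real (2 * j + 1) / (4 * m)))"
      unfolding e by (simp only: times_divide_times_eq mult_ac)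
  qed
  then show ?thesis
    using trig_weight_ratio[OF eq sin_angle_Suc_nonzero[of _ "1/2"]]
    by (simp add: A_term_def mult.commute)
qed

lemma sum_trig_weight_incs_signed_even:
  assumes "c = n + 2 * q"
  shows "(\<Sum>g\<in>incs n (Suc c). (-1) ^ (\<Sum>j = 0..<n. g j) * trig_weight sin n \<alpha> (\<lambda>j. real (g j))) =
    trig_weight sin n \<alpha> (\<lambda>j. 1 + real j) * ((-1) ^ (Suc n choose 2) * (B_term n m (real c) *
      (\<Prod>h\<in>{1..n}. cos (pi * (real c - real n + 2 * real h - 1) / (4 * m)) *
         sin (pi * (real c - real n + 2 * real h) / (4 * m)) / D_term m h)))"
proof -
  have "(\<Prod>j = 0..<n. sin (\<alpha> * ((real c - real n + 2) / 2 + real j)) * cos (\<alpha> * ((real c - real n + 1) / 2 + real j)) /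
      (cos (\<alpha> * (1/2 + real j)) * sin (\<alpha> * (1 + real j)))) =
      (\<Prod>h\<in>{1..n}. cos (pi * (real c - real n + 2 * real h - 1) / (4 * m)) *
         sin (pi * (real c - real n + 2 * real h) / (4 * m)) / D_term m h)"
    unfolding prod_atLeast1_shift D_term_def
  proof (rule prod.cong[OF refl])
    fix j
    have e: "\<alpha> * ((real c - real n + 2) / 2 + real j) = pi * (real c - real n + 2 * real (Suc j)) / (4 * m)"
      "\<alpha> * ((real c - real n + 1) / 2 + real j) = pi * (real c - real n + 2 * real (Suc j) - 1) / (4 * m)"
      "\<alpha> * (1/2 + real j) = pi * (2 * real (Suc j) - 1) / (4 * m)" "\<alpha> * (1 + real j) = pi * real (Suc j) / (2 * m)"
      using m by (simp_all add: \<alpha>_def field_simps)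
    show "sin (\<alpha> * ((real c - real n + 2) / 2 + real j)) * cos (\<alpha> * ((real c - real n + 1) / 2 + real j)) /
      (cos (\<alpha> * (1/2 + real j)) * sin (\<alpha> * (1 + real j))) =
      cos (pi * (real c - real n + 2 * real (Suc j) - 1) / (4 * m)) * sin (pi * (real c - real n + 2 * real (Suc j)) / (4 * m)) /
      (cos (pi * (2 * real (Suc j) - 1) / (4 * m)) * sin (pi * real (Suc j) / (2 * m)))"
      unfolding e by (simp only: mult_ac)
  qed
  then show ?thesis
    using trig_weight_ratio[OF trig_weight_incs_signed_even[OF n angle_pos angle_bound assms] cos_angle_half_nonzero]
    by (simp only:)
qed

lemma sum_trig_weight_incs_signed_odd:
  assumes "c = n + 2 * q + 1"
  shows "(\<Sum>g\<in>incs n (Suc c). (-1) ^ (\<Sum>j = 0..<n. g j) * trig_weight sin n \<alpha> (\<lambda>j. real (g j))) =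
    trig_weight sin n \<alpha> (\<lambda>j. 1 + real j) * ((-1) ^ (n choose 2) * (B_term n m (real c) *
      (\<Prod>h\<in>{1..n}. sin (pi * (real c - real n + 2 * real h - 1) / (4 * m)) *
         cos (pi * (real c - real n + 2 * real h) / (4 * m)) / D_term m h)))"
proof -
  have "(\<Prod>j = 0..<n. cos (\<alpha> * ((real c - real n + 2) / 2 + real j)) * sin (\<alpha> * ((real c - real n + 1) / 2 + real j)) /
      (cos (\<alpha> * (1/2 + real j)) * sin (\<alpha> * (1 + real j)))) =
      (\<Prod>h\<in>{1..n}. sin (pi * (real c - real n + 2 * real h - 1) / (4 * m)) *
         cos (pi * (real c - real n + 2 * real h) / (4 * m)) / D_term m h)"
    unfolding prod_atLeast1_shift D_term_def
  proof (rule prod.cong[OF refl])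
    fix j
    have e: "\<alpha> * ((real c - real n + 2) / 2 + real j) = pi * (real c - real n + 2 * real (Suc j)) / (4 * m)"
      "\<alpha> * ((real c - real n + 1) / 2 + real j) = pi * (real c - real n + 2 * real (Suc j) - 1) / (4 * m)"
      "\<alpha> * (1/2 + real j) = pi * (2 * real (Suc j) - 1) / (4 * m)" "\<alpha> * (1 + real j) = pi * real (Suc j) / (2 * m)"
      using m by (simp_all add: \<alpha>_def field_simps)
    show "cos (\<alpha> * ((real c - real n + 2) / 2 + real j)) * sin (\<alpha> * ((real c - real n + 1) / 2 + real j)) /
      (cos (\<alpha> * (1/2 + real j)) * sin (\<alpha> * (1 + real j))) =
      sin (pi * (real c - real n + 2 * real (Suc j) - 1) / (4 * m)) * cos (pi * (real c - real n + 2 * real (Suc j)) / (4 * m)) /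
      (cos (pi * (2 * real (Suc j) - 1) / (4 * m)) * sin (pi * real (Suc j) / (2 * m)))"
      unfolding e by (simp only: mult_ac)
  qed
  then show ?thesis
    using trig_weight_ratio[OF trig_weight_incs_signed_odd[OF n angle_pos angle_bound assms] cos_angle_half_nonzero]
    by (simp only:)
qed

end

section \<open>Dominant frequencies\<close>

lemma alcI:
  assumes "\<And>i. i \<ge> n \<Longrightarrow> g i = 0" "\<And>i. i < n \<Longrightarrow> 0 < g i" "\<And>i. Suc i < n \<Longrightarrow> g i < g (Suc i)"
    and "g (n - 1) + (if n \<ge> 2 then g (n - 2) else 0) < M"
  shows "g \<in> alc n M"
  unfolding alc_def mem_Collect_eq using assms by blast

lemma incsI:
  assumes "\<And>i. i \<ge> n \<Longrightarrow> g i = 0" "\<And>i. i < n \<Longrightarrow> g i < M" "\<And>i. Suc i < n \<Longrightarrow> g i < g (Suc i)"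
  shows "g \<in> incs n M"
  unfolding incs_def mem_Collect_eq using assms by blast

text \<open>Replacing x_1 by M - x_1 preserves the alcove because its outer inequality says x_2 < M
  - x_1. Points with 2 x_1 = M are fixed and counted in the lower half only, so the parts are at
  most \<open>M div 2\<close> in one half and below \<open>(M + 1) div 2\<close> in the other. Since
  \<open>H\<close> vanishes when the smallest part is 0, both halves may be extended to
  \<open>incs\<close>.\<close>

lemma sum_alc_reflect:
  fixes H :: "(nat \<Rightarrow> nat) \<Rightarrow> real"
  assumes n: "n > 0" and M: "M > 0" and zero: "\<And>g. g 0 = 0 \<Longrightarrow> H g = 0"
    and reflect: "\<And>g. g (n - 1) < M \<Longrightarrow> H (g(n - 1 := M - g (n - 1))) = \<kappa> * H g"
  shows "sum H (alc n M) = sum H (incs n (Suc (M div 2))) + \<kappa> * sum H (incs n ((M + 1) div 2))"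
proof -
  let ?lo = "{g \<in> alc n M. 2 * g (n - 1) \<le> M}" and ?hi = "{g \<in> alc n M. \<not> 2 * g (n - 1) \<le> M}"
  let ?pos = "\<lambda>B. {g \<in> incs n B. 0 < g 0}"
  have restrict: "sum H (incs n B) = sum H (?pos B)" for B
    by (rule sum.mono_neutral_right) (use zero in auto)
  have pos: "0 < g i" if "g \<in> ?pos B" "i < n" for g B i
    using incs_strict_mono[of g n B 0 i] that by (cases "i = 0") auto
  have le_top: "g i \<le> g (n - 1)" if "g \<in> incs n B" "i < n" for g B i
  proof -
    have "i = n - 1 \<or> i < n - 1" using that(2) by linarith
    then show ?thesis using incs_strict_mono[OF that(1), of i "n - 1"] n by auto
  qed
  have n2: "g (n - 2) < g (n - 1)" if "\<forall>i. Suc i < n \<longrightarrow> g i < g (Suc i)" "n \<ge> 2" for g :: "nat \<Rightarrow> nat"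
  proof -
    have "Suc (n - 2) = n - 1" "Suc (n - 2) < n" using that(2) by simp_all
    then show ?thesis using that(1) by metis
  qed
  have lo: "?lo = ?pos (Suc (M div 2))"
  proof (intro equalityI subsetI)
    fix g assume g: "g \<in> ?lo"
    then have "g i \<le> g (n - 1)" if "i < n" for i using alc_mono[of g n M i "n - 1"] that by auto
    moreover have "g (n - 1) \<le> M div 2" using g by auto
    ultimately have "g i < Suc (M div 2)" if "i < n" for i using that by (metis le_imp_less_Suc order.trans)
    then show "g \<in> ?pos (Suc (M div 2))" using g n by (auto simp: alc_def incs_def)
  next
    fix g assume g: "g \<in> ?pos (Suc (M div 2))"
    then have gi: "g \<in> incs n (Suc (M div 2))" by simp
    have "g (n - 1) < Suc (M div 2)" using gi n by (simp add: incs_def)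
    then have top: "2 * g (n - 1) \<le> M" by simp
    have inc: "\<forall>i. Suc i < n \<longrightarrow> g i < g (Suc i)" using gi by (simp add: incs_def)
    have "g (n - 1) + (if n \<ge> 2 then g (n - 2) else 0) < M"
    proof (cases "n \<ge> 2")
      case True
      then show ?thesis using n2[OF inc] top by simp
    next
      case False
      then show ?thesis using top pos[OF g, of "n - 1"] n by simp
    qed
    moreover have "\<forall>i<n. 0 < g i" using pos[OF g] by blast
    moreover have "\<forall>i\<ge>n. g i = 0" using gi by (simp add: incs_def)
    ultimately show "g \<in> ?lo" using inc top by (simp add: alc_def)
  qed
  let ?r = "\<lambda>g. g(n - 1 := M - g (n - 1))"
  have to: "?r g \<in> ?hi" if g: "g \<in> ?pos ((M + 1) div 2)" for g
  proof -
    have gi: "g \<in> incs n ((M + 1) div 2)" using g by simp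
    have inc: "\<forall>i. Suc i < n \<longrightarrow> g i < g (Suc i)" using gi by (simp add: incs_def)
    have "g (n - 1) < (M + 1) div 2" using gi n by (simp add: incs_def)
    then have top: "2 * g (n - 1) < M" by simp
    have t0: "0 < g (n - 1)" using pos[OF g, of "n - 1"] n by simp
    have r1: "?r g i < ?r g (Suc i)" if "Suc i < n" for i
    proof (cases "Suc i = n - 1")
      case True
      then have "g i < g (n - 1)" using inc that by metis
      then show ?thesis using True top by simp
    next
      case False
      moreover have "i \<noteq> n - 1" using that by simp
      ultimately show ?thesis using inc that by simp
    qed
    have r2: "0 < ?r g i" if "i < n" for i using pos[OF g that] top by simp
    have r3: "?r g i = 0" if "i \<ge> n" for i using gi that n by (simp add: incs_def)
    have r4: "?r g (n - 1) + (if n \<ge> 2 then ?r g (n - 2) else 0) < M"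
    proof (cases "n \<ge> 2")
      case True
      have "n - 2 \<noteq> n - 1" using True by simp
      then have "?r g (n - 2) = g (n - 2)" by (rule fun_upd_other)
      moreover have "M - x + z < M" if "z < x" "2 * x < M" for x z :: nat using that by simp
      ultimately show ?thesis using n2[OF inc True] top by (simp only: True if_True fun_upd_same)
    next
      case False
      have "M - x < M" if "0 < x" "2 * x < M" for x :: nat using that by simp
      from this[OF t0 top] show ?thesis by (simp only: False if_False fun_upd_same add_0_right)
    qed
    have "?r g \<in> alc n M"
    proof (rule alcI)
      show "?r g i = 0" if "i \<ge> n" for i by (rule r3[OF that])
      show "0 < ?r g i" if "i < n" for i by (rule r2[OF that])
      show "?r g i < ?r g (Suc i)" if "Suc i < n" for i by (rule r1[OF that])
    qed (rule r4)
    then show ?thesis using top by simp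
  qed
  have into: "?r g \<in> ?pos ((M + 1) div 2)" if g: "g \<in> ?hi" for g
  proof -
    have ga: "g \<in> alc n M" and top: "M < 2 * g (n - 1)" using g by simp_all
    have inc: "\<forall>i. Suc i < n \<longrightarrow> g i < g (Suc i)" using ga by (simp add: alc_def)
    have lt: "g (n - 1) < M" using alc_less[OF ga] n by simp
    have gap: "g i < M - g (n - 1)" if "Suc i < n" for i
    proof -
      have "g i + g (n - 1) < M" using that by (intro alc_pair_sum[OF ga]) auto
      then show ?thesis by simp
    qed
    have "M - x < (M + 1) div 2" if "M < 2 * x" for x using that M by presburger
    from this[OF top] have bd: "M - g (n - 1) < (M + 1) div 2" .
    have r1: "?r g i < ?r g (Suc i)" if "Suc i < n" for i
    proof (cases "Suc i = n - 1")
      case True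
      then show ?thesis using gap[OF that] by simp
    next
      case False
      moreover have "i \<noteq> n - 1" using that by simp
      ultimately show ?thesis using inc that by simp
    qed
    have r2: "?r g i < (M + 1) div 2" if "i < n" for i
    proof (cases "i = n - 1")
      case True
      then show ?thesis using bd by simp
    next
      case False
      then have "Suc i < n" using that by simp
      moreover have "?r g i = g i" using False by simp
      ultimately show ?thesis using gap[of i] bd by simp
    qed
    have r3: "?r g i = 0" if "i \<ge> n" for i using ga that n by (simp add: alc_def)
    have "?r g \<in> incs n ((M + 1) div 2)"
    proof (rule incsI)
      show "?r g i = 0" if "i \<ge> n" for i by (rule r3[OF that])
      show "?r g i < (M + 1) div 2" if "i < n" for i by (rule r2[OF that])
      show "?r g i < ?r g (Suc i)" if "Suc i < n" for i by (rule r1[OF that])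
    qed
    moreover have "0 < ?r g 0"
    proof (cases "n - 1 = 0")
      case True
      then show ?thesis using lt by simp
    next
      case False
      have "0 < g 0" using ga n by (simp add: alc_def)
      then show ?thesis using False by simp
    qed
    ultimately show ?thesis by simp
  qed
  have invol: "?r (?r g) = g" if "g (n - 1) < M" for g :: "nat \<Rightarrow> nat"
    using that by auto
  have "sum H ?hi = (\<Sum>g\<in>?pos ((M + 1) div 2). H (?r g))"
  proof (rule sum.reindex_bij_witness[of _ ?r ?r])
    fix g assume g: "g \<in> ?hi"
    then have lt: "g (n - 1) < M" using alc_less[of g n M "n - 1"] n by simp
    show "?r (?r g) = g" using lt by (rule invol[of g])
    then show "H (?r (?r g)) = H g" by simp
    show "?r g \<in> ?pos ((M + 1) div 2)" by (rule into[OF g])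
  next
    fix g assume g: "g \<in> ?pos ((M + 1) div 2)"
    then have "g (n - 1) < (M + 1) div 2" using n by (simp add: incs_def)
    then have "g (n - 1) < M" by simp
    then show "?r (?r g) = g" by (rule invol[of g])
    show "?r g \<in> ?hi" by (rule to[OF g])
  qed
  also have "\<dots> = (\<Sum>g\<in>?pos ((M + 1) div 2). \<kappa> * H g)"
  proof (rule sum.cong[OF refl])
    fix g assume "g \<in> ?pos ((M + 1) div 2)"
    then have "g (n - 1) < (M + 1) div 2" using n by (simp add: incs_def)
    then have "g (n - 1) < M" by simp
    then show "H (?r g) = \<kappa> * H g" by (rule reflect[of g])
  qed
  finally have hi: "sum H ?hi = \<kappa> * sum H (incs n ((M + 1) div 2))"
    unfolding restrict sum_distrib_left .
  have "sum H (alc n M) = sum H (?lo \<union> ?hi)" by (rule arg_cong[where f = "sum H"]) blast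
  also have "\<dots> = sum H ?lo + sum H ?hi" by (rule sum.union_disjoint) auto
  finally show ?thesis unfolding hi lo restrict[symmetric] .
qed

section \<open>Extremal sets of frequencies\<close>

lemma Max_same_parity:
  assumes "finite S" "card S = Suc n" "\<And>v. v \<in> S \<Longrightarrow> 0 < v \<and> v mod 2 = (e :: nat)"
  shows "2 * n + 1 \<le> Max S"
  using assms
proof (induction n arbitrary: S)
  case 0
  then have "S \<noteq> {}" by auto
  then show ?case using 0 Max_in[OF 0(1)] by fastforce
next
  case (Suc n)
  have ne: "S \<noteq> {}" using Suc.prems by auto
  let ?S = "S - {Max S}"
  have card: "card ?S = Suc n" using Suc.prems Max_in[OF Suc.prems(1) ne] by simp
  then have ne': "?S \<noteq> {}" by (metis card.empty nat.distinct(1))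
  have "2 * n + 1 \<le> Max ?S" using Suc.IH[of ?S] card Suc.prems by simp
  moreover have in': "Max ?S \<in> ?S" using Max_in[OF _ ne'] Suc.prems(1) by simp
  then have "Max ?S < Max S" using Max_ge[OF Suc.prems(1), of "Max ?S"] by auto
  moreover have "Max ?S mod 2 = Max S mod 2"
    using Suc.prems(3) in' Max_in[OF Suc.prems(1) ne] by auto
  ultimately show ?case by presburger
qed

text \<open>Remove the largest element: among \<open>Suc n\<close> positive numbers of equal parity
  it is at least \<open>2 * n + 1\<close>, and anything larger makes the sum strictly smaller. Even
  numbers are covered too; a nonempty set of them never attains the bound.\<close>

lemma sum_strict_antimono_parity:
  fixes c :: "nat \<Rightarrow> real"
  assumes anti: "\<And>a b. a < b \<Longrightarrow> b \<le> M \<Longrightarrow> c b < c a"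
    and "finite S" "card S = n" "\<And>v. v \<in> S \<Longrightarrow> 0 < v \<and> v \<le> M \<and> v mod 2 = e"
  shows "sum c S \<le> (\<Sum>h<n. c (2 * h + 1)) \<and>
    (sum c S = (\<Sum>h<n. c (2 * h + 1)) \<longrightarrow> S = (\<lambda>h. 2 * h + 1) ` {..<n})"
  using assms(2-)
proof (induction n arbitrary: S)
  case 0
  then show ?case by simp
next
  case (Suc n)
  have ne: "S \<noteq> {}" using Suc.prems by auto
  let ?v = "Max S" and ?S = "S - {Max S}"
  have v: "?v \<in> S" using Max_in[OF Suc.prems(1) ne] .
  have sum: "sum c S = c ?v + sum c ?S" by (rule sum.remove[OF Suc.prems(1) v])
  have IH: "sum c ?S \<le> (\<Sum>h<n. c (2 * h + 1)) \<and>
    (sum c ?S = (\<Sum>h<n. c (2 * h + 1)) \<longrightarrow> ?S = (\<lambda>h. 2 * h + 1) ` {..<n})"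
    using Suc.prems v by (intro Suc.IH) auto
  have ge: "2 * n + 1 \<le> ?v" by (rule Max_same_parity[OF Suc.prems(1,2)]) (use Suc.prems(3) in auto)
  have vM: "?v \<le> M" using Suc.prems(3)[OF v] by simp
  show ?case
  proof (cases "?v = 2 * n + 1")
    case True
    have S: "S = insert ?v ?S" using v by auto
    have "S = (\<lambda>h. 2 * h + 1) ` {..<Suc n}" if eq: "?S = (\<lambda>h. 2 * h + 1) ` {..<n}"
    proof -
      have "S = insert ?v ((\<lambda>h. 2 * h + 1) ` {..<n})" using S unfolding eq .
      then show ?thesis unfolding True lessThan_Suc image_insert .
    qed
    moreover have "(\<Sum>h<Suc n. c (2 * h + 1)) = c ?v + (\<Sum>h<n. c (2 * h + 1))" by (simp add: True)
    ultimately show ?thesis using IH unfolding sum by auto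
  next
    case False
    then have "c ?v < c (2 * n + 1)" using ge vM by (intro anti) simp_all
    then show ?thesis using IH sum by auto
  qed
qed

lemma ex_permutation_same_image:
  assumes "inj_on u A" "inj_on w A" "u ` A = w ` A" "\<And>h. h \<notin> A \<Longrightarrow> u h = w h"
  shows "\<exists>p. p permutes A \<and> u = w \<circ> p"
proof -
  define p where "p h = (if h \<in> A then inv_into A w (u h) else h)" for h
  have pA: "p h \<in> A \<and> w (p h) = u h" if "h \<in> A" for h
  proof -
    have "u h \<in> w ` A" using that assms(3) by blast
    then show ?thesis using that by (simp add: p_def inv_into_into f_inv_into_f)
  qed
  have "p permutes A"
  proof (rule bij_imp_permutes)
    show "bij_betw p A A"
      unfolding bij_betw_def
    proof
      show "inj_on p A"
      proof (rule inj_onI)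
        fix h k assume "h \<in> A" "k \<in> A" "p h = p k"
        then have "u h = u k" using pA by metis
        then show "h = k" using assms(1) \<open>h \<in> A\<close> \<open>k \<in> A\<close> by (auto dest: inj_onD)
      qed
      show "p ` A = A"
      proof (intro equalityI subsetI)
        fix a assume a: "a \<in> A"
        then obtain h where h: "h \<in> A" "u h = w a" using assms(3) by (metis imageE imageI)
        then have "w (p h) = w a" using pA by simp
        then have "p h = a" using assms(2) pA h a by (meson inj_onD)
        then show "a \<in> p ` A" using h by blast
      qed (use pA in auto)
    qed
  qed (simp add: p_def)
  moreover have "u = w \<circ> p"
    using pA assms(4) by (auto simp: fun_eq_iff p_def)
  ultimately show ?thesis by blast
qed

text \<open>The value \<open>undefined\<close> outside the index range makes this function, composed
  with any permutation of the indices, extensional as \<open>freqs\<close> requires.\<close>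

definition low_freq :: "nat \<Rightarrow> nat \<Rightarrow> nat" where
  "low_freq n h = (if h < n then 2 * h + 1 else undefined)"

definition high_freq :: "nat \<Rightarrow> nat \<Rightarrow> nat \<Rightarrow> nat" where
  "high_freq n M h = (if h < n then M - (2 * h + 1) else undefined)"

lemma inj_on_low_freq: "inj_on (low_freq n) {0..<n}"
  by (auto simp: inj_on_def low_freq_def)

lemma inj_on_high_freq: "2 * n \<le> M \<Longrightarrow> inj_on (high_freq n M) {0..<n}"
  by (auto simp: inj_on_def high_freq_def)

lemma cos_pi_frac_strict_antimono:
  assumes "a < b" "b \<le> M"
  shows "cos (pi * real b / real M) < cos (pi * real a / real M)"
proof (rule cos_monotone_0_pi)
  have M: "real M > 0" using assms by simp
  show "0 \<le> pi * real a / real M" by simp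
  show "pi * real a / real M < pi * real b / real M"
    using assms M by (intro divide_strict_right_mono mult_strict_left_mono) simp_all
  have "pi * real b \<le> pi * real M" using assms(2) by (intro mult_left_mono) simp_all
  then show "pi * real b / real M \<le> pi" using M by (simp only: divide_le_eq if_True)
qed

lemma cos_pi_frac_reflect:
  assumes "v \<le> M" "M > 0"
  shows "cos (pi * real (M - v) / real M) = - cos (pi * real v / real M)"
proof -
  have "pi * real (M - v) / real M = pi - pi * real v / real M"
    using assms by (simp add: of_nat_diff field_simps)
  then show ?thesis by (simp only: cos_pi_minus)
qed

text \<open>The bound is applied to the frequency set and to its image under \<open>M - v\<close>,
  whose cosine sum has the opposite sign. Together they bound the absolute value, and equality in
  either identifies the set. Injectivity is essential: repeated small frequencies could exceed the
  bound, but their determinants vanish.\<close>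

lemma eigval_dominated:
  assumes u: "u \<in> freqs n M e" and inj: "inj_on u {0..<n}" and M: "M \<ge> 2 * n" "M > 0"
  shows "\<bar>eigval n (angle M u)\<bar> < eigval n (angle M (low_freq n)) \<or>
    (\<exists>p. p permutes {0..<n} \<and> u = low_freq n \<circ> p) \<or> (\<exists>p. p permutes {0..<n} \<and> u = high_freq n M \<circ> p)"
    and "\<bar>eigval n (angle M u)\<bar> \<le> eigval n (angle M (low_freq n))"
proof -
  define c where "c v = cos (pi * real v / real M)" for v
  have anti: "c b < c a" if "a < b" "b \<le> M" for a b
    unfolding c_def by (rule cos_pi_frac_strict_antimono[OF that])
  let ?S = "u ` {0..<n}" and ?R = "\<Sum>h<n. c (2 * h + 1)"
  have uv: "0 < v \<and> v < M \<and> v mod 2 = e" if "v \<in> ?S" for v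
    using u that by (auto simp: freqs_def PiE_iff)
  have undef: "u h = undefined" if "h \<notin> {0..<n}" for h
    using u that by (auto simp: freqs_def PiE_iff extensional_def)
  have card: "card ?S = n" using inj by (simp add: card_image)
  have eig: "eigval n (angle M u) = 2 * sum c ?S"
    unfolding eigval_def angle_def c_def sum.reindex[OF inj] by (simp add: atLeast0LessThan)
  have eig0: "eigval n (angle M (low_freq n)) = 2 * ?R"
    unfolding eigval_def angle_def c_def low_freq_def by simp
  have 1: "sum c ?S \<le> ?R \<and> (sum c ?S = ?R \<longrightarrow> ?S = (\<lambda>h. 2 * h + 1) ` {..<n})"
  proof (rule sum_strict_antimono_parity[where M = M and e = e])
    show "c b < c a" if "a < b" "b \<le> M" for a b by (rule anti[OF that])
    show "0 < v \<and> v \<le> M \<and> v mod 2 = e" if "v \<in> ?S" for v using uv[OF that] by simp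
    show "card ?S = n" by (rule card)
  qed simp
  let ?T = "(\<lambda>v. M - v) ` ?S"
  have injT: "inj_on (\<lambda>v. M - v) ?S"
  proof (rule inj_onI)
    fix a b assume "a \<in> ?S" "b \<in> ?S" and eq: "M - a = M - b"
    then have "a < M" "b < M" using uv[of a] uv[of b] by simp_all
    then show "a = b" using eq by linarith
  qed
  have sumT: "sum c ?T = - sum c ?S"
  proof -
    have "sum c ?T = (\<Sum>v\<in>?S. c (M - v))" unfolding sum.reindex[OF injT] o_def ..
    also have "\<dots> = (\<Sum>v\<in>?S. - c v)"
    proof (rule sum.cong[OF refl])
      fix v assume "v \<in> ?S"
      then have "v \<le> M" using uv[of v] by simp
      then show "c (M - v) = - c v" unfolding c_def by (rule cos_pi_frac_reflect[OF _ M(2)])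
    qed
    also have "\<dots> = - sum c ?S" by (rule sum_negf)
    finally show ?thesis .
  qed
  have vT: "0 < v \<and> v \<le> M \<and> v mod 2 = (M + e) mod 2" if "v \<in> ?T" for v
  proof -
    from that obtain w where w: "w \<in> ?S" and v: "v = M - w" by (rule imageE)
    have "0 < w" "w < M" "w mod 2 = e" using uv[OF w] by simp_all
    have "M + w = (M - w) + 2 * w" using \<open>w < M\<close> by simp
    then have "(M - w) mod 2 = (M + w) mod 2" by (metis mod_mult_self2)
    also have "\<dots> = (M + e) mod 2" unfolding \<open>w mod 2 = e\<close>[symmetric] by (rule mod_add_right_eq[symmetric])
    finally show ?thesis unfolding v using \<open>0 < w\<close> \<open>w < M\<close> by simp
  qed
  have 2: "sum c ?T \<le> ?R \<and> (sum c ?T = ?R \<longrightarrow> ?T = (\<lambda>h. 2 * h + 1) ` {..<n})"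
  proof (rule sum_strict_antimono_parity[where M = M and e = "(M + e) mod 2"])
    show "c b < c a" if "a < b" "b \<le> M" for a b by (rule anti[OF that])
    show "0 < v \<and> v \<le> M \<and> v mod 2 = (M + e) mod 2" if "v \<in> ?T" for v by (rule vT[OF that])
    show "card ?T = n" unfolding card_image[OF injT] by (rule card)
  qed simp
  note le = conjunct1[OF 1] conjunct1[OF 2]
  note eq1 = conjunct2[OF 1, rule_format] and eq2 = conjunct2[OF 2, rule_format]
  show "\<bar>eigval n (angle M u)\<bar> \<le> eigval n (angle M (low_freq n))"
    using le sumT unfolding eig eig0 by linarith
  have "sum c ?S = ?R \<or> sum c ?T = ?R \<or> (sum c ?S < ?R \<and> - sum c ?S < ?R)"
    using le sumT by linarith
  then consider "sum c ?S = ?R" | "sum c ?T = ?R" | "sum c ?S < ?R" "- sum c ?S < ?R"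
    by blast
  then show "\<bar>eigval n (angle M u)\<bar> < eigval n (angle M (low_freq n)) \<or>
    (\<exists>p. p permutes {0..<n} \<and> u = low_freq n \<circ> p) \<or> (\<exists>p. p permutes {0..<n} \<and> u = high_freq n M \<circ> p)"
  proof cases
    case 1
    then have "?S = (\<lambda>h. 2 * h + 1) ` {..<n}" by (rule eq1)
    also have "\<dots> = low_freq n ` {0..<n}" by (intro image_cong) (auto simp: low_freq_def)
    finally have "\<exists>p. p permutes {0..<n} \<and> u = low_freq n \<circ> p"
      by (rule ex_permutation_same_image[OF inj inj_on_low_freq]) (simp add: undef low_freq_def)
    then show ?thesis by blast
  next
    case 2
    then have T: "?T = (\<lambda>h. 2 * h + 1) ` {..<n}" by (rule eq2)
    have "M - (M - v) = v" if "v \<in> ?S" for v using uv[OF that] by simp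
    then have "(\<lambda>v. M - v) ` ?T = (\<lambda>v. v) ` ?S"
      unfolding image_image[of "\<lambda>v. M - v" "\<lambda>v. M - v"] by (rule image_cong[OF refl])
    then have "?S = (\<lambda>v. M - v) ` ?T" by simp
    also have "\<dots> = high_freq n M ` {0..<n}"
      unfolding T unfolding image_image by (intro image_cong) (auto simp: high_freq_def)
    finally have "\<exists>p. p permutes {0..<n} \<and> u = high_freq n M \<circ> p"
      by (rule ex_permutation_same_image[OF inj inj_on_high_freq[OF M(1)]]) (simp add: undef high_freq_def)
    then show ?thesis by blast
  next
    case 3
    then show ?thesis unfolding eig eig0 by linarith
  qed
qed

lemma sine_det_not_inj:
  assumes "\<not> inj_on u {0..<n}"
  shows "sine_det n (angle M u) f = 0"
proof -
  obtain i j where "i < n" "j < n" "i \<noteq> j" "u i = u j" using assms by (auto simp: inj_on_def)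
  then show ?thesis
    unfolding sine_det_def by (intro dt_identical_rows[of i n j]) (simp_all add: angle_def)
qed

text \<open>The eigenvalue is symmetric in the frequencies and the determinant alternating, so the
  orderings of one frequency set contribute the signed sum of their \<open>mass\<close> values,
  which is a determinant summed over the alcove.\<close>

lemma sum_permuted_freqs:
  assumes inj: "inj_on w {0..<n}"
  shows "(\<Sum>u\<in>{w \<circ> p |p. p permutes {0..<n}}. eigval n (angle M u) ^ k * mass n M u * sine_det n (angle M u) f) =
    eigval n (angle M w) ^ k * (sine_det n (angle M w) f * (\<Sum>g\<in>alc n M. sine_det n (angle M w) g))"
proof -
  have ang: "angle M (w \<circ> p) h = angle M w (p h)" for p h by (simp add: angle_def)
  have inj_comp: "inj_on (\<lambda>p. w \<circ> p) {p. p permutes {0..<n}}"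
  proof (rule inj_onI)
    fix p q assume p: "p \<in> {p. p permutes {0..<n}}" and q: "q \<in> {p. p permutes {0..<n}}" and eq: "w \<circ> p = w \<circ> q"
    show "p = q"
    proof
      fix h show "p h = q h"
      proof (cases "h \<in> {0..<n}")
        case True
        then have "p h \<in> {0..<n}" "q h \<in> {0..<n}" using p q by (simp_all only: mem_Collect_eq permutes_in_image)
        moreover have "w (p h) = w (q h)" using fun_cong[OF eq, of h] by simp
        ultimately show ?thesis using inj by (meson inj_onD)
      next
        case False
        then show ?thesis using p q by (simp add: permutes_def)
      qed
    qed
  qed
  have eig: "eigval n (angle M (w \<circ> p)) = eigval n (angle M w)" if "p permutes {0..<n}" for p
    unfolding eigval_def ang using sum.permute[OF that, of "\<lambda>h. cos (angle M w h)"]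
    by (simp add: o_def atLeast0LessThan)
  have det: "sine_det n (angle M (w \<circ> p)) f = signof p * sine_det n (angle M w) f" if "p permutes {0..<n}" for p
    unfolding sine_det_def ang by (rule dt_permute_rows[OF that])
  have mass: "(\<Sum>p | p permutes {0..<n}. signof p * mass n M (w \<circ> p)) = (\<Sum>g\<in>alc n M. sine_det n (angle M w) g)"
  proof -
    have "(\<Sum>p | p permutes {0..<n}. signof p * mass n M (w \<circ> p)) =
        (\<Sum>g\<in>alc n M. \<Sum>p | p permutes {0..<n}. signof p * (\<Prod>h = 0..<n. sin (real (g h) * angle M w (p h))))"
      unfolding mass_def ang sum_distrib_left by (rule sum.swap)
    also have "\<dots> = (\<Sum>g\<in>alc n M. dt n (\<lambda>h t. sin (real (g h) * angle M w t)))"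
      unfolding dt_Leibniz ..
    also have "\<dots> = (\<Sum>g\<in>alc n M. sine_det n (angle M w) g)"
      unfolding sine_det_def by (rule sum.cong[OF refl], rule dt_transpose)
    finally show ?thesis .
  qed
  have "{w \<circ> p |p. p permutes {0..<n}} = (\<lambda>p. w \<circ> p) ` {p. p permutes {0..<n}}" by auto
  note img = this
  have "(\<Sum>u\<in>{w \<circ> p |p. p permutes {0..<n}}. eigval n (angle M u) ^ k * mass n M u * sine_det n (angle M u) f) =
      (\<Sum>p | p permutes {0..<n}. eigval n (angle M (w \<circ> p)) ^ k * mass n M (w \<circ> p) * sine_det n (angle M (w \<circ> p)) f)"
    unfolding img sum.reindex[OF inj_comp] by (rule sum.cong[OF refl]) (simp only: o_apply)
  also have "\<dots> = (\<Sum>p | p permutes {0..<n}. eigval n (angle M w) ^ k * sine_det n (angle M w) f * (signof p * mass n M (w \<circ> p)))"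
    by (rule sum.cong[OF refl]) (simp only: mem_Collect_eq eig det mult_ac)
  also have "\<dots> = eigval n (angle M w) ^ k * (sine_det n (angle M w) f * (\<Sum>g\<in>alc n M. sine_det n (angle M w) g))"
    unfolding sum_distrib_left[symmetric] mass by (simp only: mult.assoc)
  finally show ?thesis .
qed

section \<open>Asymptotics\<close>

text \<open>The alcove inequalities place the argument of every sine in the product strictly between
  0 and pi.\<close>

lemma trig_weight_pos:
  assumes f: "f \<in> alc n M" and \<alpha>: "\<alpha> = pi / real M"
  shows "trig_weight sin n \<alpha> (\<lambda>j. real (f j)) > 0"
proof -
  have M: "real M > 0" using f by (auto simp: alc_def)
  have pos: "sin (\<alpha> * real x) > 0" if "0 < x" "x < M" for x
  proof (rule sin_gt_zero)
    show "0 < \<alpha> * real x" using that(1) M by (simp add: \<alpha>)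
    have "\<alpha> * real x < \<alpha> * real M" using that(2) M by (intro mult_strict_left_mono) (simp_all add: \<alpha>)
    also have "\<dots> = pi" using M by (simp add: \<alpha>)
    finally show "\<alpha> * real x < pi" .
  qed
  have "sin (\<alpha> * real (f j)) > 0" if "j < n" for j
    using that f alc_less[OF f that] by (intro pos) (auto simp: alc_def)
  then have 1: "(\<Prod>j = 0..<n. sin (\<alpha> * real (f j))) > 0" by (intro prod_pos) auto
  have "sin (\<alpha> * (real (f k) - real (f h))) * sin (\<alpha> * (real (f k) + real (f h))) > 0" if hk: "h < k" "k < n" for h k
  proof -
    have lt: "f h < f k" by (rule alc_strict_mono[OF f hk])
    have sum: "f k + f h < M" using hk by (intro alc_pair_sum[OF f]) auto
    have e: "real (f k) - real (f h) = real (f k - f h)" "real (f k) + real (f h) = real (f k + f h)"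
      using lt by (simp_all add: of_nat_diff)
    show ?thesis unfolding e using lt sum by (intro mult_pos_pos pos) auto
  qed
  then have 2: "pair_prod {0..<n} (\<lambda>h k. sin (\<alpha> * (real (f k) - real (f h))) * sin (\<alpha> * (real (f k) + real (f h)))) > 0"
    unfolding pair_prod_def by (intro prod_pos) auto
  show ?thesis unfolding trig_weight_def by (rule mult_pos_pos[OF 1 2])
qed

lemma alc_ge_Suc:
  assumes f: "f \<in> alc n M" and "i < n" shows "Suc i \<le> f i"
  using assms(2)
proof (induction i)
  case 0
  then show ?case using f by (simp add: alc_def Suc_le_eq)
next
  case (Suc i)
  then have "f i < f (Suc i)" using alc_strict_mono[OF f, of i "Suc i"] by simp
  then show ?case using Suc by simp
qed

text \<open>Coordinates are bounded below by those of the point 1, ..., n, whose two largest add up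
  to 2n - 1.\<close>

lemma alc_nonempty_bound:
  assumes f: "f \<in> alc n M" and n: "n > 0" shows "2 * n \<le> M"
proof (cases "n \<ge> 2")
  case True
  have "f (n - 1) + f (n - 2) < M" using True by (intro alc_pair_sum[OF f]) auto
  moreover have "n - 1 < n" "n - 2 < n" using True by auto
  then have "Suc (n - 1) \<le> f (n - 1)" "Suc (n - 2) \<le> f (n - 2)" using alc_ge_Suc[OF f] by blast+
  ultimately show ?thesis using True by linarith
next
  case False
  then have "n = 1" using n by simp
  moreover have "Suc 0 \<le> f 0" "f 0 < M" using alc_ge_Suc[OF f n] alc_less[OF f n] by auto
  ultimately show ?thesis by simp
qed

section \<open>Values at the two dominant frequency sets\<close>

lemma angle_low_freq: "h < n \<Longrightarrow> angle M (low_freq n) h = (2 * real h + 1) * (pi / real M)"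
  by (simp add: angle_def low_freq_def)

lemma angle_high_freq:
  assumes "h < n" "2 * n \<le> M"
  shows "angle M (high_freq n M) h = pi - (2 * real h + 1) * (pi / real M)"
proof -
  have M: "real M \<noteq> 0" using assms by simp
  have "real (M - (2 * h + 1)) = real M - (2 * real h + 1)" using assms by (simp add: of_nat_diff)
  then have "angle M (high_freq n M) h = pi * (real M - (2 * real h + 1)) / real M"
    using assms(1) by (simp only: angle_def high_freq_def if_True)
  also have "\<dots> = pi - (2 * real h + 1) * (pi / real M)" using M by (simp add: field_simps)
  finally show ?thesis .
qed

lemma sine_det_low_freq:
  "sine_det n (angle M (low_freq n)) f = lead_const n * trig_weight sin n (pi / real M) (\<lambda>j. real (f j))"
  unfolding sine_det_def dt_sin_odd_multiples[symmetric] by (rule dt_cong) (simp only: angle_low_freq)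

lemma sine_det_high_freq:
  assumes "2 * n \<le> M"
  shows "sine_det n (angle M (high_freq n M)) f =
    (-1) ^ (\<Sum>j = 0..<n. Suc (f j)) * (lead_const n * trig_weight sin n (pi / real M) (\<lambda>j. real (f j)))"
  unfolding sine_det_def dt_sin_pi_minus[symmetric] by (rule dt_cong) (simp only: angle_high_freq[OF _ assms])

lemma eigval_low_freq:
  assumes "2 * n \<le> M" "n > 0"
  shows "eigval n (angle M (low_freq n)) = sin (2 * real n * (pi / real M)) / sin (pi / real M)"
proof -
  define a where "a = pi / real M"
  have M: "real M > 1" using assms by linarith
  have s: "sin a > 0"
  proof (rule sin_gt_zero)
    show "0 < a" using M by (simp add: a_def)
    have "pi / real M < pi / 1" using M by (intro divide_strict_left_mono) simp_all
    then show "a < pi" by (simp add: a_def)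
  qed
  have "2 * (\<Sum>h<k. cos ((2 * real h + 1) * a)) * sin a = sin (2 * real k * a)" for k
  proof (induction k)
    case (Suc k)
    have e1: "(2 * real k + 1) * a + a = 2 * real (Suc k) * a" by (simp add: algebra_simps)
    have e2: "(2 * real k + 1) * a - a = 2 * real k * a" by (simp add: algebra_simps)
    have "2 * cos b * sin a = sin (b + a) - sin (b - a)" for b unfolding sin_add sin_diff by simp
    from this[of "(2 * real k + 1) * a"]
    have "2 * cos ((2 * real k + 1) * a) * sin a = sin (2 * real (Suc k) * a) - sin (2 * real k * a)"
      unfolding e1 e2 .
    then show ?case using Suc by (simp only: sum.lessThan_Suc ring_distribs)
  qed simp
  then have "2 * (\<Sum>h<n. cos ((2 * real h + 1) * a)) = sin (2 * real n * a) / sin a"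
    using s by (simp only: eq_divide_eq) simp
  moreover have "eigval n (angle M (low_freq n)) = 2 * (\<Sum>h<n. cos ((2 * real h + 1) * a))"
    unfolding eigval_def a_def by (intro arg_cong2[where f = "(*)"] sum.cong refl) (simp only: lessThan_iff angle_low_freq)
  ultimately show ?thesis by (simp only: a_def)
qed

lemma eigval_high_freq:
  assumes "2 * n \<le> M"
  shows "eigval n (angle M (high_freq n M)) = - eigval n (angle M (low_freq n))"
proof -
  have "(\<Sum>h<n. cos (angle M (high_freq n M) h)) = (\<Sum>h<n. - cos (angle M (low_freq n) h))"
    by (rule sum.cong[OF refl]) (simp only: lessThan_iff angle_high_freq[OF _ assms] angle_low_freq cos_pi_minus)
  then show ?thesis unfolding eigval_def sum_negf by (simp only: mult_minus_right)
qed

lemma permuted_low_freq_in_freqs: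
  assumes "2 * n \<le> M" "p permutes {0..<n}"
  shows "low_freq n \<circ> p \<in> freqs n M 1"
proof -
  have *: "p h < n \<longleftrightarrow> h < n" for h using permutes_in_image[OF assms(2), of h] by simp
  have "low_freq n (p h) \<in> {u \<in> {1..<M}. u mod 2 = 1}" if "h < n" for h
  proof -
    have lt: "p h < n" using * that by simp
    then have "low_freq n (p h) = 2 * p h + 1" "2 * p h + 1 < M" using assms(1) by (simp_all add: low_freq_def)
    then show ?thesis by simp
  qed
  moreover have "low_freq n (p h) = undefined" if "\<not> h < n" for h using * that by (simp add: low_freq_def)
  ultimately show ?thesis unfolding freqs_def PiE_iff extensional_def by simp
qed

text \<open>Subtracting an odd number from \<open>M\<close> gives the parity of
  \<open>M + 1\<close>. So both dominant sets lie in the odd class if \<open>M\<close> is even, and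
  in different classes if \<open>M\<close> is odd.\<close>

lemma permuted_high_freq_in_freqs:
  assumes "2 * n \<le> M" "p permutes {0..<n}"
  shows "high_freq n M \<circ> p \<in> freqs n M ((M + 1) mod 2)"
proof -
  have *: "p h < n \<longleftrightarrow> h < n" for h using permutes_in_image[OF assms(2), of h] by simp
  have "high_freq n M (p h) \<in> {u \<in> {1..<M}. u mod 2 = (M + 1) mod 2}" if "h < n" for h
  proof -
    have lt: "p h < n" using * that by simp
    define x where "x = p h"
    have "x < n" "high_freq n M (p h) = M - (2 * x + 1)" using lt by (simp_all add: x_def high_freq_def)
    moreover have "1 \<le> M - (2 * x + 1)" "M - (2 * x + 1) < M" using \<open>x < n\<close> assms(1) by simp_all
    moreover have "(M - (2 * x + 1)) mod 2 = (M + 1) mod 2"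
    proof -
      have "M + 1 = (M - (2 * x + 1)) + 2 * (x + 1)" using \<open>x < n\<close> assms(1) by simp
      then show ?thesis by (metis mod_mult_self2)
    qed
    ultimately show ?thesis by simp
  qed
  moreover have "high_freq n M (p h) = undefined" if "\<not> h < n" for h using * that by (simp add: high_freq_def)
  ultimately show ?thesis unfolding freqs_def PiE_iff extensional_def by simp
qed

lemma finite_freqs [simp]: "finite (freqs n M e)"
  unfolding freqs_def by (intro finite_PiE) auto

text \<open>\<open>2 * n < M\<close> separates the two dominant sets. \<open>Q\<close> holds all
  other frequencies: either the eigenvalue is strictly smaller in absolute value, or an entry is
  repeated and the determinant is zero.\<close>

theorem card_walks_within_alcove_split:
  assumes n: "n > 0" and M: "real M = 2 * m" "2 * n < M" and f: "f \<in> alc n M"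
  obtains Q :: "(nat \<Rightarrow> nat) set" where "finite Q"
    "\<And>u. u \<in> Q \<Longrightarrow> \<bar>eigval n (angle M u)\<bar> < eigval n (angle M (low_freq n)) \<or> sine_det n (angle M u) f = 0"
    "\<And>k. real (card (walks_within n (alcove_B n m) (alcove_point n f) k)) = (4 / real M) ^ n / 2 *
      (eigval n (angle M (low_freq n)) ^ k * (sine_det n (angle M (low_freq n)) f * (\<Sum>g\<in>alc n M. sine_det n (angle M (low_freq n)) g)) +
       eigval n (angle M (high_freq n M)) ^ k * (sine_det n (angle M (high_freq n M)) f * (\<Sum>g\<in>alc n M. sine_det n (angle M (high_freq n M)) g)) +
       (\<Sum>u\<in>Q. eigval n (angle M u) ^ k * mass n M u * sine_det n (angle M u) f))"
proof -
  let ?T = "freqs n M 0 \<union> freqs n M 1"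
  let ?QL = "{low_freq n \<circ> p |p. p permutes {0..<n}}" and ?QH = "{high_freq n M \<circ> p |p. p permutes {0..<n}}"
  let ?QR = "?T - (?QL \<union> ?QH)"
  let ?a = "\<lambda>k u. eigval n (angle M u) ^ k * mass n M u * sine_det n (angle M u) f"
  have M2: "2 * n \<le> M" using M(2) by simp
  have disjT: "freqs n M 0 \<inter> freqs n M 1 = {}"
  proof -
    have parity: "u 0 mod 2 = e" if "u \<in> freqs n M e" for u e
      using that n by (simp add: freqs_def PiE_iff)
    show ?thesis
    proof (rule equals0I)
      fix u assume "u \<in> freqs n M 0 \<inter> freqs n M 1"
      then have "u 0 mod 2 = 0" "u 0 mod 2 = 1" using parity[of u 0] parity[of u 1] by simp_all
      then show False by simp
    qed
  qed
  have sub0: "?QL \<subseteq> ?T" using permuted_low_freq_in_freqs[OF M2] by blast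
  have sub1: "?QH \<subseteq> ?T"
  proof
    fix u assume "u \<in> ?QH"
    then have "u \<in> freqs n M ((M + 1) mod 2)" using permuted_high_freq_in_freqs[OF M2] by blast
    moreover have "(M + 1) mod 2 = 0 \<or> (M + 1) mod 2 = 1" by presburger
    ultimately show "u \<in> ?T" by auto
  qed
  \<comment> \<open>The entry \<open>M - 1\<close> of the reflected set would have to equal a low
    frequency, and these are at most \<open>2 * n - 1\<close>.\<close>
  have disjQ: "?QL \<inter> ?QH = {}"
  proof (rule ccontr)
    assume "?QL \<inter> ?QH \<noteq> {}"
    then obtain p q where p: "p permutes {0..<n}" and q: "q permutes {0..<n}" and eq: "low_freq n \<circ> p = high_freq n M \<circ> q"
      by blast
    define h where "h = inv_into UNIV q 0"
    have "q h = 0" unfolding h_def using permutes_inverses(1)[OF q] .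
    then have hn: "h < n" using permutes_in_image[OF q, of h] n by simp
    then have "p h < n" using permutes_in_image[OF p, of h] by simp
    moreover have "low_freq n (p h) = high_freq n M (q h)" using fun_cong[OF eq, of h] by simp
    ultimately have "2 * p h + 1 = M - 1" using \<open>q h = 0\<close> n by (simp add: low_freq_def high_freq_def)
    then show False using M(2) \<open>p h < n\<close> by linarith
  qed
  have finQ: "finite ?QL" "finite ?QH" by (rule finite_subset[OF sub0], simp, rule finite_subset[OF sub1], simp)
  show thesis
  proof (rule that[of ?QR])
    show "finite ?QR" by simp
    show "\<bar>eigval n (angle M u)\<bar> < eigval n (angle M (low_freq n)) \<or> sine_det n (angle M u) f = 0" if u: "u \<in> ?QR" for u
    proof (cases "inj_on u {0..<n}")
      case True
      obtain e where "u \<in> freqs n M e" using u by blast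
      from eigval_dominated(1)[OF this True M2] M(2) u show ?thesis by blast
    next
      case False
      then show ?thesis using sine_det_not_inj by blast
    qed
    fix k
    have union_split: "sum F (freqs n M 0) + sum F (freqs n M 1) = sum F ?QL + sum F ?QH + sum F ?QR"
      for F :: "(nat \<Rightarrow> nat) \<Rightarrow> real"
    proof -
      have fin: "finite ?T" by simp
      have "sum F ?T = sum F (freqs n M 0) + sum F (freqs n M 1)"
        by (rule sum.union_disjoint[OF finite_freqs finite_freqs disjT])
      moreover have "sum F ?T = sum F ?QR + sum F (?QL \<union> ?QH)"
        by (rule sum.subset_diff[OF Un_least[OF sub0 sub1] fin])
      moreover have "sum F (?QL \<union> ?QH) = sum F ?QL + sum F ?QH"
        by (rule sum.union_disjoint[OF finQ disjQ])
      ultimately show ?thesis by linarith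
    qed
    have two: "(\<Sum>e<2. F e) = F 0 + F 1" for F :: "nat \<Rightarrow> real"
      by (simp add: numeral_2_eq_2)
    have "(\<Sum>e<2. sum (?a k) (freqs n M e)) = sum (?a k) ?QL + sum (?a k) ?QH + sum (?a k) ?QR"
      unfolding two by (rule union_split)
    moreover have "1 \<le> n" using n by simp
    ultimately show "real (card (walks_within n (alcove_B n m) (alcove_point n f) k)) = (4 / real M) ^ n / 2 *
      (eigval n (angle M (low_freq n)) ^ k * (sine_det n (angle M (low_freq n)) f * (\<Sum>g\<in>alc n M. sine_det n (angle M (low_freq n)) g)) +
       eigval n (angle M (high_freq n M)) ^ k * (sine_det n (angle M (high_freq n M)) f * (\<Sum>g\<in>alc n M. sine_det n (angle M (high_freq n M)) g)) +
       sum (?a k) ?QR)"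
      by (simp only: card_walks_within_alcove[OF \<open>1 \<le> n\<close> M(1) f] sum_permuted_freqs[OF inj_on_low_freq] sum_permuted_freqs[OF inj_on_high_freq[OF M2]])
  qed
qed

text \<open>Origin of the constant 4^(n^2): \<open>4 ^ n\<close> comes from the completeness
  constant, the rest from the leading coefficients of two determinants, one at the start point and
  one summed over end points.\<close>

lemma lead_const_squared: "4 ^ n * (lead_const n * lead_const n) = 4 ^ (n\<^sup>2)"
proof (induction n)
  case (Suc n)
  have "(-4 :: real) ^ n * (-4) ^ n = 4 ^ (2 * n)" by (simp flip: power_mult_distrib add: power_mult)
  moreover have "lead_const (Suc n) = lead_const n * (-4) ^ n" by (simp add: lead_const_def)
  moreover have "4 ^ ((Suc n)\<^sup>2) = (4 :: real) ^ (n\<^sup>2) * (4 ^ (2 * n) * 4)"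
    by (simp add: power2_eq_square flip: power_add power_Suc2)
  ultimately show ?case using Suc by (simp add: mult_ac)
qed (simp add: lead_const_def)

section \<open>From the spectral sum to the asymptotics\<close>

lemma power_in_smallo:
  fixes r \<rho> :: real
  assumes "\<bar>r\<bar> < \<rho>"
  shows "(\<lambda>k. r ^ k * c) \<in> o(\<lambda>k. \<rho> ^ k)"
proof (rule smalloI_tendsto)
  have \<rho>: "\<rho> > 0" using assms by linarith
  then have "norm (r / \<rho>) < 1" using assms by (simp add: abs_divide)
  then have "(\<lambda>k. (r / \<rho>) ^ k * c) \<longlonglongrightarrow> 0 * c"
    by (intro tendsto_mult LIMSEQ_power_zero tendsto_const)
  moreover have "r ^ k * c / \<rho> ^ k = (r / \<rho>) ^ k * c" for k by (simp add: power_divide)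
  ultimately show "(\<lambda>k. r ^ k * c / \<rho> ^ k) \<longlonglongrightarrow> 0" by simp
  show "\<forall>\<^sub>F k in sequentially. \<rho> ^ k \<noteq> 0" using \<rho> by simp
qed

text \<open>The oscillating factor takes only the values \<open>a + b\<close> and
  \<open>a - b\<close>. Their positivity bounds the leading term below by a constant times
  \<open>\<rho> ^ k\<close>, so it absorbs the remaining terms.\<close>

lemma asymp_equiv_two_periodic:
  fixes \<rho> :: real
  assumes \<rho>: "\<rho> > 0" and Q: "finite Q" "\<And>u. u \<in> Q \<Longrightarrow> \<bar>r u\<bar> < \<rho> \<or> c u = 0"
    and ab: "a + b > 0" "a - b > 0"
  shows "(\<lambda>k. \<rho> ^ k * (a + (-1) ^ (k + s) * b) + (\<Sum>u\<in>Q. r u ^ k * c u)) \<sim>[sequentially]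
    (\<lambda>k. \<rho> ^ k * (a + (-1) ^ (k + s) * b))"
proof -
  let ?X = "\<lambda>k. \<rho> ^ k * (a + (-1) ^ (k + s) * b)"
  define d where "d = min (a + b) (a - b)"
  have d: "d > 0" using ab by (simp add: d_def)
  have lower: "d \<le> a + (-1) ^ (k + s) * b" for k
    by (cases "even (k + s)") (simp_all add: d_def del: even_add)
  have "(\<lambda>k. \<Sum>u\<in>Q. r u ^ k * c u) \<in> o(\<lambda>k. \<rho> ^ k)"
  proof (rule big_sum_in_smallo)
    fix u assume "u \<in> Q"
    then consider "\<bar>r u\<bar> < \<rho>" | "c u = 0" using Q(2) by blast
    then show "(\<lambda>k. r u ^ k * c u) \<in> o(\<lambda>k. \<rho> ^ k)"
    proof cases
      case 1
      then show ?thesis by (rule power_in_smallo)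
    qed simp
  qed
  also have "(\<lambda>k. \<rho> ^ k) \<in> O(?X)"
  proof (rule bigoI[of _ "1 / d"], rule always_eventually, rule allI)
    fix k
    have "\<rho> ^ k * d \<le> ?X k" using lower[of k] \<rho> by (intro mult_left_mono) simp_all
    moreover have "0 < \<rho> ^ k * d" using \<rho> d by simp
    ultimately have "\<rho> ^ k * d \<le> norm (?X k)" by simp
    then show "norm (\<rho> ^ k) \<le> 1 / d * norm (?X k)" using d \<rho> by (simp add: field_simps)
  qed
  finally have "(\<lambda>k. (?X k + (\<Sum>u\<in>Q. r u ^ k * c u)) - ?X k) \<in> o(?X)" by simp
  then show ?thesis by (rule smallo_imp_asymp_equiv)
qed

lemma alc_both_parities:
  assumes n: "n > 0" and M: "2 * n < M"
  obtains g1 g2 where "g1 \<in> alc n M" "g2 \<in> alc n M" "(\<Sum>j = 0..<n. g2 j) = Suc (\<Sum>j = 0..<n. g1 j)"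
proof -
  \<comment> \<open>The smallest point 1, ..., n, and the same point with its top coordinate raised
    by one. The outer inequality of the second point is exactly \<open>2 * n < M\<close>.\<close>
  define g1 where "g1 i = (if i < n then i + 1 else 0)" for i
  define g2 where "g2 = g1(n - 1 := n + 1)"
  have top: "g1 (n - 1) = n" using n by (simp add: g1_def)
  have second: "(if n \<ge> 2 then g1 (n - 2) else 0) = n - 1" using n by (auto simp: g1_def)
  have 1: "g1 \<in> alc n M"
  proof (rule alcI)
    show "g1 (n - 1) + (if n \<ge> 2 then g1 (n - 2) else 0) < M" unfolding top second using M by simp
  qed (simp_all add: g1_def)
  have g2_top: "g2 (n - 1) = n + 1" and g2_other: "i \<noteq> n - 1 \<Longrightarrow> g2 i = g1 i" for i
    by (simp_all add: g2_def)
  have g2_second: "(if n \<ge> 2 then g2 (n - 2) else 0) = n - 1"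
    using second g2_other[of "n - 2"] by (cases "n \<ge> 2") auto
  have 2: "g2 \<in> alc n M"
  proof (rule alcI)
    show "g2 (n - 1) + (if n \<ge> 2 then g2 (n - 2) else 0) < M" unfolding g2_top g2_second using M n by simp
    show "g2 i = 0" if "i \<ge> n" for i
    proof -
      have "i \<noteq> n - 1" using that n by simp
      from g2_other[OF this] show ?thesis using that by (simp add: g1_def)
    qed
    show "0 < g2 i" if "i < n" for i
      using that g2_top g2_other[of i] by (cases "i = n - 1") (simp_all add: g1_def)
    show "g2 i < g2 (Suc i)" if "Suc i < n" for i
    proof -
      have "i \<noteq> n - 1" using that by simp
      then have "g2 i = i + 1" using g2_other[of i] that by (simp add: g1_def)
      moreover have "g2 (Suc i) > i + 1"
        using that g2_top g2_other[of "Suc i"] by (cases "Suc i = n - 1") (simp_all add: g1_def)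
      ultimately show ?thesis by simp
    qed
  qed
  have rem: "(\<Sum>j = 0..<n. g j) = g (n - 1) + (\<Sum>j\<in>{0..<n} - {n - 1}. g j)" for g :: "nat \<Rightarrow> nat"
    using n by (intro sum.remove) simp_all
  have "(\<Sum>j\<in>{0..<n} - {n - 1}. g2 j) = (\<Sum>j\<in>{0..<n} - {n - 1}. g1 j)"
    by (rule sum.cong[OF refl]) (simp add: g2_other)
  then have "(\<Sum>j = 0..<n. g2 j) = Suc (\<Sum>j = 0..<n. g1 j)"
    unfolding rem[of g1] rem[of g2] top g2_top by simp
  then show thesis using that 1 2 by blast
qed

text \<open>Sum and difference are twice the total weight of the points with even and with odd
  coordinate sum; weights are positive and both kinds of points exist.\<close>

lemma signed_weight_sum_pos:
  assumes n: "n > 0" and M: "2 * n < M" and \<alpha>: "\<alpha> = pi / real M"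
  defines "W \<equiv> \<lambda>g. trig_weight sin n \<alpha> (\<lambda>j. real (g j))"
  shows "(\<Sum>g\<in>alc n M. W g) + (\<Sum>g\<in>alc n M. (-1) ^ (\<Sum>j = 0..<n. g j) * W g) > 0"
    and "(\<Sum>g\<in>alc n M. W g) - (\<Sum>g\<in>alc n M. (-1) ^ (\<Sum>j = 0..<n. g j) * W g) > 0"
proof -
  have pos: "W g > 0" if "g \<in> alc n M" for g unfolding W_def by (rule trig_weight_pos[OF that \<alpha>])
  let ?s = "\<lambda>g. (-1 :: real) ^ (\<Sum>j = 0..<n. g j)"
  have s: "?s g = 1 \<or> ?s g = -1" for g :: "nat \<Rightarrow> nat" by (cases "even (\<Sum>j = 0..<n. g j)") simp_all
  obtain g1 g2 where g: "g1 \<in> alc n M" "g2 \<in> alc n M" "(\<Sum>j = 0..<n. g2 j) = Suc (\<Sum>j = 0..<n. g1 j)"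
    using alc_both_parities[OF n M] by blast
  have opp: "?s g2 = - ?s g1" unfolding g(3) by simp
  have plus: "\<exists>g\<in>alc n M. ?s g = 1" and minus: "\<exists>g\<in>alc n M. ?s g = -1"
    using g(1,2) opp s[of g1] by force+
  have "(\<Sum>g\<in>alc n M. W g + ?s g * W g) > 0"
  proof -
    from plus obtain g where g: "g \<in> alc n M" "?s g = 1" by blast
    show ?thesis
    proof (rule sum_pos2[OF finite_alc g(1)])
      show "0 < W g + ?s g * W g" using pos[OF g(1)] g(2) by simp
      show "0 \<le> W h + ?s h * W h" if "h \<in> alc n M" for h using pos[OF that] s[of h] by auto
    qed
  qed
  then show "(\<Sum>g\<in>alc n M. W g) + (\<Sum>g\<in>alc n M. ?s g * W g) > 0" by (simp only: sum.distrib)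
  have "(\<Sum>g\<in>alc n M. W g - ?s g * W g) > 0"
  proof -
    from minus obtain g where g: "g \<in> alc n M" "?s g = -1" by blast
    show ?thesis
    proof (rule sum_pos2[OF finite_alc g(1)])
      show "0 < W g - ?s g * W g" using pos[OF g(1)] g(2) by simp
      show "0 \<le> W h - ?s h * W h" if "h \<in> alc n M" for h using pos[OF that] s[of h] by auto
    qed
  qed
  then show "(\<Sum>g\<in>alc n M. W g) - (\<Sum>g\<in>alc n M. ?s g * W g) > 0" by (simp only: sum_subtractf)
qed

text \<open>The reflected frequencies have the opposite eigenvalue, which gives the sign in
  \<open>k\<close>; their determinants differ from the low ones by signs only, which give the parity
  of the start point and the signed sum over the alcove.\<close>

theorem card_walks_asymp:
  assumes n: "n > 0" and M: "real M = 2 * m" "2 * n < M" and f: "f \<in> alc n M" and \<alpha>: "\<alpha> = pi / real M"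
  defines "W \<equiv> \<lambda>g. trig_weight sin n \<alpha> (\<lambda>j. real (g j))"
  shows "(\<lambda>k. real (card (walks_within n (alcove_B n m) (alcove_point n f) k))) \<sim>[sequentially]
    (\<lambda>k. 4 ^ (n\<^sup>2) / (2 * (2 * m) ^ n) * (eigval n (angle M (low_freq n)) ^ k * W f) *
      ((\<Sum>g\<in>alc n M. W g) + (-1) ^ (k + (\<Sum>j = 0..<n. f j)) * (\<Sum>g\<in>alc n M. (-1) ^ (\<Sum>j = 0..<n. g j) * W g)))"
proof -
  let ?\<rho> = "eigval n (angle M (low_freq n))" and ?L = "lead_const n"
  let ?C = "(4 / real M) ^ n / 2"
  let ?P = "\<Sum>g\<in>alc n M. W g" and ?S = "\<Sum>g\<in>alc n M. (-1) ^ (\<Sum>j = 0..<n. g j) * W g"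
  let ?F = "\<Sum>j = 0..<n. f j"
  have M2: "2 * n \<le> M" using M(2) by simp
  have Mp: "real M > 0" using M(2) by simp
  have Wf: "W f > 0" unfolding W_def by (rule trig_weight_pos[OF f \<alpha>])
  have \<rho>: "?\<rho> > 0"
  proof -
    have "0 < 2 * real n * (pi / real M)" using n Mp by simp
    moreover have "2 * real n * (pi / real M) < pi"
    proof -
      have "real (2 * n) * (pi / real M) < real M * (pi / real M)"
        using M(2) Mp by (intro mult_strict_right_mono) simp_all
      then show ?thesis using Mp by simp
    qed
    ultimately have 1: "sin (2 * real n * (pi / real M)) > 0" by (rule sin_gt_zero)
    have "pi / real M < pi / 1" using M(2) n Mp by (intro divide_strict_left_mono) simp_all
    then have 2: "sin (pi / real M) > 0" using Mp by (intro sin_gt_zero) simp_all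
    show ?thesis unfolding eigval_low_freq[OF M2 n] by (rule divide_pos_pos[OF 1 2])
  qed
  obtain Q where Q: "finite Q" "\<And>u. u \<in> Q \<Longrightarrow> \<bar>eigval n (angle M u)\<bar> < ?\<rho> \<or> sine_det n (angle M u) f = 0"
    and card: "\<And>k. real (card (walks_within n (alcove_B n m) (alcove_point n f) k)) = ?C *
      (?\<rho> ^ k * (sine_det n (angle M (low_freq n)) f * (\<Sum>g\<in>alc n M. sine_det n (angle M (low_freq n)) g)) +
       eigval n (angle M (high_freq n M)) ^ k * (sine_det n (angle M (high_freq n M)) f * (\<Sum>g\<in>alc n M. sine_det n (angle M (high_freq n M)) g)) +
       (\<Sum>u\<in>Q. eigval n (angle M u) ^ k * mass n M u * sine_det n (angle M u) f))"
    by (rule card_walks_within_alcove_split[OF n M f], rule that, assumption, blast, blast)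
  define K where "K = ?C * (?L * ?L) * W f"
  have L: "?L * ?L > 0"
    using lead_const_nonzero[of n] unfolding power2_eq_square[symmetric] zero_less_power2 .
  have C: "?C > 0" using Mp by simp
  have K: "K > 0" unfolding K_def by (rule mult_pos_pos[OF mult_pos_pos[OF C L] Wf])
  have low: "sine_det n (angle M (low_freq n)) g = ?L * W g" for g
    unfolding sine_det_low_freq W_def \<alpha> ..
  have high: "sine_det n (angle M (high_freq n M)) g = (-1) ^ n * ((-1) ^ (\<Sum>j = 0..<n. g j) * (?L * W g))" for g
  proof -
    have "(\<Sum>j = 0..<n. Suc (g j)) = n + (\<Sum>j = 0..<n. g j)" by (induction n) simp_all
    then show ?thesis unfolding sine_det_high_freq[OF M2] W_def \<alpha> by (simp only: power_add mult.assoc)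
  qed
  have sum_low: "(\<Sum>g\<in>alc n M. sine_det n (angle M (low_freq n)) g) = ?L * ?P"
    unfolding low sum_distrib_left ..
  have sum_high: "(\<Sum>g\<in>alc n M. sine_det n (angle M (high_freq n M)) g) = (-1) ^ n * (?L * ?S)"
    unfolding high sum_distrib_left by (simp only: mult.left_commute)
  have expand: "real (card (walks_within n (alcove_B n m) (alcove_point n f) k)) =
     ?\<rho> ^ k * (K * ?P + (-1) ^ (k + ?F) * (K * ?S)) +
     (\<Sum>u\<in>Q. eigval n (angle M u) ^ k * (?C * mass n M u * sine_det n (angle M u) f))" for k
  proof -
    have "?C * (?\<rho> ^ k * (?L * W f * (?L * ?P))) = ?\<rho> ^ k * (K * ?P)"
      unfolding K_def by (simp only: mult_ac)
    moreover have "?C * ((- ?\<rho>) ^ k * ((-1) ^ n * ((-1) ^ ?F * (?L * W f)) * ((-1) ^ n * (?L * ?S)))) =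
        ?\<rho> ^ k * ((-1) ^ (k + ?F) * (K * ?S))"
    proof -
      have m: "(- ?\<rho>) ^ k = (-1) ^ k * ?\<rho> ^ k" by (rule power_minus)
      \<comment> \<open>The sign \<open>(-1) ^ n\<close> of the reflected determinants enters once
        from the start point and once from the sum over end points.\<close>
      have one: "(-1 :: real) ^ n * (-1) ^ n = 1" by (simp flip: power_mult_distrib)
      have "?C * ((- ?\<rho>) ^ k * ((-1) ^ n * ((-1) ^ ?F * (?L * W f)) * ((-1) ^ n * (?L * ?S)))) =
          ((-1) ^ n * (-1) ^ n) * (?\<rho> ^ k * (((-1) ^ k * (-1) ^ ?F) * (K * ?S)))"
        unfolding m K_def by (simp only: mult_ac)
      then show ?thesis unfolding one power_add by (simp only: mult_1_left)
    qed
    moreover have "?C * (\<Sum>u\<in>Q. eigval n (angle M u) ^ k * mass n M u * sine_det n (angle M u) f) =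
        (\<Sum>u\<in>Q. eigval n (angle M u) ^ k * (?C * mass n M u * sine_det n (angle M u) f))"
      unfolding sum_distrib_left by (rule sum.cong[OF refl]) (simp only: mult_ac)
    ultimately show ?thesis
      unfolding card low high sum_low[unfolded low] sum_high[unfolded high] eigval_high_freq[OF M2] by (simp only: distrib_left)
  qed
  have "(\<lambda>k. real (card (walks_within n (alcove_B n m) (alcove_point n f) k))) \<sim>[sequentially]
     (\<lambda>k. ?\<rho> ^ k * (K * ?P + (-1) ^ (k + ?F) * (K * ?S)))"
    unfolding expand
  proof (rule asymp_equiv_two_periodic[OF \<rho> Q(1)])
    show "\<bar>eigval n (angle M u)\<bar> < ?\<rho> \<or> ?C * mass n M u * sine_det n (angle M u) f = 0" if "u \<in> Q" for u
      using Q(2)[OF that] by auto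
    have "K * (?P + ?S) > 0"
      unfolding W_def by (rule mult_pos_pos[OF K signed_weight_sum_pos(1)[OF n M(2) \<alpha>]])
    then show "K * ?P + K * ?S > 0" by (simp only: distrib_left)
    have "K * (?P - ?S) > 0"
      unfolding W_def by (rule mult_pos_pos[OF K signed_weight_sum_pos(2)[OF n M(2) \<alpha>]])
    then show "K * ?P - K * ?S > 0" by (simp only: right_diff_distrib)
  qed
  also have "(\<lambda>k. ?\<rho> ^ k * (K * ?P + (-1) ^ (k + ?F) * (K * ?S))) =
    (\<lambda>k. 4 ^ (n\<^sup>2) / (2 * (2 * m) ^ n) * (?\<rho> ^ k * W f) * (?P + (-1) ^ (k + ?F) * ?S))"
  proof
    fix k
    have "K = 4 ^ (n\<^sup>2) / (2 * (2 * m) ^ n) * W f"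
      unfolding K_def lead_const_squared[symmetric] M(1) power_divide
      by (simp only: times_divide_eq_left times_divide_eq_right divide_divide_eq_left mult_ac)
    then show "?\<rho> ^ k * (K * ?P + (-1) ^ (k + ?F) * (K * ?S)) =
      4 ^ (n\<^sup>2) / (2 * (2 * m) ^ n) * (?\<rho> ^ k * W f) * (?P + (-1) ^ (k + ?F) * ?S)"
      by (simp only: distrib_left mult_ac)
  qed
  finally show ?thesis .
qed

section \<open>The start vector and the factor \<open>R_term\<close>\<close>

lemma prod_pairs_eq_pair_prod:
  "(\<Prod>h\<in>{1..n}. \<Prod>t\<in>{h<..n}. G h t) = pair_prod {0..<n} (\<lambda>h k. G (Suc h) (Suc k))"
proof -
  have "(\<Prod>h\<in>{1..n}. \<Prod>t\<in>{h<..n}. G h t) = (\<Prod>h\<in>{1..n}. \<Prod>t | t \<in> {1..n} \<and> h < t. G h t)"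
    by (intro prod.cong refl) auto
  also have "\<dots> = (\<Prod>t\<in>{1..n}. \<Prod>h | h \<in> {1..n} \<and> h < t. G h t)"
    by (rule prod.swap_restrict) simp_all
  also have "\<dots> = pair_prod (Suc ` {0..<n}) G"
    unfolding pair_prod_def by (simp add: image_Suc_atLeastLessThan atLeastLessThanSuc_atLeastAtMost)
  also have "\<dots> = pair_prod {0..<n} (\<lambda>h k. G (Suc h) (Suc k))"
    by (rule pair_prod_reindex) (simp add: strict_mono_on_def)
  finally show ?thesis .
qed

text \<open>Mediates between the decreasing coordinates of the statement and the increasing ones of
  \<open>alc\<close>; reversal also swaps the members of each pair.\<close>

lemma pair_prod_reverse:
  "pair_prod {0..<n} (\<lambda>h k. F (n - Suc k) (n - Suc h)) = pair_prod {0..<n} F"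
proof -
  have "pair_prod {0..<n} (\<lambda>h k. F (n - Suc k) (n - Suc h)) =
      (\<Prod>a\<in>{0..<n}. \<Prod>b | b \<in> {0..<n} \<and> a < b. F a b)"
    unfolding pair_prod_def
  proof (rule prod.reindex_bij_witness[of _ "\<lambda>a. n - Suc a" "\<lambda>k. n - Suc k"])
    fix k assume k: "k \<in> {0..<n}"
    show "(\<Prod>b | b \<in> {0..<n} \<and> n - Suc k < b. F (n - Suc k) b) = (\<Prod>h\<in>{h \<in> {0..<n}. h < k}. F (n - Suc k) (n - Suc h))"
      by (rule prod.reindex_bij_witness[of _ "\<lambda>h. n - Suc h" "\<lambda>b. n - Suc b"]) (use k in auto)
  qed auto
  also have "\<dots> = (\<Prod>b\<in>{0..<n}. \<Prod>a | a \<in> {0..<n} \<and> a < b. F a b)"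
    by (rule prod.swap_restrict) simp_all
  finally show ?thesis by (simp only: pair_prod_def)
qed

text \<open>Apart from the eigenvalue, \<open>R_term\<close> interleaves two products: the weight of
  the start point and the weight of the point 1, ..., n.\<close>

lemma R_term_trig_weight:
  assumes f: "\<And>i. i < n \<Longrightarrow> \<eta> (n - i) = int (f i)" and \<alpha>: "\<alpha> = pi / (2 * m)"
  shows "R_term n m \<eta> k = (sin (real n * pi / m) / sin (pi / (2 * m))) ^ k *
    (trig_weight sin n \<alpha> (\<lambda>j. real (f j)) * trig_weight sin n \<alpha> (\<lambda>j. 1 + real j))"
proof -
  have eta: "of_int (\<eta> (Suc h)) = real (f (n - Suc h))" if "h < n" for h
  proof -
    have "n - (n - Suc h) = Suc h" using that by simp
    then show ?thesis using f[of "n - Suc h"] that by simp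
  qed
  let ?G = "\<lambda>h t. sin (pi * (of_int (\<eta> h) - of_int (\<eta> t)) / (2 * m)) * sin (pi * (real t - real h) / (2 * m)) *
        sin (pi * (of_int (\<eta> h) + of_int (\<eta> t)) / (2 * m)) * sin (pi * (real t + real h) / (2 * m))"
  let ?H = "\<lambda>h k. sin (\<alpha> * (real (f k) - real (f h))) * sin (\<alpha> * (real (f k) + real (f h)))"
  let ?E = "\<lambda>h k. sin (\<alpha> * ((1 + real k) - (1 + real h))) * sin (\<alpha> * ((1 + real k) + (1 + real h)))"
  have scale: "pi * x / (2 * m) = \<alpha> * x" for x by (simp add: \<alpha>)
  have "(\<Prod>h\<in>{1..n}. \<Prod>t\<in>{h<..n}. ?G h t) = pair_prod {0..<n} (\<lambda>h k. ?G (Suc h) (Suc k))"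
    by (rule prod_pairs_eq_pair_prod)
  also have "\<dots> = pair_prod {0..<n} (\<lambda>h k. ?H (n - Suc k) (n - Suc h) * ?E h k)"
  proof (rule pair_prod_cong)
    fix h k assume "h \<in> {0..<n}" "k \<in> {0..<n}"
    then have "h < n" "k < n" by simp_all
    have e: "real (Suc k) - real (Suc h) = (1 + real k) - (1 + real h)" "real (Suc k) + real (Suc h) = (1 + real k) + (1 + real h)"
      by simp_all
    show "?G (Suc h) (Suc k) = ?H (n - Suc k) (n - Suc h) * ?E h k"
      unfolding scale e eta[OF \<open>h < n\<close>] eta[OF \<open>k < n\<close>] by (simp only: mult_ac)
  qed
  also have "\<dots> = pair_prod {0..<n} ?H * pair_prod {0..<n} ?E"
    unfolding pair_prod_mult[of _ "\<lambda>h k. ?H (n - Suc k) (n - Suc h)" ?E] pair_prod_reverse[of n ?H] ..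
  finally have pairs: "(\<Prod>h\<in>{1..n}. \<Prod>t\<in>{h<..n}. ?G h t) = pair_prod {0..<n} ?H * pair_prod {0..<n} ?E" .
  have "(\<Prod>h\<in>{1..n}. sin (pi * of_int (\<eta> h) / (2 * m)) * sin (pi * real h / (2 * m))) =
      (\<Prod>j = 0..<n. sin (\<alpha> * real (f (n - Suc j))) * sin (\<alpha> * (1 + real j)))"
    unfolding prod_atLeast1_shift
  proof (rule prod.cong[OF refl])
    fix j assume "j \<in> {0..<n}"
    then have "j < n" by simp
    have e: "real (Suc j) = 1 + real j" by simp
    show "sin (pi * of_int (\<eta> (Suc j)) / (2 * m)) * sin (pi * real (Suc j) / (2 * m)) =
      sin (\<alpha> * real (f (n - Suc j))) * sin (\<alpha> * (1 + real j))"
      unfolding scale eta[OF \<open>j < n\<close>] e ..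
  qed
  also have "\<dots> = (\<Prod>j = 0..<n. sin (\<alpha> * real (f j))) * (\<Prod>j = 0..<n. sin (\<alpha> * (1 + real j)))"
    unfolding prod.distrib atLeast0LessThan prod.nat_diff_reindex[of "\<lambda>j. sin (\<alpha> * real (f j))"] ..
  finally have singles: "(\<Prod>h\<in>{1..n}. sin (pi * of_int (\<eta> h) / (2 * m)) * sin (pi * real h / (2 * m))) =
    (\<Prod>j = 0..<n. sin (\<alpha> * real (f j))) * (\<Prod>j = 0..<n. sin (\<alpha> * (1 + real j)))" .
  show ?thesis
    unfolding R_term_def pairs singles trig_weight_def by (simp only: mult_ac)
qed

lemma alcove_point_of_int:
  assumes n: "n \<ge> 1" and M: "real M = 2 * m" and \<eta>: "(\<lambda>i. real_of_int (\<eta> i)) \<in> alcove_B n m"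
  obtains f where "f \<in> alc n M" "(\<lambda>i. real_of_int (\<eta> i)) = alcove_point n f"
    "\<And>i. i < n \<Longrightarrow> \<eta> (n - i) = int (f i)" "weight n \<eta> = int (\<Sum>j = 0..<n. f j)"
proof -
  define f where "f i = (if i < n then nat (\<eta> (n - i)) else 0)" for i
  have last: "0 < \<eta> n" and dec: "\<eta> i > \<eta> (Suc i)" if "i \<in> {1..<n}" for i
    using \<eta> that by (auto simp: alcove_B_def)
  have last: "0 < \<eta> n" using \<eta> by (simp add: alcove_B_def)
  have pos: "0 < \<eta> (n - i)" if "i < n" for i
    using that
  proof (induction i)
    case (Suc i)
    have "Suc (n - Suc i) = n - i" using Suc.prems by simp
    then have "\<eta> (n - i) < \<eta> (n - Suc i)" using dec[of "n - Suc i"] Suc.prems by simp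
    then show ?case using Suc by simp
  qed (simp add: last)
  have eq: "\<eta> (n - i) = int (f i)" if "i < n" for i using pos[OF that] that by (simp add: f_def)
  have point: "(\<lambda>i. real_of_int (\<eta> i)) = alcove_point n f"
  proof
    fix i
    show "real_of_int (\<eta> i) = alcove_point n f i"
    proof (cases "i \<in> {1..n}")
      case True
      then have "n - i < n" "n - (n - i) = i" by auto
      then have "\<eta> i = int (f (n - i))" using eq[of "n - i"] by simp
      then show ?thesis using True by (simp add: alcove_point_def)
    next
      case False
      then have "real_of_int (\<eta> i) = 0" using \<eta> by (simp add: alcove_B_def vectors_def)
      then show ?thesis using False by (simp only: alcove_point_def if_False)
    qed
  qed
  have "f \<in> alc n M"
    using \<eta> unfolding point by (subst (asm) alcove_point_in_alcove_iff[OF n M]) (simp_all add: f_def)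
  moreover have "weight n \<eta> = int (\<Sum>j = 0..<n. f j)"
  proof -
    have "weight n \<eta> = (\<Sum>j = 0..<n. \<eta> (n - j))"
      unfolding weight_def by (rule sum.reindex_bij_witness[of _ "\<lambda>j. n - j" "\<lambda>i. n - i"]) auto
    also have "\<dots> = (\<Sum>j = 0..<n. int (f j))" by (rule sum.cong[OF refl]) (simp add: eq)
    finally show ?thesis by simp
  qed
  ultimately show thesis using that[of f] point eq by blast
qed

text \<open>The dominant eigenvalue contains the factor sin pi, so every eigenvalue with a nonzero
  determinant is 0. Geometrically, the alcove has the single lattice point 1, ..., n.\<close>

lemma card_walks_within_alcove_degenerate:
  assumes n: "n > 0" and M: "real M = 2 * m" "M = 2 * n" and f: "f \<in> alc n M" and k: "k > 0"
  shows "card (walks_within n (alcove_B n m) (alcove_point n f) k) = 0"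
proof -
  have M2: "2 * n \<le> M" and Mp: "M > 0" using M(2) n by simp_all
  have "2 * real n * (pi / real M) = pi" using M(2) n by simp
  then have zero: "eigval n (angle M (low_freq n)) = 0"
    unfolding eigval_low_freq[OF M2 n] by simp
  have "eigval n (angle M u) ^ k * mass n M u * sine_det n (angle M u) f = 0" if "u \<in> freqs n M e" for u e
  proof (cases "inj_on u {0..<n}")
    case True
    have "\<bar>eigval n (angle M u)\<bar> \<le> 0"
      using eigval_dominated(2)[OF that True M2 Mp] unfolding zero .
    then have "eigval n (angle M u) = 0" by simp
    then show ?thesis using k by simp
  next
    case False
    from sine_det_not_inj[OF this] show ?thesis by simp
  qed
  then have "(\<Sum>e<2. \<Sum>u\<in>freqs n M e. eigval n (angle M u) ^ k * mass n M u * sine_det n (angle M u) f) = 0"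
    by (intro sum.neutral ballI)
  moreover have "1 \<le> n" using n by simp
  ultimately have "real (card (walks_within n (alcove_B n m) (alcove_point n f) k)) = 0"
    by (simp only: card_walks_within_alcove[OF \<open>1 \<le> n\<close> M(1) f] mult_zero_right)
  then show ?thesis by simp
qed

text \<open>The fold leaves the weight unchanged, since sin(pi - a) = sin a, and changes the
  coordinate sum by \<open>M\<close> modulo 2; hence it multiplies the signed weight by
  \<open>(-1) ^ M\<close>.\<close>

lemma sum_alc_trig_weight:
  assumes n: "n > 0" and M: "real M = 2 * m" "2 * n < M" and \<alpha>: "\<alpha> = pi / (2 * m)"
  defines "W \<equiv> \<lambda>g. trig_weight sin n \<alpha> (\<lambda>j. real (g j))"
    and "V \<equiv> \<lambda>g. (-1) ^ (\<Sum>j = 0..<n. g j) * trig_weight sin n \<alpha> (\<lambda>j. real (g j))"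
  shows "sum W (alc n M) = sum W (incs n (Suc (M div 2))) + sum W (incs n ((M + 1) div 2))"
    and "sum V (alc n M) = sum V (incs n (Suc (M div 2))) + (-1) ^ M * sum V (incs n ((M + 1) div 2))"
proof -
  have Mp: "M > 0" using M(2) by simp
  have zero: "W g = 0" if "g 0 = 0" for g :: "nat \<Rightarrow> nat"
    unfolding W_def using n that by (intro trig_weight_eq_0[of 0]) simp_all
  have reflect: "W (g(n - 1 := M - g (n - 1))) = W g" if "g (n - 1) < M" for g :: "nat \<Rightarrow> nat"
    unfolding W_def
  proof (rule trig_weight_sin_cong)
    fix j assume "j < n"
    have "\<alpha> * real (M - g (n - 1)) = pi - \<alpha> * real (g (n - 1))"
    proof -
      have "real (M - g (n - 1)) = real M - real (g (n - 1))" using that by (simp add: of_nat_diff)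
      moreover have "\<alpha> * real M = pi" using Mp unfolding \<alpha> M(1)[symmetric] by simp
      ultimately show ?thesis by (simp only: right_diff_distrib)
    qed
    then have "sin (\<alpha> * real (M - g (n - 1))) = sin (\<alpha> * real (g (n - 1)))" by (simp only: sin_pi_minus)
    then show "sin (\<alpha> * real ((g(n - 1 := M - g (n - 1))) j)) = sin (\<alpha> * real (g j))"
      by (cases "j = n - 1") simp_all
  qed
  have "sum W (alc n M) = sum W (incs n (Suc (M div 2))) + 1 * sum W (incs n ((M + 1) div 2))"
  proof (rule sum_alc_reflect[OF n Mp])
    show "W g = 0" if "g 0 = 0" for g :: "nat \<Rightarrow> nat" by (rule zero[of g, OF that])
    show "W (g(n - 1 := M - g (n - 1))) = 1 * W g" if "g (n - 1) < M" for g :: "nat \<Rightarrow> nat"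
      unfolding mult_1_left by (rule reflect[of g, OF that])
  qed
  then show "sum W (alc n M) = sum W (incs n (Suc (M div 2))) + sum W (incs n ((M + 1) div 2))" by (simp only: mult_1_left)
  have V: "V g = (-1) ^ (\<Sum>j = 0..<n. g j) * W g" for g by (simp only: V_def W_def)
  show "sum V (alc n M) = sum V (incs n (Suc (M div 2))) + (-1) ^ M * sum V (incs n ((M + 1) div 2))"
  proof (rule sum_alc_reflect[OF n Mp])
    show "V g = 0" if "g 0 = 0" for g :: "nat \<Rightarrow> nat" unfolding V zero[of g, OF that] by (rule mult_zero_right)
    fix g :: "nat \<Rightarrow> nat" assume lt: "g (n - 1) < M"
    let ?g = "g(n - 1 := M - g (n - 1))" and ?R = "\<Sum>j\<in>{0..<n} - {n - 1}. g j"
    have rem: "(\<Sum>j = 0..<n. h j) = h (n - 1) + (\<Sum>j\<in>{0..<n} - {n - 1}. h j)" for h :: "nat \<Rightarrow> nat"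
      using n by (intro sum.remove) simp_all
    have "(\<Sum>j\<in>{0..<n} - {n - 1}. ?g j) = ?R" by (rule sum.cong[OF refl]) simp
    then have "(\<Sum>j = 0..<n. ?g j) = M - g (n - 1) + ?R" unfolding rem[of ?g] by (simp only: fun_upd_same)
    then have "(\<Sum>j = 0..<n. ?g j) + 2 * g (n - 1) = M + (\<Sum>j = 0..<n. g j)"
      unfolding rem[of g] using lt by simp
    then have "(-1 :: real) ^ ((\<Sum>j = 0..<n. ?g j) + 2 * g (n - 1)) = (-1) ^ (M + (\<Sum>j = 0..<n. g j))" by (rule arg_cong)
    then have "(-1 :: real) ^ (\<Sum>j = 0..<n. ?g j) = (-1) ^ M * (-1) ^ (\<Sum>j = 0..<n. g j)"
      by (simp only: power_add power_mult) simp
    then show "V ?g = (-1) ^ M * V g" unfolding V reflect[of g, OF lt] by (simp only: mult.assoc)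
  qed
qed

theorem theorem26:
  fixes n :: nat and m :: real and \<eta> :: "nat \<Rightarrow> int"
  assumes "n \<ge> 1"
    and "m > 0"
    and "m \<in> \<int> \<or> half_integer m"
    and "(\<lambda>i. real_of_int (\<eta> i)) \<in> alcove_B n m"
  defines "N \<equiv> (\<lambda>k. real (card (walks_within n (alcove_B n m) (\<lambda>i. real_of_int (\<eta> i)) k)))"
  shows "(m \<in> \<int> \<and> (even \<lfloor>m\<rfloor> \<longleftrightarrow> even n) \<longrightarrow>
      N \<sim>[sequentially] (\<lambda>k.
        4 ^ (n\<^sup>2) / (2 * (2 * m) ^ n) * R_term n m \<eta> k *
        (A_term n m m + A_term n m (m - 1) +
         (-1) powi (weight n \<eta> + int k + int ((n + 1) choose 2)) * B_term n m m *
           (\<Prod>h\<in>{1..n}.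
              cos (pi * (m - real n + 2 * real h - 1) / (4 * m)) *
              sin (pi * (m - real n + 2 * real h) / (4 * m)) / D_term m h) +
         (-1) powi (weight n \<eta> + int k + int (n choose 2)) * B_term n m (m - 1) *
           (\<Prod>h\<in>{1..n}.
              sin (pi * (m - real n + 2 * real h - 2) / (4 * m)) *
              cos (pi * (m - real n + 2 * real h - 1) / (4 * m)) / D_term m h))))
    \<and> (m \<in> \<int> \<and> (even \<lfloor>m\<rfloor> \<longleftrightarrow> odd n) \<longrightarrow>
      N \<sim>[sequentially] (\<lambda>k.
        4 ^ (n\<^sup>2) / (2 * (2 * m) ^ n) * R_term n m \<eta> k *
        (A_term n m m + A_term n m (m - 1) +
         (-1) powi (weight n \<eta> + int k + int (n choose 2)) * B_term n m m *
           (\<Prod>h\<in>{1..n}.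
              sin (pi * (m - real n + 2 * real h - 1) / (4 * m)) *
              cos (pi * (m - real n + 2 * real h) / (4 * m)) / D_term m h) +
         (-1) powi (weight n \<eta> + int k + int ((n + 1) choose 2)) * B_term n m (m - 1) *
           (\<Prod>h\<in>{1..n}.
              cos (pi * (m - real n + 2 * real h - 2) / (4 * m)) *
              sin (pi * (m - real n + 2 * real h - 1) / (4 * m)) / D_term m h))))
    \<and> (half_integer m \<longrightarrow>
      N \<sim>[sequentially] (\<lambda>k.
        4 ^ (n\<^sup>2) / (2 * m) ^ n * R_term n m \<eta> k * A_term n m (real_of_int \<lfloor>m\<rfloor>)))"
proof -
  have n: "n > 0" and m: "m > 0" using assms(1,2) by simp_all
  obtain M :: nat where M: "real M = 2 * m"
  proof -
    obtain z :: int where z: "2 * m = of_int z"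
    proof -
      consider a :: int where "m = of_int a" | j :: int where "m = of_int j / 2"
        using assms(3) unfolding half_integer_def by (auto elim: Ints_cases)
      then show thesis
      proof cases
        case (1 a)
        then have "2 * m = of_int (2 * a)" by simp
        then show thesis by (rule that)
      next
        case (2 j)
        then have "2 * m = of_int j" by simp
        then show thesis by (rule that)
      qed
    qed
    then have "0 < z" using m by simp
    then have "real (nat z) = 2 * m" using z by simp
    then show thesis by (rule that)
  qed
  define \<alpha> where "\<alpha> = pi / (2 * m)"
  have \<alpha>M: "\<alpha> = pi / real M" unfolding \<alpha>_def M ..
  obtain f where f: "f \<in> alc n M" and point: "(\<lambda>i. real_of_int (\<eta> i)) = alcove_point n f"
    and eta: "\<And>i. i < n \<Longrightarrow> \<eta> (n - i) = int (f i)" and weight: "weight n \<eta> = int (\<Sum>j = 0..<n. f j)"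
    using alcove_point_of_int[OF assms(1) M assms(4)] by blast
  have M2: "2 * n \<le> M" by (rule alc_nonempty_bound[OF f n])
  define W where "W z = trig_weight sin n \<alpha> z" for z
  let ?F = "\<Sum>j = 0..<n. f j" and ?D = "W (\<lambda>j. 1 + real j)"
  let ?\<rho> = "eigval n (angle M (low_freq n))"
  have \<rho>: "?\<rho> = sin (real n * pi / m) / sin (pi / (2 * m))"
  proof -
    have "2 * real n * (pi / real M) = real n * pi / m" unfolding M by simp
    then show ?thesis unfolding eigval_low_freq[OF M2 n] M by simp
  qed
  have R: "R_term n m \<eta> k = ?\<rho> ^ k * (W (\<lambda>j. real (f j)) * ?D)" for k
    unfolding \<rho> W_def by (rule R_term_trig_weight[of n \<eta> f, OF eta \<alpha>_def])
  have N: "N = (\<lambda>k. real (card (walks_within n (alcove_B n m) (alcove_point n f) k)))"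
    unfolding N_def point ..
  show ?thesis
  proof (cases "M = 2 * n")
    \<comment> \<open>Both sides are 0 for all \<open>k >= 1\<close>, so they are eventually equal.
      \<open>k = 0\<close> has to be left out, since the zero eigenvalue then contributes
      \<open>0 ^ 0 = 1\<close>.\<close>
    case True
    have "N k = 0" if "k \<ge> 1" for k
      unfolding N using card_walks_within_alcove_degenerate[OF n M True f, of k] that by simp
    moreover have "R_term n m \<eta> k = 0" if "k \<ge> 1" for k
    proof -
      have "m = real n" using M True by simp
      then have "sin (real n * pi / m) = 0" using n by simp
      then show ?thesis unfolding R \<rho> using that by simp
    qed
    ultimately have degenerate: "N \<sim>[sequentially] (\<lambda>k. c * R_term n m \<eta> k * E k)" for c E
      by (intro asymp_equiv_refl_ev eventually_sequentiallyI[of 1]) simp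
    show ?thesis by (intro conjI impI; rule degenerate)
  next
    case False
    then have M3: "2 * n < M" using M2 by simp
    have bound: "2 * real n - 1 < 2 * m"
    proof -
      have "real (2 * n) < real M" using M3 by simp
      then show ?thesis unfolding M by simp
    qed
    define P where "P = (\<Sum>g\<in>alc n M. W (\<lambda>j. real (g j)))"
    define S where "S = (\<Sum>g\<in>alc n M. (-1) ^ (\<Sum>j = 0..<n. g j) * W (\<lambda>j. real (g j)))"
    define T where "T c = (\<Sum>g\<in>incs n (Suc c). (-1) ^ (\<Sum>j = 0..<n. g j) * W (\<lambda>j. real (g j)))" for c
    note ctx = n m \<alpha>_def bound
    have asymp: "N \<sim>[sequentially] E"
      if "\<And>k. E k = 4 ^ (n\<^sup>2) / (2 * (2 * m) ^ n) * (?\<rho> ^ k * W (\<lambda>j. real (f j))) * (P + (-1) ^ (k + ?F) * S)" for E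
    proof -
      have "E = (\<lambda>k. 4 ^ (n\<^sup>2) / (2 * (2 * m) ^ n) * (?\<rho> ^ k * W (\<lambda>j. real (f j))) * (P + (-1) ^ (k + ?F) * S))"
        by (rule ext) (rule that)
      then show ?thesis
        unfolding N P_def S_def W_def by (simp only:) (rule card_walks_asymp[OF n M M3 f \<alpha>M])
    qed
    have incs_P: "(\<Sum>g\<in>incs n (Suc c). W (\<lambda>j. real (g j))) = ?D * A_term n m (real c)" for c
      unfolding W_def by (rule sum_trig_weight_incs[OF ctx])
    have P: "P = ?D * A_term n m (real (M div 2)) + (\<Sum>g\<in>incs n ((M + 1) div 2). W (\<lambda>j. real (g j)))"
      unfolding P_def incs_P[symmetric] unfolding W_def by (rule sum_alc_trig_weight(1)[OF n M M3 \<alpha>_def])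
    have S: "S = T (M div 2) + (-1) ^ M * (\<Sum>g\<in>incs n ((M + 1) div 2). (-1) ^ (\<Sum>j = 0..<n. g j) * W (\<lambda>j. real (g j)))"
      unfolding S_def T_def W_def by (rule sum_alc_trig_weight(2)[OF n M M3 \<alpha>_def])
    have T_even: "T c = ?D * ((-1) ^ (Suc n choose 2) * (B_term n m (real c) *
      (\<Prod>h\<in>{1..n}. cos (pi * (real c - real n + 2 * real h - 1) / (4 * m)) *
         sin (pi * (real c - real n + 2 * real h) / (4 * m)) / D_term m h)))" if "c = n + 2 * q" for c q
      unfolding T_def W_def by (rule sum_trig_weight_incs_signed_even[OF ctx that])
    have T_odd: "T c = ?D * ((-1) ^ (n choose 2) * (B_term n m (real c) *
      (\<Prod>h\<in>{1..n}. sin (pi * (real c - real n + 2 * real h - 1) / (4 * m)) *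
         cos (pi * (real c - real n + 2 * real h) / (4 * m)) / D_term m h)))" if "c = n + 2 * q + 1" for c q
      unfolding T_def W_def by (rule sum_trig_weight_incs_signed_odd[OF ctx that])
    have sign: "(-1 :: real) powi (weight n \<eta> + int k + int c) = (-1) ^ (k + ?F) * (-1) ^ c" for k c
    proof -
      have "weight n \<eta> + int k + int c = int (k + ?F + c)" unfolding weight by simp
      then show ?thesis by (simp only: power_int_of_nat power_add)
    qed
    have algebra: "c * (p * (w * d)) * (a1 + a2 + (s * e1) * b1 * x1 + (s * e2) * b2 * x2) =
        c * (p * w) * ((d * a1 + d * a2) + s * (d * (e1 * (b1 * x1)) + d * (e2 * (b2 * x2))))"
      for c p w d a1 a2 s e1 e2 b1 b2 x1 x2 :: real
      by (simp add: algebra_simps)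
    \<comment> \<open>\<open>c\<close> is \<open>m - 1\<close>: the lower half of the fold has parts
      up to \<open>m\<close>, the upper half up to \<open>m - 1\<close>, and \<open>M\<close> is
      even, so the signed sums add.\<close>
    have integral: "\<exists>c. m = real (Suc c) \<and> \<lfloor>m\<rfloor> = int (Suc c) \<and> n \<le> c \<and>
      P = ?D * A_term n m m + ?D * A_term n m (m - 1) \<and> S = T (Suc c) + T c" if "m \<in> \<int>"
    proof -
      obtain z where z: "m = of_int z" using \<open>m \<in> \<int>\<close> by (rule Ints_cases)
      then have "0 < z" using m by simp
      then obtain c where c: "z = int (Suc c)" by (metis Suc_pred zero_less_nat_eq nat_0_le less_imp_le)
      have mc: "m = real (Suc c)" unfolding z c by simp
      have "real M = real (2 * Suc c)" unfolding M mc by simp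
      then have Mc: "M = 2 * Suc c" by (simp only: of_nat_eq_iff)
      have div: "M div 2 = Suc c" "(M + 1) div 2 = Suc c" unfolding Mc by simp_all
      have "(-1 :: real) ^ M = 1" unfolding Mc by simp
      then have "S = T (Suc c) + T c" unfolding S div T_def by simp
      moreover have "real c = m - 1" unfolding mc by simp
      then have "P = ?D * A_term n m m + ?D * A_term n m (m - 1)"
        unfolding P div incs_P by (simp only: mc[symmetric])
      moreover have "\<lfloor>m\<rfloor> = int (Suc c)" unfolding z c by simp
      moreover have "n \<le> c" using M3 unfolding Mc by simp
      ultimately show ?thesis using mc by blast
    qed
    show ?thesis (is "(_ \<longrightarrow> ?A) \<and> (_ \<longrightarrow> ?B) \<and> (_ \<longrightarrow> ?C)")
    proof (intro conjI impI)
      assume *: "m \<in> \<int> \<and> (even \<lfloor>m\<rfloor> \<longleftrightarrow> even n)"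
      then obtain c where c: "m = real (Suc c)" "\<lfloor>m\<rfloor> = int (Suc c)" "n \<le> c"
        "P = ?D * A_term n m m + ?D * A_term n m (m - 1)" "S = T (Suc c) + T c"
        using integral by blast
      have "even (Suc c) \<longleftrightarrow> even n" using * unfolding c(2) by simp
      then have "even (Suc c - n)" using c(3) by (auto simp: even_diff_nat)
      then obtain q where q: "Suc c - n = 2 * q" by (rule evenE)
      \<comment> \<open>\<open>n \<le> c\<close> forces \<open>q\<close> to be positive, so
        \<open>q - 1\<close> is not truncated. Relative to \<open>n\<close>, \<open>c\<close> has
        the parity opposite to \<open>Suc c\<close>, which is why the second oscillating term takes
        the odd form.\<close>
      then have q1: "Suc c = n + 2 * q" and q2: "c = n + 2 * (q - 1) + 1" using c(3) by simp_all
      have rc: "real c = m - 1" unfolding c(1) by simp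
      have e: "m - real n + 2 * real h - 1 - 1 = m - real n + 2 * real h - 2"
        "m - 1 - real n + 2 * real h = m - real n + 2 * real h - 1" for h by simp_all
      show ?A
        by (rule asymp, unfold R sign c(4,5) T_even[OF q1] T_odd[OF q2] rc c(1)[symmetric] e Suc_eq_plus1[symmetric]) (rule algebra)
    next
      assume *: "m \<in> \<int> \<and> (even \<lfloor>m\<rfloor> \<longleftrightarrow> odd n)"
      then obtain c where c: "m = real (Suc c)" "\<lfloor>m\<rfloor> = int (Suc c)" "n \<le> c"
        "P = ?D * A_term n m m + ?D * A_term n m (m - 1)" "S = T (Suc c) + T c"
        using integral by blast
      have "even c \<longleftrightarrow> even n" using * unfolding c(2) by simp
      then have "even (c - n)" using c(3) by (auto simp: even_diff_nat)
      then obtain q where q: "c - n = 2 * q" by (rule evenE)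
      then have q1: "Suc c = n + 2 * q + 1" and q2: "c = n + 2 * q" using c(3) by simp_all
      have rc: "real c = m - 1" unfolding c(1) by simp
      have e: "m - real n + 2 * real h - 1 - 1 = m - real n + 2 * real h - 2"
        "m - 1 - real n + 2 * real h = m - real n + 2 * real h - 1" for h by simp_all
      show ?B
        by (rule asymp, unfold R sign c(4,5) T_odd[OF q1] T_even[OF q2] rc c(1)[symmetric] e Suc_eq_plus1[symmetric]) (rule algebra)
    next
      assume "half_integer m"
      then obtain j :: int where j: "odd j" "m = of_int j / 2" unfolding half_integer_def by blast
      have "of_int j = (of_int (int M) :: real)" using M unfolding j(2) by simp
      then have "j = int M" by (simp only: of_int_eq_iff)
      then have "odd M" using j(1) by simp
      then obtain c where c: "M = 2 * c + 1" by (rule oddE)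
      have div: "M div 2 = c" "(M + 1) div 2 = Suc c" unfolding c by simp_all
      have floor: "real_of_int \<lfloor>m\<rfloor> = real c"
      proof -
        have "m = real c + 1/2" using M unfolding c by simp
        then have "\<lfloor>m\<rfloor> = int c" by (intro floor_unique) simp_all
        then show ?thesis by simp
      qed
      have "(-1 :: real) ^ M = -1" unfolding c by simp
      \<comment> \<open>Both halves of the fold have the same range, and for odd \<open>M\<close>
        their signed sums cancel. The unsigned sums double, which removes the 2 from the denominator
        of the prefactor.\<close>
      then have S0: "S = 0" unfolding S div T_def by simp
      have P2: "P = 2 * (?D * A_term n m (real c))" unfolding P div incs_P by simp
      have algebra2: "a / b * (p * (w * d)) * x = a / (2 * b) * (p * w) * (2 * (d * x) + s * 0)"
        for a b p w d x s :: real by simp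
      show ?C
        by (rule asymp) (unfold R floor S0 P2, rule algebra2)
    qed
  qed
qed

end
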